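(* Let $\lambda\ge0$, $p_0=\frac{2\lambda}{2\lambda+1}$, $p_0\le p<\infty$ with $p>0$, $p\le\ell\le\infty$, and $\delta=\frac1p-\frac1\ell$ (with $1/\infty=0$). Then for every $f\in A^p_\lambda(\mathbb{D})$, $$M_\ell(f;r)=o\left((1-r)^{-\delta(2\lambda+1)-1/p}\right)\quad\text{as } r\to1-,$$ and there is a constant $c>0$, independent of $f$ and $r$, such that $$M_\ell(f;r)\le c\,(1-r)^{-\delta(2\lambda+1)-1/p}\|f\|_{A^p_\lambda},\qquad 0\le r<1.$$
   Context: Fix $\lambda\ge0$; $\mathbb{D}$ is the open unit disk in $\mathbb{C}$. For a complex-valued function $f$ put $D_{\bar z}f(z)=\partial_{\bar z}f(z)-\lambda\frac{f(z)-f(\bar z)}{z-\bar z}$, $z=x+iy$ (at real points the quotient is read as its limit $-i\,\partial_y f$). A $C^2$ (real sense) function $f:\mathbb{D}\to\mathbb{C}$ is $\lambda$-analytic if $D_{\bar z}f=0$ in $\mathbb{D}$. $d\sigma_\lambda(z)=c_\lambda|y|^{2\lambda}dx\,dy$, $z=x+iy$, with $c_\lambda=\frac{\Gamma(\lambda+2)}{\Gamma(\lambda+1/2)\Gamma(1/2)}$. For $0<p<\infty$, $A^p_\lambda(\mathbb{D})$ is the set of $\lambda$-analytic functions $f$ on $\mathbb{D}$ with $\|f\|_{A^p_\lambda}=\left(\int_{\mathbb{D}}|f|^pd\sigma_\lambda\right)^{1/p}<\infty$. $dm_\lambda(\theta)=\tilde c_\lambda|\sin\theta|^{2\lambda}d\theta$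 on $[-\pi,\pi]$, $\tilde c_\lambda=c_\lambda/(2\lambda+2)$. For $0<p<\infty$, $M_p(f;r)=\left\{\int_{-\pi}^{\pi}|f(re^{i\theta})|^pdm_\lambda(\theta)\right\}^{1/p}$, and $M_\infty(f;r)=\sup_\theta|f(re^{i\theta})|$, $0\le r<1$. *)

theory Defs
  imports "HOL-Analysis.Analysis" "HOL-Library.Landau_Symbols"
begin

abbreviation unit_disk :: "complex set"  (\<open>\<bbbD>\<close>)
  where "\<bbbD> \<equiv> ball 0 1"

text \<open>
  Twice continuously differentiable in the real sense on an open set: \<open>complex\<close> is regarded as a
  real normed space, so \<open>\<Rightarrow>\<^sub>L\<close> is the space of bounded real-linear maps.
\<close>

definition C2_on :: "complex set \<Rightarrow> (complex \<Rightarrow> complex) \<Rightarrow> bool" where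
  "C2_on S f \<longleftrightarrow>
     (\<exists>(f' :: complex \<Rightarrow> complex \<Rightarrow>\<^sub>L complex)
       (f'' :: complex \<Rightarrow> complex \<Rightarrow>\<^sub>L complex \<Rightarrow>\<^sub>L complex).
        (\<forall>z\<in>S. (f has_derivative blinfun_apply (f' z)) (at z)) \<and>
        (\<forall>z\<in>S. (f' has_derivative blinfun_apply (f'' z)) (at z)) \<and>
        continuous_on S f'')"

definition partial_x :: "(complex \<Rightarrow> complex) \<Rightarrow> complex \<Rightarrow> complex" where
  "partial_x f z = vector_derivative (\<lambda>x. f (Complex x (Im z))) (at (Re z))"

definition partial_y :: "(complex \<Rightarrow> complex) \<Rightarrow> complex \<Rightarrow> complex" where
  "partial_y f z = vector_derivative (\<lambda>y. f (Complex (Re z) y)) (at (Im z))"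

definition partial_zbar :: "(complex \<Rightarrow> complex) \<Rightarrow> complex \<Rightarrow> complex" where
  "partial_zbar f z = (partial_x f z + \<i> * partial_y f z) / 2"

text \<open>On the real axis the difference quotient is replaced by its limit as \<open>Im z\<close> tends to 0.\<close>

definition reflection_quotient :: "(complex \<Rightarrow> complex) \<Rightarrow> complex \<Rightarrow> complex" where
  "reflection_quotient f z =
     (if Im z = 0 then - \<i> * partial_y f z else (f z - f (cnj z)) / (z - cnj z))"

definition D_zbar :: "real \<Rightarrow> (complex \<Rightarrow> complex) \<Rightarrow> complex \<Rightarrow> complex" where
  "D_zbar lam f z = partial_zbar f z - of_real lam * reflection_quotient f z"

definition lambda_analytic :: "real \<Rightarrow> (complex \<Rightarrow> complex) \<Rightarrow> bool" where
  "lambda_analytic lam f \<longleftrightarrow> C2_on \<bbbD> f \<and> (\<forall>z\<in>\<bbbD>. D_zbar lam f z = 0)"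

definition c_const :: "real \<Rightarrow> real" where
  "c_const lam = Gamma (lam + 2) / (Gamma (lam + 1/2) * Gamma (1/2))"

text \<open>
  Since \<open>0 powr 0 = 0\<close>, for \<open>lam = 0\<close> the densities below vanish where \<open>Im z = 0\<close>, resp.
  \<open>sin \<theta> = 0\<close>, instead of being constant; these are null sets, so the measures are the intended ones.
\<close>

definition sigma_measure :: "real \<Rightarrow> complex measure" where
  "sigma_measure lam =
     density lborel (\<lambda>z. ennreal (c_const lam * \<bar>Im z\<bar> powr (2 * lam)))"

definition m_measure :: "real \<Rightarrow> real measure" where
  "m_measure lam =
     density lborel (\<lambda>\<theta>. ennreal (c_const lam / (2 * lam + 2) * \<bar>sin \<theta>\<bar> powr (2 * lam)))"

definition bergman_space :: "real \<Rightarrow> real \<Rightarrow> (complex \<Rightarrow> complex) set" where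
  "bergman_space p lam =
     {f. lambda_analytic lam f \<and>
         set_integrable (sigma_measure lam) \<bbbD> (\<lambda>z. norm (f z) powr p)}"

definition bergman_norm :: "real \<Rightarrow> real \<Rightarrow> (complex \<Rightarrow> complex) \<Rightarrow> real" where
  "bergman_norm p lam f =
     (LINT z:\<bbbD>|sigma_measure lam. norm (f z) powr p) powr (1 / p)"

definition integral_mean :: "real \<Rightarrow> ereal \<Rightarrow> (complex \<Rightarrow> complex) \<Rightarrow> real \<Rightarrow> real" where
  "integral_mean lam l f r =
     (if l = \<infinity> then (SUP \<theta>\<in>{-pi..pi}. norm (f (of_real r * cis \<theta>)))
      else (LINT \<theta>:{-pi..pi}|m_measure lam.
              norm (f (of_real r * cis \<theta>)) powr real_of_ereal l) powr (1 / real_of_ereal l))"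

end

theory Submission
  imports Defs
begin

text \<open>
  Everything follows from a local sub-mean-value inequality for \<open>\<bar>f\<bar>\<^sup>p\<close>. Let \<open>P(z, R)\<close> consist of the
  points whose real part and whose \<open>\<bar>Im\<bar>\<close> differ by at most \<open>R\<close> from those of \<open>z\<close>; this is a square around
  \<open>z\<close> together with its mirror image. Then (\<open>sub_mean_value\<close>)
    \<open>\<bar>f z\<bar>\<^sup>p R\<^sup>2 (\<bar>Im z\<bar> + R)\<^bsup>2\<lambda>\<^esup> \<le> C \<integral> \<bar>f\<bar>\<^sup>p d\<sigma>\<^sub>\<lambda>\<close>, the integral being over \<open>P(z, R)\<close>.
  Put \<open>R = (1 - r) / 4\<close> and \<open>z = r e\<^bsup>i\<theta>\<^esup>\<close>. All the sets \<open>P(z, R)\<close> lie in one annulus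
  \<open>A\<^sub>r\<close> adjacent to the unit circle, whose inner radius tends to 1 with \<open>r\<close>. Dropping \<open>\<bar>Im z\<bar>\<close> gives the bound
  \<open>(1 - r)\<^bsup>2\<lambda> + 2\<^esup> \<bar>f z\<bar>\<^sup>p \<le> C \<integral> \<bar>f\<bar>\<^sup>p d\<sigma>\<^sub>\<lambda>\<close> over \<open>A\<^sub>r\<close>. Integrating in \<open>\<theta>\<close> and exchanging the integrals
  gives \<open>(1 - r) M\<^sub>p(f; r)\<^sup>p \<le> C \<integral> \<bar>f\<bar>\<^sup>p d\<sigma>\<^sub>\<lambda>\<close> over \<open>A\<^sub>r\<close>, because a given point belongs to \<open>P(r e\<^bsup>i\<theta>\<^esup>, R)\<close> only
  for \<open>\<theta>\<close> in a set of measure \<open>O(R)\<close>, and the weight \<open>\<bar>sin \<theta>\<bar>\<^bsup>2\<lambda>\<^esup>\<close> is absorbed by \<open>(\<bar>Im z\<bar> + R)\<^bsup>2\<lambda>\<^esup>\<close>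
  (\<open>circle_bounds\<close>). The means of order \<open>\<ell> > p\<close> follow from \<open>\<bar>f\<bar>\<^bsup>\<ell>\<^esup> \<le> (sup \<bar>f\<bar>)\<^bsup>\<ell> - p\<^esup> \<bar>f\<bar>\<^sup>p\<close>. The integral over
  \<open>A\<^sub>r\<close> is at most the \<open>p\<close>-th power of the norm, and it tends to 0 as \<open>r \<rightarrow> 1\<close>; this is the little-o claim.

  The sub-mean-value inequality follows from the argument of Hardy and Littlewood as soon as a bounded
  solution has controlled oscillation: at a point \<open>z\<^sub>1\<close> maximising \<open>\<bar>f\<bar>\<close> times a power of the distance to the
  boundary of \<open>P(z, R)\<close>, \<open>\<bar>f\<bar>\<close> stays above \<open>\<bar>f z\<^sub>1\<bar> / 2\<close> on a box of comparable size, and that box alone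
  contributes enough to the integral.

  The oscillation is controlled by an interior gradient bound (\<open>dunkl_gradient_x\<close>, \<open>dunkl_odd_part_bound\<close>),
  which is obtained from maximum principles and therefore needs neither kernels nor representation formulas. Let
  \<open>L = \<partial>\<^sub>x\<^sup>2 + \<partial>\<^sub>y\<^sup>2 + (2\<lambda>/y) \<partial>\<^sub>y\<close> and \<open>W(z) = \<bar>f(z)\<bar>\<^sup>2 + \<bar>f(cnj z)\<bar>\<^sup>2\<close>. Differentiating the equation of \<open>f\<close> gives
  \<open>L f = \<lambda> (f(z) - f(cnj z)) / y\<^sup>2\<close>, and in the sum over \<open>z\<close> and \<open>cnj z\<close> the right-hand side contributes a
  non-negative term, so that \<open>L W\<close> is at least twice the sum of the squared gradients. Since the equation is invariant under
  horizontal translations, the same holds for the horizontal difference quotients of \<open>f\<close>. Bernstein's method, that is, the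
  maximum principle for \<open>\<phi>\<^sup>2 W\<^sub>g + k W\<close> with \<open>g\<close> such a quotient, \<open>W\<^sub>g\<close> its sum of squares, \<open>\<phi>\<close> a cut-off function and \<open>k\<close>
  a large constant, bounds \<open>\<partial>\<^sub>x f\<close>. The first-order equation then gives \<open>\<partial>\<^sub>y f\<close>, once
  \<open>(f(z) - f(cnj z)) / y\<close> is bounded; for fixed \<open>x\<close> the odd part of \<open>f\<close> solves an ordinary differential equation
  in \<open>y\<close> with integrating factor \<open>y\<^bsup>2\<lambda>\<^esup>\<close>.
\<close>

section \<open>Partial derivatives along the coordinate lines\<close>

text \<open>
  The derivative in the direction \<open>e\<close> is kept as a relation along a line, so that only the values of
  \<open>F\<close> on that line enter: the maximum principle needs nothing but pure second derivatives, for functions that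
  are built from \<open>f\<close>, its reflection and its translates.
\<close>
definition has_partial :: "complex \<Rightarrow> (complex \<Rightarrow> 'a::real_normed_vector) \<Rightarrow> complex \<Rightarrow> 'a \<Rightarrow> bool" where
  "has_partial e F z d \<longleftrightarrow> ((\<lambda>t. F (z + of_real t * e)) has_vector_derivative d) (at 0)"

lemma has_partial_line:
  "has_partial e F (z + of_real t * e) d \<longleftrightarrow> ((\<lambda>s. F (z + of_real s * e)) has_vector_derivative d) (at t)"
proof -
  have "((\<lambda>s. F (z + of_real s * e)) has_vector_derivative d) (at t)
     \<longleftrightarrow> (((\<lambda>s. F (z + of_real s * e)) \<circ> (\<lambda>s. t + s)) has_vector_derivative d) (at 0)"
    (is "?A \<longleftrightarrow> ?B")
  proof
    assume ?A
    then have "((\<lambda>s. F (z + of_real s * e)) has_vector_derivative d) (at (t + 0))" by simp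
    moreover have "((\<lambda>s. t + s) has_vector_derivative 1) (at 0)"
      by (auto intro!: derivative_eq_intros)
    ultimately show ?B
      using vector_diff_chain_at[of "\<lambda>s. t + s" 1 0 "\<lambda>s. F (z + of_real s * e)" d] by simp
  next
    assume B: ?B
    have "((\<lambda>s. s - t) has_vector_derivative 1) (at t)"
      by (auto intro!: derivative_eq_intros)
    then have "((((\<lambda>s. F (z + of_real s * e)) \<circ> (\<lambda>s. t + s)) \<circ> (\<lambda>s. s - t)) has_vector_derivative 1 *\<^sub>R d) (at t)"
      using B by (intro vector_diff_chain_at) auto
    then show ?A by (simp add: o_def)
  qed
  then show ?thesis
    by (simp add: has_partial_def o_def algebra_simps)
qed

lemma has_partial_unique: "has_partial e F z d \<Longrightarrow> has_partial e F z d' \<Longrightarrow> d = d'"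
  unfolding has_partial_def by (rule vector_derivative_unique_at)

lemma has_partial_const: "has_partial e (\<lambda>z. c) z 0"
  by (simp add: has_partial_def)

lemma has_partial_add: "has_partial e F z d \<Longrightarrow> has_partial e G z d' \<Longrightarrow> has_partial e (\<lambda>z. F z + G z) z (d + d')"
  unfolding has_partial_def by (rule has_vector_derivative_add)

lemma has_partial_diff: "has_partial e F z d \<Longrightarrow> has_partial e G z d' \<Longrightarrow> has_partial e (\<lambda>z. F z - G z) z (d - d')"
  unfolding has_partial_def by (rule has_vector_derivative_diff)

lemma has_partial_bilinear:
  assumes "bounded_bilinear B" "has_partial e F z d" "has_partial e G z d'"
  shows "has_partial e (\<lambda>z. B (F z) (G z)) z (B (F z) d' + B d (G z))"
  using bounded_bilinear.has_vector_derivative[OF assms(1), OF assms(2,3)[unfolded has_partial_def]]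
  by (simp add: has_partial_def)

lemma has_partial_linear:
  assumes "bounded_linear B" "has_partial e F z d"
  shows "has_partial e (\<lambda>z. B (F z)) z (B d)"
  using bounded_linear.has_vector_derivative[OF assms(1), OF assms(2)[unfolded has_partial_def]]
  by (simp add: has_partial_def)

lemma has_partial_cong:
  assumes "has_partial e F z d" "open S" "z \<in> S" "\<And>w. w \<in> S \<Longrightarrow> F w = G w"
  shows "has_partial e G z d"
proof -
  have "((\<lambda>t. z + of_real t * e) \<longlongrightarrow> z + of_real 0 * e) (at (0::real))"
    by (intro tendsto_intros)
  then have ev: "eventually (\<lambda>t::real. z + of_real t * e \<in> S) (at 0)"
    using assms(2,3) by (auto simp: tendsto_def)
  then have "eventually (\<lambda>t::real. F (z + of_real t * e) = G (z + of_real t * e)) (at 0)"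
    by eventually_elim (use assms(4) in auto)
  then have "eventually (\<lambda>t::real. F (z + of_real t * e) = G (z + of_real t * e)) (nhds 0)"
    using assms(3,4) by (auto simp: eventually_at_filter elim!: eventually_mono)
  then show ?thesis
    using assms(1) assms(3,4) has_vector_derivative_cong_ev[where f="\<lambda>t. F (z + of_real t * e)" and g="\<lambda>t. G (z + of_real t * e)" and x=0 and S=UNIV]
    unfolding has_partial_def by (auto elim!: eventually_mono)
qed

lemma has_partial_shift: "has_partial e F (z + w) d \<Longrightarrow> has_partial e (\<lambda>z. F (z + w)) z d"
  unfolding has_partial_def by (simp add: algebra_simps)

lemma has_partial_cnj_re: "has_partial 1 F (cnj z) d \<Longrightarrow> has_partial 1 (\<lambda>z. F (cnj z)) z d"
  unfolding has_partial_def by simp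

lemma has_partial_cnj_im:
  assumes "has_partial \<i> F (cnj z) d"
  shows "has_partial \<i> (\<lambda>z. F (cnj z)) z (- d)"
proof -
  have "((\<lambda>t::real. - t) has_vector_derivative - 1) (at 0)"
    by (auto intro!: derivative_eq_intros)
  moreover have "((\<lambda>t. F (cnj z + of_real t * \<i>)) has_vector_derivative d) (at (- 0))"
    using assms by (simp add: has_partial_def)
  ultimately have "(((\<lambda>t. F (cnj z + of_real t * \<i>)) \<circ> (\<lambda>t. -t)) has_vector_derivative (-1) *\<^sub>R d) (at 0)"
    by (rule vector_diff_chain_at)
  then show ?thesis by (simp add: has_partial_def o_def)
qed

lemma has_derivative_imp_has_partial:
  assumes "(F has_derivative F') (at z)"
  shows "has_partial e F z (F' e)"
proof -
  have "((\<lambda>t::real. z + of_real t * e) has_vector_derivative e) (at 0)"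
    by (auto intro!: derivative_eq_intros)
  then have "((F \<circ> (\<lambda>t::real. z + of_real t * e)) has_vector_derivative F' e) (at 0)"
    using assms by (intro vector_derivative_diff_chain_within[where S=UNIV]) (auto intro: has_derivative_at_withinI)
  then show ?thesis by (simp add: has_partial_def o_def)
qed

lemma has_partial_mvt:
  fixes F :: "complex \<Rightarrow> real"
  assumes "h > 0" "\<And>t. 0 \<le> t \<Longrightarrow> t \<le> h \<Longrightarrow> has_partial e F (z + of_real t * e) (F' (z + of_real t * e))"
  shows "\<exists>t. 0 < t \<and> t < h \<and> F (z + of_real h * e) - F z = h * F' (z + of_real t * e)"
proof -
  have "\<exists>t::real. 0 < t \<and> t < h \<and> F (z + of_real h * e) - F (z + of_real 0 * e) = (h - 0) * F' (z + of_real t * e)"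
    using assms(1)
    by (rule MVT2) (use assms(2) in \<open>auto simp: has_partial_line has_real_derivative_iff_has_vector_derivative\<close>)
  then show ?thesis by simp
qed

text \<open>
  The second difference of \<open>F\<close> over a small square with corner \<open>z\<close> equals \<open>h\<^sup>2\<close> times a value of either
  mixed derivative in the square, by two applications of the mean value theorem in either order.
\<close>
lemma mixed_partials_eq_real:
  fixes F :: "complex \<Rightarrow> real"
  assumes "open S" "z \<in> S"
    and Fx: "\<And>w. w \<in> S \<Longrightarrow> has_partial 1 F w (Fx w)" and Fy: "\<And>w. w \<in> S \<Longrightarrow> has_partial \<i> F w (Fy w)"
    and Fxy: "\<And>w. w \<in> S \<Longrightarrow> has_partial \<i> Fx w (Fxy w)" and Fyx: "\<And>w. w \<in> S \<Longrightarrow> has_partial 1 Fy w (Fyx w)"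
    and cont: "continuous_on S Fxy" "continuous_on S Fyx"
  shows "Fxy z = Fyx z"
proof (rule ccontr)
  assume "Fxy z \<noteq> Fyx z"
  define e where "e = dist (Fxy z) (Fyx z) / 2"
  have e: "e > 0" using \<open>Fxy z \<noteq> Fyx z\<close> by (simp add: e_def)
  have "isCont Fxy z" "isCont Fyx z"
    using cont assms(1,2) by (auto simp: continuous_on_eq_continuous_at)
  then obtain d1 d2 where d1: "d1 > 0" "\<And>w. dist w z < d1 \<Longrightarrow> dist (Fxy w) (Fxy z) < e"
    and d2: "d2 > 0" "\<And>w. dist w z < d2 \<Longrightarrow> dist (Fyx w) (Fyx z) < e"
    using e unfolding continuous_at_eps_delta by metis
  obtain d3 where d3: "d3 > 0" "ball z d3 \<subseteq> S" using assms(1,2) openE by blast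
  define h where "h = Min {d1, d2, d3} / 3"
  have h: "h > 0" "2 * h < d1" "2 * h < d2" "2 * h < d3" using d1 d2 d3 by (auto simp: h_def)
  have sq: "dist (z + of_real s + of_real t * \<i>) z \<le> 2 * h" if "0 \<le> s" "s \<le> h" "0 \<le> t" "t \<le> h" for s t
  proof -
    have "norm (of_real s + of_real t * \<i>) \<le> \<bar>s\<bar> + \<bar>t\<bar>"
      using norm_triangle_ineq[of "complex_of_real s" "of_real t * \<i>"] by (simp add: norm_mult)
    then show ?thesis using that by (simp add: dist_norm add.assoc)
  qed
  have inS: "z + of_real s + of_real t * \<i> \<in> S" if "0 \<le> s" "s \<le> h" "0 \<le> t" "t \<le> h" for s t
    using sq[OF that] h d3 by (auto simp: dist_commute subset_iff)
  let ?D = "F (z + of_real h + of_real h * \<i>) - F (z + of_real h) - F (z + of_real h * \<i>) + F z"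
  \<comment> \<open>the second difference over the square, read horizontally first and vertically first\<close>
  obtain s where s: "0 < s" "s < h" and s1: "?D = h * (Fx (z + of_real s + of_real h * \<i>) - Fx (z + of_real s))"
  proof -
    have "has_partial 1 (\<lambda>w. F (w + of_real h * \<i>) - F w) (z + of_real t * 1)
            (Fx (z + of_real t * 1 + of_real h * \<i>) - Fx (z + of_real t * 1))" if "0 \<le> t" "t \<le> h" for t
    proof -
      have "has_partial 1 F (z + of_real t * 1 + of_real h * \<i>) (Fx (z + of_real t * 1 + of_real h * \<i>))"
        "has_partial 1 F (z + of_real t * 1) (Fx (z + of_real t * 1))"
        using Fx inS[of t h] inS[of t 0] that h by simp_all
      then show ?thesis by (intro has_partial_diff has_partial_shift)
    qed
    from has_partial_mvt[OF h(1) this] obtain s where "0 < s" "s < h"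
      "F (z + of_real h * 1 + of_real h * \<i>) - F (z + of_real h * 1) - (F (z + of_real h * \<i>) - F z)
        = h * (Fx (z + of_real s * 1 + of_real h * \<i>) - Fx (z + of_real s * 1))" by blast
    then show ?thesis using that by (simp add: algebra_simps)
  qed
  have "has_partial \<i> Fx (z + of_real s + of_real t * \<i>) (Fxy (z + of_real s + of_real t * \<i>))" if "0 \<le> t" "t \<le> h" for t
    using Fxy inS that s by simp
  from has_partial_mvt[OF h(1) this] obtain t where t: "0 < t" "t < h" "?D = h * (h * Fxy (z + of_real s + of_real t * \<i>))"
    using s1 by auto
  obtain s' where s': "0 < s'" "s' < h" and s1': "?D = h * (Fy (z + of_real h + of_real s' * \<i>) - Fy (z + of_real s' * \<i>))"
  proof -
    have "has_partial \<i> (\<lambda>w. F (w + of_real h) - F w) (z + of_real t * \<i>)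
            (Fy (z + of_real t * \<i> + of_real h) - Fy (z + of_real t * \<i>))" if "0 \<le> t" "t \<le> h" for t
    proof -
      have "has_partial \<i> F (z + of_real t * \<i> + of_real h) (Fy (z + of_real t * \<i> + of_real h))"
        "has_partial \<i> F (z + of_real t * \<i>) (Fy (z + of_real t * \<i>))"
        using Fy inS[of h t] inS[of 0 t] that h by (simp_all add: add.assoc add.commute[of "of_real h"])
      then show ?thesis by (intro has_partial_diff has_partial_shift)
    qed
    from has_partial_mvt[OF h(1) this] obtain s where "0 < s" "s < h"
      "F (z + of_real h * \<i> + of_real h) - F (z + of_real h * \<i>) - (F (z + of_real h) - F z)
        = h * (Fy (z + of_real s * \<i> + of_real h) - Fy (z + of_real s * \<i>))" by blast
    then show ?thesis using that by (simp add: algebra_simps)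
  qed
  have "has_partial 1 Fy (z + of_real s' * \<i> + of_real t * 1) (Fyx (z + of_real s' * \<i> + of_real t * 1))" if "0 \<le> t" "t \<le> h" for t
    using Fyx inS[of t s'] that s' by (simp add: algebra_simps)
  from has_partial_mvt[OF h(1) this] obtain t' where t': "0 < t'" "t' < h" "?D = h * (h * Fyx (z + of_real t' + of_real s' * \<i>))"
    using s1' by (auto simp: algebra_simps)
  have eq: "Fxy (z + of_real s + of_real t * \<i>) = Fyx (z + of_real t' + of_real s' * \<i>)"
    using t t' h by auto
  have "dist (Fxy (z + of_real s + of_real t * \<i>)) (Fxy z) < e"
    using d1(2) sq[of s t] s t h by simp
  moreover have "dist (Fyx (z + of_real t' + of_real s' * \<i>)) (Fyx z) < e"
    using d2(2) sq[of t' s'] s' t' h by simp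
  ultimately have "dist (Fxy z) (Fyx z) < e + e"
    unfolding eq by (metis dist_commute dist_triangle_less_add)
  then show False by (simp add: e_def)
qed

lemma mixed_partials_eq:
  fixes F :: "complex \<Rightarrow> complex"
  assumes "open S" "z \<in> S"
    and Fx: "\<And>w. w \<in> S \<Longrightarrow> has_partial 1 F w (Fx w)" and Fy: "\<And>w. w \<in> S \<Longrightarrow> has_partial \<i> F w (Fy w)"
    and Fxy: "\<And>w. w \<in> S \<Longrightarrow> has_partial \<i> Fx w (Fxy w)" and Fyx: "\<And>w. w \<in> S \<Longrightarrow> has_partial 1 Fy w (Fyx w)"
    and cont: "continuous_on S Fxy" "continuous_on S Fyx"
  shows "Fxy z = Fyx z"
proof (rule complex_eqI)
  show "Re (Fxy z) = Re (Fyx z)"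
    by (rule mixed_partials_eq_real[OF assms(1,2), of "\<lambda>w. Re (F w)" "\<lambda>w. Re (Fx w)" "\<lambda>w. Re (Fy w)"])
       (auto intro: assms has_partial_linear[OF bounded_linear_Re] continuous_on_Re)
  show "Im (Fxy z) = Im (Fyx z)"
    by (rule mixed_partials_eq_real[OF assms(1,2), of "\<lambda>w. Im (F w)" "\<lambda>w. Im (Fx w)" "\<lambda>w. Im (Fy w)"])
       (auto intro: assms has_partial_linear[OF bounded_linear_Im] continuous_on_Im)
qed

text \<open>
  No mixed derivative is recorded: mixed derivatives enter only when the first-order equation
  is differentiated.
\<close>
definition partials :: "complex set \<Rightarrow> (complex \<Rightarrow> 'a::real_normed_vector) \<Rightarrow> (complex \<Rightarrow> 'a) \<Rightarrow> (complex \<Rightarrow> 'a)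
    \<Rightarrow> (complex \<Rightarrow> 'a) \<Rightarrow> (complex \<Rightarrow> 'a) \<Rightarrow> bool" where
  "partials S f fx fy fxx fyy \<longleftrightarrow>
     continuous_on S f \<and> continuous_on S fx \<and> continuous_on S fy \<and> continuous_on S fxx \<and> continuous_on S fyy \<and>
     (\<forall>z\<in>S. has_partial 1 f z (fx z) \<and> has_partial \<i> f z (fy z) \<and> has_partial 1 fx z (fxx z) \<and> has_partial \<i> fy z (fyy z))"

lemma partials_add:
  assumes "partials S f fx fy fxx fyy" "partials S g gx gy gxx gyy"
  shows "partials S (\<lambda>z. f z + g z) (\<lambda>z. fx z + gx z) (\<lambda>z. fy z + gy z) (\<lambda>z. fxx z + gxx z) (\<lambda>z. fyy z + gyy z)"
  using assms unfolding partials_def by (simp add: continuous_on_add has_partial_add)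

lemma partials_linear:
  assumes "bounded_linear B" "partials S f fx fy fxx fyy"
  shows "partials S (\<lambda>z. B (f z)) (\<lambda>z. B (fx z)) (\<lambda>z. B (fy z)) (\<lambda>z. B (fxx z)) (\<lambda>z. B (fyy z))"
  using assms(2) unfolding partials_def
  by (simp add: bounded_linear.continuous_on[OF assms(1)] has_partial_linear[OF assms(1)])

lemma partials_bilinear:
  assumes B: "bounded_bilinear B" and "partials S f fx fy fxx fyy" "partials S g gx gy gxx gyy"
  shows "partials S (\<lambda>z. B (f z) (g z))
     (\<lambda>z. B (f z) (gx z) + B (fx z) (g z)) (\<lambda>z. B (f z) (gy z) + B (fy z) (g z))
     (\<lambda>z. B (f z) (gxx z) + B (fx z) (gx z) + (B (fx z) (gx z) + B (fxx z) (g z)))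
     (\<lambda>z. B (f z) (gyy z) + B (fy z) (gy z) + (B (fy z) (gy z) + B (fyy z) (g z)))"
  using assms(2,3) unfolding partials_def
  by (simp add: continuous_on_add bounded_bilinear.continuous_on[OF B] has_partial_add has_partial_bilinear[OF B])

lemma partials_subset: "partials S f fx fy fxx fyy \<Longrightarrow> T \<subseteq> S \<Longrightarrow> partials T f fx fy fxx fyy"
  unfolding partials_def by (blast intro: continuous_on_subset)

lemma partials_shift:
  assumes "partials S f fx fy fxx fyy" "\<And>z. z \<in> T \<Longrightarrow> z + w \<in> S"
  shows "partials T (\<lambda>z. f (z + w)) (\<lambda>z. fx (z + w)) (\<lambda>z. fy (z + w)) (\<lambda>z. fxx (z + w)) (\<lambda>z. fyy (z + w))"
proof -
  have "continuous_on T (\<lambda>z. F (z + w))" if "continuous_on S F" for F :: "complex \<Rightarrow> 'a"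
    by (rule continuous_on_compose2[OF that]) (auto intro!: continuous_intros assms)
  moreover have "has_partial 1 (\<lambda>z. f (z + w)) z (fx (z + w)) \<and> has_partial \<i> (\<lambda>z. f (z + w)) z (fy (z + w))
      \<and> has_partial 1 (\<lambda>z. fx (z + w)) z (fxx (z + w)) \<and> has_partial \<i> (\<lambda>z. fy (z + w)) z (fyy (z + w))" if "z \<in> T" for z
    using assms that by (intro conjI has_partial_shift) (simp_all add: partials_def)
  ultimately show ?thesis
    using assms(1) unfolding partials_def by simp
qed

lemma partials_cnj:
  assumes "partials S f fx fy fxx fyy" "\<And>z. z \<in> S \<Longrightarrow> cnj z \<in> S"
  shows "partials S (\<lambda>z. f (cnj z)) (\<lambda>z. fx (cnj z)) (\<lambda>z. - fy (cnj z)) (\<lambda>z. fxx (cnj z)) (\<lambda>z. fyy (cnj z))"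
proof -
  have "continuous_on S (\<lambda>z. F (cnj z))" if "continuous_on S F" for F :: "complex \<Rightarrow> 'a"
    by (rule continuous_on_compose2[OF that]) (auto intro!: continuous_intros assms)
  moreover have "has_partial \<i> (\<lambda>z. - fy (cnj z)) z (fyy (cnj z))" if "z \<in> S" for z
    using has_partial_linear[OF bounded_linear_minus[OF bounded_linear_ident] has_partial_cnj_im[of fy z "fyy (cnj z)"]] that assms
    by (auto simp: partials_def)
  moreover have "has_partial 1 (\<lambda>z. f (cnj z)) z (fx (cnj z)) \<and> has_partial \<i> (\<lambda>z. f (cnj z)) z (- fy (cnj z))
      \<and> has_partial 1 (\<lambda>z. fx (cnj z)) z (fxx (cnj z))" if "z \<in> S" for z
    using assms that by (intro conjI has_partial_cnj_re has_partial_cnj_im) (simp_all add: partials_def)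
  ultimately show ?thesis
    using assms(1) unfolding partials_def by (simp add: continuous_on_minus)
qed

section \<open>The second-order equation of a \<open>\<lambda>\<close>-analytic function\<close>

lemma partial_x_eq:
  assumes "has_partial 1 f z d" shows "partial_x f z = d"
proof -
  have z: "z = Complex 0 (Im z) + of_real (Re z) * 1" by (simp add: complex_eq_iff)
  have "(\<lambda>x. f (Complex x (Im z))) = (\<lambda>s. f (Complex 0 (Im z) + of_real s * 1))"
    by (intro ext arg_cong[of _ _ f]) (simp add: complex_eq_iff)
  then show ?thesis
    using assms has_partial_line[of 1 f "Complex 0 (Im z)" "Re z" d] z
    by (auto simp: partial_x_def intro: vector_derivative_at)
qed

lemma partial_y_eq:
  assumes "has_partial \<i> f z d" shows "partial_y f z = d"
proof -
  have z: "z = Complex (Re z) 0 + of_real (Im z) * \<i>" by (simp add: complex_eq_iff)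
  have "(\<lambda>y. f (Complex (Re z) y)) = (\<lambda>s. f (Complex (Re z) 0 + of_real s * \<i>))"
    by (intro ext arg_cong[of _ _ f]) (simp add: complex_eq_iff)
  then show ?thesis
    using assms has_partial_line[of \<i> f "Complex (Re z) 0" "Im z" d] z
    by (auto simp: partial_y_def intro: vector_derivative_at)
qed

lemma C2_on_partials:
  assumes "C2_on S f" "open S"
  obtains fx fy fxx fxy fyy where "partials S f fx fy fxx fyy"
    "\<And>z. z \<in> S \<Longrightarrow> has_partial 1 fy z (fxy z)" "\<And>z. z \<in> S \<Longrightarrow> has_partial \<i> fx z (fxy z)"
proof -
  obtain f' :: "complex \<Rightarrow> complex \<Rightarrow>\<^sub>L complex" and f'' :: "complex \<Rightarrow> complex \<Rightarrow>\<^sub>L complex \<Rightarrow>\<^sub>L complex"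
    where f': "\<And>z. z \<in> S \<Longrightarrow> (f has_derivative blinfun_apply (f' z)) (at z)"
      and f'': "\<And>z. z \<in> S \<Longrightarrow> (f' has_derivative blinfun_apply (f'' z)) (at z)"
      and cont: "continuous_on S f''"
    using assms(1) unfolding C2_on_def by blast
  have c0: "continuous_on S f"
    using f' by (meson continuous_at_imp_continuous_on has_derivative_continuous)
  have c1: "continuous_on S f'"
    using f'' by (meson continuous_at_imp_continuous_on has_derivative_continuous)
  have pd1: "has_partial e f z (blinfun_apply (f' z) e)" if "z \<in> S" for z e
    using has_derivative_imp_has_partial[OF f'[OF that]] .
  have pd2: "has_partial e (\<lambda>z. blinfun_apply (f' z) e') z (blinfun_apply (blinfun_apply (f'' z) e) e')" if "z \<in> S" for z e e'
    using has_partial_linear[OF blinfun.bounded_linear_left has_derivative_imp_has_partial[OF f''[OF that]]] .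
  have c2: "continuous_on S (\<lambda>z. blinfun_apply (f' z) e)" for e
    by (intro continuous_intros c1)
  have c3: "continuous_on S (\<lambda>z. blinfun_apply (blinfun_apply (f'' z) e) e')" for e e'
    by (intro continuous_intros cont)
  have sym: "blinfun_apply (blinfun_apply (f'' z) \<i>) 1 = blinfun_apply (blinfun_apply (f'' z) 1) \<i>" if "z \<in> S" for z
    by (rule mixed_partials_eq[OF assms(2) that, of f "\<lambda>z. blinfun_apply (f' z) 1" "\<lambda>z. blinfun_apply (f' z) \<i>"
          "\<lambda>z. blinfun_apply (blinfun_apply (f'' z) \<i>) 1" "\<lambda>z. blinfun_apply (blinfun_apply (f'' z) 1) \<i>"])
       (auto intro: pd1 pd2 c3)
  show ?thesis
  proof (rule that)
    show "partials S f (\<lambda>z. blinfun_apply (f' z) 1) (\<lambda>z. blinfun_apply (f' z) \<i>)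
      (\<lambda>z. blinfun_apply (blinfun_apply (f'' z) 1) 1) (\<lambda>z. blinfun_apply (blinfun_apply (f'' z) \<i>) \<i>)"
      unfolding partials_def using c0 c2 c3 pd1 pd2 by auto
    show "has_partial 1 (\<lambda>z. blinfun_apply (f' z) \<i>) z (blinfun_apply (blinfun_apply (f'' z) 1) \<i>)" if "z \<in> S" for z
      using pd2 that by blast
    show "has_partial \<i> (\<lambda>z. blinfun_apply (f' z) 1) z (blinfun_apply (blinfun_apply (f'' z) 1) \<i>)" if "z \<in> S" for z
      using pd2[OF that, of \<i> 1] sym[OF that] by simp
  qed
qed

text \<open>
  Both equations are imposed off the real axis only. On the axis they are replaced by the continuity of the
  derivatives, which lets \<open>S\<close> be any set and avoids a separate form of the equations there.
\<close>
definition dunkl_solution :: "real \<Rightarrow> complex set \<Rightarrow> (complex \<Rightarrow> complex) \<Rightarrow> (complex \<Rightarrow> complex) \<Rightarrow> (complex \<Rightarrow> complex)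
    \<Rightarrow> (complex \<Rightarrow> complex) \<Rightarrow> (complex \<Rightarrow> complex) \<Rightarrow> bool" where
  "dunkl_solution lam S f fx fy fxx fyy \<longleftrightarrow> partials S f fx fy fxx fyy \<and>
     (\<forall>z\<in>S. Im z \<noteq> 0 \<longrightarrow>
        fx z + \<i> * fy z = - \<i> * of_real lam * (f z - f (cnj z)) / of_real (Im z) \<and>
        fxx z + fyy z + of_real (2 * lam / Im z) * fy z = of_real lam * (f z - f (cnj z)) / of_real ((Im z)\<^sup>2))"

text \<open>
  Multiplied by \<open>y\<close>, the equation says that \<open>E = y (f\<^sub>x + \<i> f\<^sub>y) + \<i> \<lambda> (f - f \<circ> cnj)\<close> vanishes identically.
  The second-order equation is the vanishing of \<open>E\<^sub>x - \<i> E\<^sub>y\<close>, simplified by the first-order equation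
  at \<open>z\<close> and at \<open>cnj z\<close>; the two mixed derivatives of \<open>f\<close> cancel because they agree.
\<close>
lemma lambda_analytic_solution:
  assumes "lambda_analytic lam f"
  obtains fx fy fxx fyy where "dunkl_solution lam \<bbbD> f fx fy fxx fyy"
proof -
  obtain fx fy fxx fxy fyy where P: "partials \<bbbD> f fx fy fxx fyy"
    and xy: "\<And>z. z \<in> \<bbbD> \<Longrightarrow> has_partial 1 fy z (fxy z)" and yx: "\<And>z. z \<in> \<bbbD> \<Longrightarrow> has_partial \<i> fx z (fxy z)"
  proof -
    have "C2_on \<bbbD> f" using assms by (simp add: lambda_analytic_def)
    then show ?thesis using that by (rule C2_on_partials[OF _ open_ball]) blast
  qed
  have pds: "has_partial 1 f z (fx z)" "has_partial \<i> f z (fy z)" "has_partial 1 fx z (fxx z)" "has_partial \<i> fy z (fyy z)" if "z \<in> \<bbbD>" for z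
    using P that by (auto simp: partials_def)
  have cnjD: "cnj z \<in> \<bbbD>" if "z \<in> \<bbbD>" for z using that by simp
  have CR: "fx z + \<i> * fy z = - \<i> * of_real lam * (f z - f (cnj z)) / of_real (Im z)"
    if "z \<in> \<bbbD>" "Im z \<noteq> 0" for z
  proof -
    have "z - cnj z = 2 * \<i> * of_real (Im z)" by (simp add: complex_eq_iff)
    moreover have "D_zbar lam f z = 0" using assms that by (simp add: lambda_analytic_def)
    ultimately have "(fx z + \<i> * fy z) / 2 = of_real lam * ((f z - f (cnj z)) / (2 * \<i> * of_real (Im z)))"
      using that pds(1,2)[OF that(1)]
      by (simp add: D_zbar_def partial_zbar_def reflection_quotient_def partial_x_eq partial_y_eq)
    also have "of_real lam * ((f z - f (cnj z)) / (2 * \<i> * of_real (Im z)))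
        = (- \<i> * of_real lam * (f z - f (cnj z)) / of_real (Im z)) / 2"
      using that by (simp add: divide_simps)
    finally show ?thesis by simp
  qed
  have "fxx z + fyy z + of_real (2 * lam / Im z) * fy z = of_real lam * (f z - f (cnj z)) / of_real ((Im z)\<^sup>2)"
    if z: "z \<in> \<bbbD>" "Im z \<noteq> 0" for z
  proof -
    let ?y = "complex_of_real (Im z)"
    define E where "E w = of_real (Im w) * (fx w + \<i> * fy w) + \<i> * of_real lam * (f w - f (cnj w))" for w
    have E0: "E w = 0" if "w \<in> \<bbbD>" for w
    proof (cases "Im w = 0")
      case True
      then have "cnj w = w" by (simp add: complex_eq_iff)
      then show ?thesis using True by (simp add: E_def)
    next
      case False
      then show ?thesis unfolding E_def CR[OF that False] by (simp add: field_simps)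
    qed
    have cz: "cnj z \<in> \<bbbD>" using z by simp
    have Im1: "has_partial 1 (\<lambda>w. complex_of_real (Im w)) z 0"
      by (simp add: has_partial_def)
    have Imi: "has_partial \<i> (\<lambda>w. complex_of_real (Im w)) z 1"
      by (auto simp: has_partial_def intro!: derivative_eq_intros)
    have fh1: "has_partial 1 (\<lambda>w. f (cnj w)) z (fx (cnj z))" by (rule has_partial_cnj_re[OF pds(1)[OF cz]])
    have fhi: "has_partial \<i> (\<lambda>w. f (cnj w)) z (- fy (cnj z))" by (rule has_partial_cnj_im[OF pds(2)[OF cz]])
    have mul: "has_partial e (\<lambda>w. c * F w) z (c * d)" if "has_partial e F z d" for e c d and F :: "complex \<Rightarrow> complex"
      using has_partial_linear[OF bounded_linear_mult_right that] .
    note prod = has_partial_bilinear[OF bounded_bilinear_mult]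
    have "has_partial 1 E z (?y * (fxx z + \<i> * fxy z) + 0 * (fx z + \<i> * fy z) + \<i> * of_real lam * (fx z - fx (cnj z)))"
      unfolding E_def
      by (intro has_partial_add prod Im1 mul pds[OF z(1)] xy[OF z(1)] has_partial_diff fh1)
    moreover have "has_partial \<i> E z (?y * (fxy z + \<i> * fyy z) + 1 * (fx z + \<i> * fy z) + \<i> * of_real lam * (fy z - - fy (cnj z)))"
      unfolding E_def
      by (intro has_partial_add prod Imi mul pds[OF z(1)] yx[OF z(1)] has_partial_diff fhi)
    \<comment> \<open>\<open>E\<close> vanishes on the whole disk, axis included, so that the identity may be differentiated.\<close>
    moreover have "has_partial e E z 0" for e
      by (rule has_partial_cong[OF has_partial_const open_ball z(1)]) (use E0 in auto)
    ultimately have e1: "?y * (fxx z + \<i> * fxy z) + 0 * (fx z + \<i> * fy z) + \<i> * of_real lam * (fx z - fx (cnj z)) = 0"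
      and e2: "?y * (fxy z + \<i> * fyy z) + 1 * (fx z + \<i> * fy z) + \<i> * of_real lam * (fy z - - fy (cnj z)) = 0"
      using has_partial_unique by blast+
    define d where "d = (f z - f (cnj z)) / ?y"
    have c1: "fx z + \<i> * fy z = - \<i> * of_real lam * d" using CR[OF z] by (simp add: d_def)
    have c2: "fx (cnj z) + \<i> * fy (cnj z) = - \<i> * of_real lam * d"
      using CR[OF cz] z by (simp add: d_def field_simps)
    have y0: "?y \<noteq> 0" using z by simp
    have "?y * (fxx z + fyy z) + 2 * of_real lam * fy z = of_real lam * d"
    proof -
      have "fx z - fx (cnj z) = - \<i> * (fy z - fy (cnj z))" using c1 c2 by (simp add: algebra_simps) 
      have ii: "\<i> * (\<i> * x) = - x" for x by (simp flip: mult.assoc)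
      have "?y * (fxx z + fyy z) + 2 * of_real lam * fy z - of_real lam * d
        = (?y * (fxx z + \<i> * fxy z) + 0 * (fx z + \<i> * fy z) + \<i> * of_real lam * (fx z - fx (cnj z)))
        - \<i> * (?y * (fxy z + \<i> * fyy z) + 1 * (fx z + \<i> * fy z) + \<i> * of_real lam * (fy z - - fy (cnj z)))
        - \<i> * of_real lam * ((fx z + \<i> * fy z + \<i> * of_real lam * d) - (fx (cnj z) + \<i> * fy (cnj z) + \<i> * of_real lam * d))
        + \<i> * (fx z + \<i> * fy z + \<i> * of_real lam * d)"
        by (simp add: algebra_simps ii)
      also have "\<dots> = 0" using e1 e2 c1 c2 by simp
      finally show ?thesis by simp
    qed
    moreover have "fxx z + fyy z + of_real (2 * lam / Im z) * fy z = (?y * (fxx z + fyy z) + 2 * of_real lam * fy z) / ?y"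
      using y0 by (simp add: add_divide_distrib)
    ultimately show ?thesis by (simp add: d_def power2_eq_square)
  qed
  with CR P show ?thesis by (intro that[of fx fy fxx fyy]) (simp add: dunkl_solution_def)
qed

text \<open>
  The equations have coefficients independent of \<open>x\<close>, so that they pass to horizontal difference quotients. Quotients
  are used in place of \<open>f\<^sub>x\<close> because \<open>f\<close> is only twice differentiable.
\<close>
lemma dunkl_solution_difference:
  assumes "dunkl_solution lam S f fx fy fxx fyy"
    and "\<And>z. z \<in> T \<Longrightarrow> z \<in> S" "\<And>z. z \<in> T \<Longrightarrow> z + of_real h \<in> S"
  shows "dunkl_solution lam T (\<lambda>z. (f (z + of_real h) - f z) / of_real h) (\<lambda>z. (fx (z + of_real h) - fx z) / of_real h)
     (\<lambda>z. (fy (z + of_real h) - fy z) / of_real h) (\<lambda>z. (fxx (z + of_real h) - fxx z) / of_real h)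
     (\<lambda>z. (fyy (z + of_real h) - fyy z) / of_real h)"
proof -
  let ?h = "complex_of_real h"
  have P: "partials S f fx fy fxx fyy" using assms by (simp add: dunkl_solution_def)
  have 1: "partials T f fx fy fxx fyy" using partials_subset[OF P] assms by blast
  have 2: "partials T (\<lambda>z. f (z + ?h)) (\<lambda>z. fx (z + ?h)) (\<lambda>z. fy (z + ?h)) (\<lambda>z. fxx (z + ?h)) (\<lambda>z. fyy (z + ?h))"
    by (rule partials_shift[OF P]) (use assms in auto)
  have "partials T (\<lambda>z. (f (z + of_real h) - f z) / of_real h) (\<lambda>z. (fx (z + of_real h) - fx z) / of_real h)
     (\<lambda>z. (fy (z + of_real h) - fy z) / of_real h) (\<lambda>z. (fxx (z + of_real h) - fxx z) / of_real h)
     (\<lambda>z. (fyy (z + of_real h) - fyy z) / of_real h)"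
    using partials_linear[OF bounded_linear_divide partials_add[OF 2 partials_linear[OF bounded_linear_minus[OF bounded_linear_ident] 1]], of ?h]
    by simp
  moreover have "(fx (z + ?h) - fx z) / ?h + \<i> * ((fy (z + ?h) - fy z) / ?h)
      = - \<i> * of_real lam * ((f (z + ?h) - f z) / ?h - (f (cnj z + ?h) - f (cnj z)) / ?h) / of_real (Im z) \<and>
      (fxx (z + ?h) - fxx z) / ?h + (fyy (z + ?h) - fyy z) / ?h + of_real (2 * lam / Im z) * ((fy (z + ?h) - fy z) / ?h)
      = of_real lam * ((f (z + ?h) - f z) / ?h - (f (cnj z + ?h) - f (cnj z)) / ?h) / of_real ((Im z)\<^sup>2)"
    if z: "z \<in> T" "Im z \<noteq> 0" for z
  proof -
    have a: "fx z + \<i> * fy z = - \<i> * of_real lam * (f z - f (cnj z)) / of_real (Im z)"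
        "fxx z + fyy z + of_real (2 * lam / Im z) * fy z = of_real lam * (f z - f (cnj z)) / of_real ((Im z)\<^sup>2)"
      using assms(1,2) z by (auto simp: dunkl_solution_def)
    have b: "fx (z+?h) + \<i> * fy (z+?h) = - \<i> * of_real lam * (f (z+?h) - f (cnj z + ?h)) / of_real (Im z)"
        "fxx (z+?h) + fyy (z+?h) + of_real (2 * lam / Im z) * fy (z+?h) = of_real lam * (f (z+?h) - f (cnj z + ?h)) / of_real ((Im z)\<^sup>2)"
      using assms(1) assms(3)[OF z(1)] z(2) by (auto simp: dunkl_solution_def)
    have "(fx (z + ?h) - fx z) / ?h + \<i> * ((fy (z + ?h) - fy z) / ?h) = ((fx (z+?h) + \<i> * fy (z+?h)) - (fx z + \<i> * fy z)) / ?h"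
      by (simp add: algebra_simps diff_divide_distrib add_divide_distrib)
    moreover have "(fxx (z + ?h) - fxx z) / ?h + (fyy (z + ?h) - fyy z) / ?h + of_real (2 * lam / Im z) * ((fy (z + ?h) - fy z) / ?h)
      = ((fxx (z+?h) + fyy (z+?h) + of_real (2 * lam / Im z) * fy (z+?h)) - (fxx z + fyy z + of_real (2 * lam / Im z) * fy z)) / ?h"
      by (simp add: algebra_simps diff_divide_distrib add_divide_distrib)
    ultimately show ?thesis unfolding a b
      by (simp add: algebra_simps diff_divide_distrib add_divide_distrib)
  qed
  ultimately show ?thesis unfolding dunkl_solution_def by simp
qed

text \<open>
  The zero-order terms of the second-order equations at \<open>z\<close> and at \<open>cnj z\<close> add up to
  \<open>2 \<lambda> \<bar>f(z) - f(cnj z)\<bar>\<^sup>2 / y\<^sup>2\<close>, which has the good sign. This cancellation is the reason for adding the two squares.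
\<close>
lemma dunkl_solution_Bochner:
  assumes f: "dunkl_solution lam S f fx fy fxx fyy" and sym: "\<And>z. z \<in> S \<Longrightarrow> cnj z \<in> S" and "lam \<ge> 0"
  obtains Wx Wy Wxx Wyy where
    "partials S (\<lambda>z. (norm (f z))\<^sup>2 + (norm (f (cnj z)))\<^sup>2) Wx Wy Wxx Wyy"
    "\<And>z. z \<in> S \<Longrightarrow> \<bar>Wx z\<bar> \<le> 2 * (norm (f z) * norm (fx z) + norm (f (cnj z)) * norm (fx (cnj z)))"
    "\<And>z. z \<in> S \<Longrightarrow> \<bar>Wy z\<bar> \<le> 2 * (norm (f z) * norm (fy z) + norm (f (cnj z)) * norm (fy (cnj z)))"
    "\<And>z. z \<in> S \<Longrightarrow> Im z \<noteq> 0 \<Longrightarrow> Wxx z + Wyy z + 2 * lam / Im z * Wy z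
       \<ge> 2 * ((norm (fx z))\<^sup>2 + (norm (fy z))\<^sup>2 + (norm (fx (cnj z)))\<^sup>2 + (norm (fy (cnj z)))\<^sup>2)"
proof -
  have P: "partials S f fx fy fxx fyy" using f by (simp add: dunkl_solution_def)
  note Q = partials_cnj[OF P sym]
  define Wx where "Wx z = f z \<bullet> fx z + fx z \<bullet> f z + (f (cnj z) \<bullet> fx (cnj z) + fx (cnj z) \<bullet> f (cnj z))" for z
  define Wy where "Wy z = f z \<bullet> fy z + fy z \<bullet> f z + (f (cnj z) \<bullet> - fy (cnj z) + - fy (cnj z) \<bullet> f (cnj z))" for z
  define Wxx where "Wxx z = f z \<bullet> fxx z + fx z \<bullet> fx z + (fx z \<bullet> fx z + fxx z \<bullet> f z)
    + (f (cnj z) \<bullet> fxx (cnj z) + fx (cnj z) \<bullet> fx (cnj z) + (fx (cnj z) \<bullet> fx (cnj z) + fxx (cnj z) \<bullet> f (cnj z)))" for z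
  define Wyy where "Wyy z = f z \<bullet> fyy z + fy z \<bullet> fy z + (fy z \<bullet> fy z + fyy z \<bullet> f z)
    + (f (cnj z) \<bullet> fyy (cnj z) + - fy (cnj z) \<bullet> - fy (cnj z) + (- fy (cnj z) \<bullet> - fy (cnj z) + fyy (cnj z) \<bullet> f (cnj z)))" for z
  have "partials S (\<lambda>z. f z \<bullet> f z + f (cnj z) \<bullet> f (cnj z)) Wx Wy Wxx Wyy"
    unfolding Wx_def[abs_def] Wy_def[abs_def] Wxx_def[abs_def] Wyy_def[abs_def]
    using partials_add[OF partials_bilinear[OF bounded_bilinear_inner P P] partials_bilinear[OF bounded_bilinear_inner Q Q]] .
  then have 1: "partials S (\<lambda>z. (norm (f z))\<^sup>2 + (norm (f (cnj z)))\<^sup>2) Wx Wy Wxx Wyy"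
    by (simp add: dot_square_norm)
  have cs: "\<bar>a \<bullet> b\<bar> \<le> norm a * norm b" for a b :: complex by (rule Cauchy_Schwarz_ineq2)
  have 2: "\<bar>Wx z\<bar> \<le> 2 * (norm (f z) * norm (fx z) + norm (f (cnj z)) * norm (fx (cnj z)))" for z
    using cs[of "f z" "fx z"] cs[of "f (cnj z)" "fx (cnj z)"] by (simp add: Wx_def inner_commute)
  have 3: "\<bar>Wy z\<bar> \<le> 2 * (norm (f z) * norm (fy z) + norm (f (cnj z)) * norm (fy (cnj z)))" for z
    using cs[of "f z" "fy z"] cs[of "f (cnj z)" "fy (cnj z)"] by (simp add: Wy_def inner_commute)
  have 4: "Wxx z + Wyy z + 2 * lam / Im z * Wy z
       \<ge> 2 * ((norm (fx z))\<^sup>2 + (norm (fy z))\<^sup>2 + (norm (fx (cnj z)))\<^sup>2 + (norm (fy (cnj z)))\<^sup>2)"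
    if z: "z \<in> S" "Im z \<noteq> 0" for z
  proof -
    define k where "k = lam / (Im z)\<^sup>2"
    have k: "k \<ge> 0" using \<open>lam \<ge> 0\<close> by (simp add: k_def)
    have a: "fxx z + fyy z + (2 * lam / Im z) *\<^sub>R fy z = k *\<^sub>R (f z - f (cnj z))"
      using f z unfolding dunkl_solution_def by (auto simp: scaleR_conv_of_real k_def)
    have b: "fxx (cnj z) + fyy (cnj z) - (2 * lam / Im z) *\<^sub>R fy (cnj z) = k *\<^sub>R (f (cnj z) - f z)"
      using f sym[OF z(1)] z(2) unfolding dunkl_solution_def by (auto simp: scaleR_conv_of_real k_def)
    have "Wxx z + Wyy z + 2 * lam / Im z * Wy z
      = 2 * (fx z \<bullet> fx z + fy z \<bullet> fy z + fx (cnj z) \<bullet> fx (cnj z) + fy (cnj z) \<bullet> fy (cnj z))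
       + 2 * (f z \<bullet> (fxx z + fyy z + (2 * lam / Im z) *\<^sub>R fy z))
       + 2 * (f (cnj z) \<bullet> (fxx (cnj z) + fyy (cnj z) - (2 * lam / Im z) *\<^sub>R fy (cnj z)))"
      by (simp add: Wxx_def Wyy_def Wy_def inner_add_right inner_diff_right inner_add_left inner_commute algebra_simps)
    also have "\<dots> = 2 * (fx z \<bullet> fx z + fy z \<bullet> fy z + fx (cnj z) \<bullet> fx (cnj z) + fy (cnj z) \<bullet> fy (cnj z))
       + 2 * k * ((f z - f (cnj z)) \<bullet> (f z - f (cnj z)))"
      unfolding a b by (simp add: inner_diff_right inner_diff_left inner_commute algebra_simps)
    also have "\<dots> \<ge> 2 * (fx z \<bullet> fx z + fy z \<bullet> fy z + fx (cnj z) \<bullet> fx (cnj z) + fy (cnj z) \<bullet> fy (cnj z))"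
      using k by simp
    finally show ?thesis by (simp add: dot_square_norm)
  qed
  show ?thesis using that[OF 1 2 3 4] by blast
qed

section \<open>A maximum principle across the real axis\<close>

lemma second_derivative_test:
  fixes g :: "real \<Rightarrow> real"
  assumes "d > 0" and g': "\<And>t. \<bar>t\<bar> < d \<Longrightarrow> (g has_real_derivative g' t) (at t)"
    and g'': "(g' has_real_derivative D) (at 0)"
    and max: "\<And>t. \<bar>t\<bar> < d \<Longrightarrow> g t \<le> g 0"
  shows "g' 0 = 0" "D \<le> 0"
proof -
  show 0: "g' 0 = 0"
    by (rule DERIV_local_max[OF g'[of 0] \<open>d > 0\<close>]) (use max \<open>d > 0\<close> in auto)
  show "D \<le> 0"
  proof (rule ccontr)
    assume "\<not> D \<le> 0"
    then obtain e where e: "e > 0" "\<And>h. 0 < h \<Longrightarrow> h < e \<Longrightarrow> g' 0 < g' (0 + h)"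
      using DERIV_pos_inc_right[OF g''] by auto
    define h where "h = min d e / 2"
    have h: "0 < h" "h < d" "h < e" using e \<open>d > 0\<close> by (auto simp: h_def)
    obtain t where t: "0 < t" "t < h" "g h - g 0 = (h - 0) * g' t"
      using MVT2[OF h(1), of g g'] g' h by force
    then have "g h - g 0 > 0" using e(2)[of t] h 0 by simp
    then show False using max[of h] h by simp
  qed
qed

text \<open>
  Off the axis this is the second derivative test. At a maximum on the axis \<open>F\<^sub>y = 0\<close>, hence \<open>F\<^sub>y / y\<close> just above
  it is a value of \<open>F\<^sub>y\<^sub>y\<close>; by continuity \<open>F\<^sub>x\<^sub>x\<close> and \<open>F\<^sub>y\<^sub>y\<close> stay small there, which contradicts the
  inequality at points off the axis.
\<close>
lemma weinstein_maximum_principle: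
  fixes F :: "complex \<Rightarrow> real"
  assumes F: "partials S F Fx Fy Fxx Fyy" and "lam \<ge> 0"
    and K: "compact K" "K \<subseteq> S" and U: "open U" "U \<subseteq> K" and "c > 0"
    and L: "\<And>z. z \<in> U \<Longrightarrow> Im z \<noteq> 0 \<Longrightarrow> Fxx z + Fyy z + 2 * lam / Im z * Fy z \<ge> c"
    and b: "\<And>z. z \<in> K - U \<Longrightarrow> F z \<le> b"
    and "z \<in> K"
  shows "F z \<le> b"
proof -
  have pds: "has_partial 1 F w (Fx w)" "has_partial \<i> F w (Fy w)" "has_partial 1 Fx w (Fxx w)" "has_partial \<i> Fy w (Fyy w)" if "w \<in> U" for w
    using that F K U by (auto simp: partials_def)
  have "continuous_on K F" using F K by (auto simp: partials_def intro: continuous_on_subset)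
  then obtain m where m: "m \<in> K" "\<And>w. w \<in> K \<Longrightarrow> F w \<le> F m"
    using continuous_attains_sup[OF K(1)] \<open>z \<in> K\<close> by blast
  have "m \<notin> U"
  proof
    assume mU: "m \<in> U"
    then obtain d where d: "d > 0" "ball m d \<subseteq> U" using U openE by blast
    have line: "m + of_real t * e \<in> U" if "\<bar>t\<bar> < d" "norm e = 1" for t e
      using d that by (auto simp: subset_iff dist_norm norm_mult)
    have mx: "F (m + of_real t * e) \<le> F (m + of_real 0 * e)" if "\<bar>t\<bar> < d" "norm e = 1" for t e
      using m(2)[of "m + of_real t * e"] line[OF that] U by auto
    have test: "F' m = 0 \<and> D \<le> 0"
      if "norm e = 1" "\<And>w. w \<in> U \<Longrightarrow> has_partial e F w (F' w)" "has_partial e F' m D" for e F' D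
    proof -
      have 1: "((\<lambda>t. F (m + of_real t * e)) has_real_derivative F' (m + of_real t * e)) (at t)" if "\<bar>t\<bar> < d" for t
        using \<open>\<And>w. w \<in> U \<Longrightarrow> has_partial e F w (F' w)\<close>[OF line[OF that \<open>norm e = 1\<close>]]
        unfolding has_partial_line has_real_derivative_iff_has_vector_derivative .
      have 2: "((\<lambda>t. F' (m + of_real t * e)) has_real_derivative D) (at 0)"
        using that(3) unfolding has_partial_def has_real_derivative_iff_has_vector_derivative .
      show ?thesis
        using second_derivative_test[OF d(1) 1 2 mx] that(1) by simp
    qed
    have x: "Fxx m \<le> 0" and y: "Fy m = 0" "Fyy m \<le> 0"
      using test[of 1 Fx "Fxx m"] test[of \<i> Fy "Fyy m"] pds mU by auto
    show False
    proof (cases "Im m = 0")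
      case False
      then show False using L[OF mU] x y \<open>c > 0\<close> by simp
    next
      case True
      \<comment> \<open>Three second derivatives below \<open>c'\<close>, one of them with the factor \<open>2\<lambda>\<close>, add up to less than \<open>c\<close>.\<close>
      define c' where "c' = c / (2 + 2 * lam)"
      have c': "c' > 0" "c' * (2 + 2 * lam) = c" using \<open>c > 0\<close> \<open>lam \<ge> 0\<close> by (auto simp: c'_def)
      have "continuous_on U Fxx" "continuous_on U Fyy"
        using F K U by (auto simp: partials_def intro: continuous_on_subset)
      then have "isCont Fxx m" "isCont Fyy m" using U mU by (auto simp: continuous_on_eq_continuous_at)
      then obtain d1 d2 where d1: "d1 > 0" "\<And>w. dist w m < d1 \<Longrightarrow> dist (Fxx w) (Fxx m) < c'"
        and d2: "d2 > 0" "\<And>w. dist w m < d2 \<Longrightarrow> dist (Fyy w) (Fyy m) < c'"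
        using c'(1) unfolding continuous_at_eps_delta by metis
      define h where "h = Min {d, d1, d2} / 2"
      have h: "0 < h" "h < d" "h < d1" "h < d2" using d(1) d1(1) d2(1) by (auto simp: h_def)
      obtain t where t: "0 < t" "t < h" "Fy (m + of_real h * \<i>) - Fy m = h * Fyy (m + of_real t * \<i>)"
        using has_partial_mvt[OF h(1), of \<i> Fy m Fyy] pds(4) line[of _ \<i>] h by auto
      have "dist (Fyy (m + of_real t * \<i>)) (Fyy m) < c'" "dist (Fxx (m + of_real h * \<i>)) (Fxx m) < c'"
        "dist (Fyy (m + of_real h * \<i>)) (Fyy m) < c'"
        using t h d2(2) d1(2) by (simp_all add: dist_norm norm_mult)
      then have lt: "Fyy (m + of_real t * \<i>) < c'" "Fxx (m + of_real h * \<i>) < c'" "Fyy (m + of_real h * \<i>) < c'"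
        using x y by (auto simp: dist_real_def)
      have "2 * lam / h * Fy (m + of_real h * \<i>) = 2 * lam * Fyy (m + of_real t * \<i>)"
        using t(3) y h by simp
      also have "\<dots> \<le> 2 * lam * c'"
        using lt \<open>lam \<ge> 0\<close> by (intro mult_left_mono) auto
      finally have "Fxx (m + of_real h * \<i>) + Fyy (m + of_real h * \<i>) + 2 * lam / h * Fy (m + of_real h * \<i>) < c"
        using lt c'(2) by (simp add: algebra_simps)
      moreover have "Im (m + of_real h * \<i>) = h" using True by simp
      ultimately show False
        using L[OF line[of h \<i>]] h by simp
    qed
  qed
  then show ?thesis using m \<open>z \<in> K\<close> b[of m] by fastforce
qed

section \<open>Folded distance and cut-off functions\<close>

text \<open>
  The maximum distance after folding the plane along the real axis. Its balls are invariant under conjugation, as a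
  domain of the equation must be.
\<close>
definition fold_dist :: "complex \<Rightarrow> complex \<Rightarrow> real" where
  "fold_dist z w = max \<bar>Re z - Re w\<bar> \<bar>\<bar>Im z\<bar> - \<bar>Im w\<bar>\<bar>"

lemma fold_dist_nonneg [simp]: "0 \<le> fold_dist z w"
  and fold_dist_same [simp]: "fold_dist z z = 0"
  and fold_dist_cnj [simp]: "fold_dist (cnj z) w = fold_dist z w"
  and fold_dist_commute: "fold_dist z w = fold_dist w z"
  by (auto simp: fold_dist_def abs_minus_commute)

lemma fold_dist_le_iff:
  "fold_dist z w \<le> R \<longleftrightarrow> \<bar>Re z - Re w\<bar> \<le> R \<and> \<bar>\<bar>Im z\<bar> - \<bar>Im w\<bar>\<bar> \<le> R"
  by (simp add: fold_dist_def)

lemma fold_dist_ge: "\<bar>Re z - Re w\<bar> \<le> fold_dist z w" "\<bar>\<bar>Im z\<bar> - \<bar>Im w\<bar>\<bar> \<le> fold_dist z w"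
  by (simp_all add: fold_dist_def)

lemma fold_dist_triangle: "fold_dist x z \<le> fold_dist x y + fold_dist y z"
proof -
  have tri: "\<bar>a - c\<bar> \<le> s + t" if "\<bar>a - b\<bar> \<le> s" "\<bar>b - c\<bar> \<le> t" for a b c s t :: real
    using that by linarith
  show ?thesis
    unfolding fold_dist_le_iff by (intro conjI tri[OF fold_dist_ge(1) fold_dist_ge(1)] tri[OF fold_dist_ge(2) fold_dist_ge(2)])
qed

lemma norm_le_fold_dist: "norm z \<le> norm w + 2 * fold_dist z w"
proof -
  have "norm (Complex (Re z) \<bar>Im z\<bar> - Complex (Re w) \<bar>Im w\<bar>) \<le> \<bar>Re z - Re w\<bar> + \<bar>\<bar>Im z\<bar> - \<bar>Im w\<bar>\<bar>"
    using cmod_le[of "Complex (Re z) \<bar>Im z\<bar> - Complex (Re w) \<bar>Im w\<bar>"] by simp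
  also have "\<dots> \<le> 2 * fold_dist z w"
    using add_mono[OF fold_dist_ge(1)[of z w] fold_dist_ge(2)[of z w]] by simp
  finally have "norm (Complex (Re z) \<bar>Im z\<bar>) \<le> norm (Complex (Re w) \<bar>Im w\<bar>) + 2 * fold_dist z w"
    using norm_triangle_sub[of "Complex (Re z) \<bar>Im z\<bar>" "Complex (Re w) \<bar>Im w\<bar>"] by simp
  then show ?thesis by (simp add: cmod_def)
qed

lemma continuous_on_fold_dist [continuous_intros]:
  assumes "continuous_on S f" "continuous_on S g"
  shows "continuous_on S (\<lambda>z. fold_dist (f z) (g z))"
  unfolding fold_dist_def by (intro continuous_intros assms)

lemma closed_fold_ball: "closed {z. fold_dist z w \<le> R}"
  by (intro closed_Collect_le continuous_intros)

lemma compact_fold_ball: "compact {z. fold_dist z w \<le> R}"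
proof -
  have "norm z \<le> norm w + 2 * R" if "fold_dist z w \<le> R" for z
    using norm_le_fold_dist[of z w] that by simp
  then have "bounded {z. fold_dist z w \<le> R}" by (auto simp: bounded_iff)
  then show ?thesis using closed_fold_ball compact_eq_bounded_closed by blast
qed

text \<open>
  Using \<open>y\<^sup>2\<close> instead of \<open>y\<close> makes the function even in \<open>y\<close> and smooth across the axis, so that
  \<open>(2\<lambda>/y) \<partial>\<^sub>y\<close> of it is bounded. The denominator \<open>\<rho> (\<rho> + \<bar>Im w\<bar>)\<close> is the size of \<open>y\<^sup>2 - (Im w)\<^sup>2\<close>
  at folded distance \<open>\<rho>\<close> from \<open>w\<close>, both near the axis and far from it; hence no case distinction between the two.
\<close>
definition cutoff :: "complex \<Rightarrow> real \<Rightarrow> complex \<Rightarrow> real" where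
  "cutoff w \<rho> z = 1 - (Re z - Re w)\<^sup>2 / \<rho>\<^sup>2 - ((Im z)\<^sup>2 - (Im w)\<^sup>2)\<^sup>2 / (\<rho> * (\<rho> + \<bar>Im w\<bar>))\<^sup>2"

lemma cutoff_le_1: "cutoff w \<rho> z \<le> 1"
proof -
  have "0 \<le> (Re z - Re w)\<^sup>2 / \<rho>\<^sup>2" "0 \<le> ((Im z)\<^sup>2 - (Im w)\<^sup>2)\<^sup>2 / (\<rho> * (\<rho> + \<bar>Im w\<bar>))\<^sup>2" by simp_all
  then show ?thesis unfolding cutoff_def by linarith
qed

lemma cutoff_nonneg_bounds:
  assumes "\<rho> > 0" "cutoff w \<rho> z \<ge> 0"
  shows "\<bar>Re z - Re w\<bar> \<le> \<rho>" "\<bar>(Im z)\<^sup>2 - (Im w)\<^sup>2\<bar> \<le> \<rho> * (\<rho> + \<bar>Im w\<bar>)" "\<bar>\<bar>Im z\<bar> - \<bar>Im w\<bar>\<bar> \<le> 2 * \<rho>"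
    "\<bar>Im z\<bar> \<le> \<rho> + \<bar>Im w\<bar>"
proof -
  let ?k = "\<rho> + \<bar>Im w\<bar>"
  have k: "?k > 0" using assms by simp
  have a: "0 \<le> (Re z - Re w)\<^sup>2 / \<rho>\<^sup>2" and b: "0 \<le> ((Im z)\<^sup>2 - (Im w)\<^sup>2)\<^sup>2 / (\<rho> * ?k)\<^sup>2" by simp_all
  have "(Re z - Re w)\<^sup>2 / \<rho>\<^sup>2 \<le> 1" using assms(2) b unfolding cutoff_def by linarith
  then have "(Re z - Re w)\<^sup>2 \<le> \<rho>\<^sup>2" using assms(1) by (simp add: field_simps)
  then show "\<bar>Re z - Re w\<bar> \<le> \<rho>" using assms(1) abs_le_square_iff[of "Re z - Re w" \<rho>] by simp
  have "((Im z)\<^sup>2 - (Im w)\<^sup>2)\<^sup>2 / (\<rho> * ?k)\<^sup>2 \<le> 1" using assms(2) a unfolding cutoff_def by linarith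
  then have "((Im z)\<^sup>2 - (Im w)\<^sup>2)\<^sup>2 \<le> (\<rho> * ?k)\<^sup>2" using assms(1) k by (subst (asm) divide_le_eq_1_pos) auto
  then show c: "\<bar>(Im z)\<^sup>2 - (Im w)\<^sup>2\<bar> \<le> \<rho> * ?k"
    using assms(1) k abs_le_square_iff[of "(Im z)\<^sup>2 - (Im w)\<^sup>2" "\<rho> * ?k"] by simp
  have "\<bar>Im z\<bar>\<^sup>2 \<le> \<bar>Im w\<bar>\<^sup>2 + \<rho> * ?k" using c by simp
  also have "\<dots> \<le> ?k\<^sup>2" using assms(1) by (simp add: power2_eq_square algebra_simps)
  finally show d: "\<bar>Im z\<bar> \<le> ?k" using k power2_le_imp_le[of "\<bar>Im z\<bar>" ?k] by simp
  have e: "\<bar>Im w\<bar> - \<bar>Im z\<bar> \<le> 2 * \<rho>"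
  proof (rule ccontr)
    assume "\<not> ?thesis"
    then have g: "2 * \<rho> < \<bar>Im w\<bar> - \<bar>Im z\<bar>" by simp
    have "2 * \<rho> * \<bar>Im w\<bar> \<le> (\<bar>Im w\<bar> - \<bar>Im z\<bar>) * (\<bar>Im w\<bar> + \<bar>Im z\<bar>)"
      using g assms(1) by (intro mult_mono) auto
    also have "\<dots> \<le> \<rho> * ?k" using c by (simp add: power2_eq_square algebra_simps abs_le_iff)
    finally have "2 * \<bar>Im w\<bar> \<le> ?k" using assms(1) by simp
    then show False using g assms(1) by simp
  qed
  then show "\<bar>\<bar>Im z\<bar> - \<bar>Im w\<bar>\<bar> \<le> 2 * \<rho>" using d assms(1) by (intro abs_leI) linarith+
qed

lemma cutoff_ge_half:
  assumes "\<rho> > 0" "fold_dist z w \<le> \<rho> / 4"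
  shows "cutoff w \<rho> z \<ge> 1 / 2"
proof -
  let ?k = "\<rho> + \<bar>Im w\<bar>"
  have d: "\<bar>Re z - Re w\<bar> \<le> \<rho> / 4" "\<bar>\<bar>Im z\<bar> - \<bar>Im w\<bar>\<bar> \<le> \<rho> / 4" using assms(2) unfolding fold_dist_le_iff by auto
  have k: "?k > 0" using assms by simp
  have "(Re z - Re w)\<^sup>2 \<le> (\<rho> / 4)\<^sup>2" using d(1) assms(1) abs_le_square_iff[of "Re z - Re w" "\<rho> / 4"] by simp
  then have "(Re z - Re w)\<^sup>2 / \<rho>\<^sup>2 \<le> (\<rho> / 4)\<^sup>2 / \<rho>\<^sup>2" by (rule divide_right_mono) simp
  then have 1: "(Re z - Re w)\<^sup>2 / \<rho>\<^sup>2 \<le> 1 / 16" using assms(1) by (simp add: power_divide)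
  have "\<bar>(Im z)\<^sup>2 - (Im w)\<^sup>2\<bar> = \<bar>(\<bar>Im z\<bar> - \<bar>Im w\<bar>) * (\<bar>Im z\<bar> + \<bar>Im w\<bar>)\<bar>"
    using square_diff_square_factored[of "\<bar>Im z\<bar>" "\<bar>Im w\<bar>"] by (simp add: power2_eq_square mult.commute)
  also have "\<dots> = \<bar>\<bar>Im z\<bar> - \<bar>Im w\<bar>\<bar> * (\<bar>Im z\<bar> + \<bar>Im w\<bar>)" by (simp add: abs_mult)
  also have "\<dots> \<le> (\<rho> / 4) * (2 * ?k)"
  proof (rule mult_mono)
    have "u + v \<le> 2 * (\<rho> + v)" if "u - v \<le> \<rho> / 4" for u v using that assms(1) by (simp add: algebra_simps)
    then show "\<bar>Im z\<bar> + \<bar>Im w\<bar> \<le> 2 * ?k" using abs_le_D1[OF d(2)] .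
  qed (use d assms(1) in auto)
  also have "\<dots> = \<rho> * ?k / 2" by (simp add: algebra_simps)
  finally have "\<bar>(Im z)\<^sup>2 - (Im w)\<^sup>2\<bar> \<le> \<rho> * ?k / 2" .
  then have "((Im z)\<^sup>2 - (Im w)\<^sup>2)\<^sup>2 \<le> (\<rho> * ?k / 2)\<^sup>2"
    using assms(1) k abs_le_square_iff[of "(Im z)\<^sup>2 - (Im w)\<^sup>2" "\<rho> * ?k / 2"] by simp
  then have 2: "((Im z)\<^sup>2 - (Im w)\<^sup>2)\<^sup>2 / (\<rho> * ?k)\<^sup>2 \<le> 1 / 4"
    using assms(1) k by (simp add: divide_le_eq power_divide)
  show ?thesis using 1 2 by (simp add: cutoff_def)
qed

lemma cutoff_partials:
  assumes "\<rho> > 0" "lam \<ge> 0"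
  obtains px py pxx pyy where "partials UNIV (cutoff w \<rho>) px py pxx pyy"
    "\<And>z. cutoff w \<rho> z \<ge> 0 \<Longrightarrow> (px z)\<^sup>2 + (py z)\<^sup>2 \<le> 20 / \<rho>\<^sup>2"
    "\<And>z. cutoff w \<rho> z \<ge> 0 \<Longrightarrow> Im z \<noteq> 0 \<Longrightarrow> pxx z + pyy z + 2 * lam / Im z * py z \<ge> - (14 + 8 * lam) / \<rho>\<^sup>2"
proof -
  define k where "k = \<rho> + \<bar>Im w\<bar>"
  have k: "k \<ge> \<rho>" "k > 0" using assms by (auto simp: k_def)
  define px where "px z = - (2 * (Re z - Re w)) / \<rho>\<^sup>2" for z
  define py where "py z = - (4 * Im z * ((Im z)\<^sup>2 - (Im w)\<^sup>2)) / (\<rho> * k)\<^sup>2" for z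
  define pxx where "pxx z = - 2 / \<rho>\<^sup>2" for z :: complex
  define pyy where "pyy z = - (12 * (Im z)\<^sup>2 - 4 * (Im w)\<^sup>2) / (\<rho> * k)\<^sup>2" for z
  have d1: "((\<lambda>t. 1 - (a + t - b)\<^sup>2 / C - e) has_real_derivative - (2 * (a - b)) / C) (at 0)"
    and d2: "((\<lambda>t. - (2 * (a + t - b)) / C) has_real_derivative - 2 / C) (at 0)"
    and d3: "((\<lambda>t. 1 - e - ((a + t)\<^sup>2 - b)\<^sup>2 / C) has_real_derivative - (4 * a * (a\<^sup>2 - b)) / C) (at 0)"
    and d4: "((\<lambda>t. - (4 * (a + t) * ((a + t)\<^sup>2 - b)) / C) has_real_derivative - (12 * a\<^sup>2 - 4 * b) / C) (at 0)"
    if "C > 0" for a b C e :: real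
    using that by (auto intro!: derivative_eq_intros simp: field_simps power2_eq_square)
  have pos: "\<rho>\<^sup>2 > 0" "(\<rho> * k)\<^sup>2 > 0" using assms k by auto
  have "has_partial 1 (cutoff w \<rho>) z (px z) \<and> has_partial \<i> (cutoff w \<rho>) z (py z) \<and> has_partial 1 px z (pxx z) \<and> has_partial \<i> py z (pyy z)" for z
    using d1[OF pos(1), of "Re z" "Re w" "((Im z)\<^sup>2 - (Im w)\<^sup>2)\<^sup>2 / (\<rho> * k)\<^sup>2"] d2[OF pos(1), of "Re z" "Re w"]
      d3[OF pos(2), of "(Re z - Re w)\<^sup>2 / \<rho>\<^sup>2" "Im z" "(Im w)\<^sup>2"] d4[OF pos(2), of "Im z" "(Im w)\<^sup>2"]
    unfolding has_partial_def has_real_derivative_iff_has_vector_derivative[symmetric] cutoff_def px_def py_def pxx_def pyy_def k_def[symmetric]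
    by simp
  then have 1: "partials UNIV (cutoff w \<rho>) px py pxx pyy"
    unfolding partials_def
    using assms k
    by (auto intro!: continuous_intros simp: cutoff_def[abs_def] px_def[abs_def] py_def[abs_def] pxx_def[abs_def] pyy_def[abs_def] k_def)
  have 2: "(px z)\<^sup>2 + (py z)\<^sup>2 \<le> 20 / \<rho>\<^sup>2" if "cutoff w \<rho> z \<ge> 0" for z
  proof -
    note b = cutoff_nonneg_bounds[OF assms(1) that, folded k_def]
    have "\<bar>px z\<bar> \<le> 2 / \<rho>"
      using b(1) assms(1) by (simp add: px_def abs_mult field_simps power2_eq_square)
    then have "(px z)\<^sup>2 \<le> (2 / \<rho>)\<^sup>2" using assms(1) abs_le_square_iff[of "px z" "2 / \<rho>"] by simp
    moreover have "\<bar>py z\<bar> \<le> 4 / \<rho>"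
    proof -
      have "\<bar>py z\<bar> = 4 * (\<bar>Im z\<bar> * \<bar>(Im z)\<^sup>2 - (Im w)\<^sup>2\<bar>) / (\<rho> * k)\<^sup>2" by (simp add: py_def abs_mult)
      also have "\<dots> \<le> 4 * (k * (\<rho> * k)) / (\<rho> * k)\<^sup>2"
        using b k by (intro divide_right_mono mult_left_mono mult_mono) auto
      also have "\<dots> = 4 / \<rho>" using assms(1) k by (simp add: field_simps power2_eq_square)
      finally show ?thesis .
    qed
    then have "(py z)\<^sup>2 \<le> (4 / \<rho>)\<^sup>2" using assms(1) abs_le_square_iff[of "py z" "4 / \<rho>"] by simp
    ultimately show ?thesis by (simp add: power_divide)
  qed
  have 3: "pxx z + pyy z + 2 * lam / Im z * py z \<ge> - (14 + 8 * lam) / \<rho>\<^sup>2"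
    if "cutoff w \<rho> z \<ge> 0" "Im z \<noteq> 0" for z
  proof -
    note b = cutoff_nonneg_bounds[OF assms(1) that(1), folded k_def]
    have "(Im z)\<^sup>2 \<le> k\<^sup>2" using b(4) k abs_le_square_iff[of "Im z" k] by simp
    then have "12 * (Im z)\<^sup>2 - 4 * (Im w)\<^sup>2 \<le> 12 * k\<^sup>2" using zero_le_power2[of "Im w"] by linarith
    then have "(12 * (Im z)\<^sup>2 - 4 * (Im w)\<^sup>2) / (\<rho> * k)\<^sup>2 \<le> 12 * k\<^sup>2 / (\<rho> * k)\<^sup>2" by (intro divide_right_mono) auto
    also have "\<dots> = 12 / \<rho>\<^sup>2" using k by (simp add: power_mult_distrib)
    finally have a: "pyy z \<ge> - (12 / \<rho>\<^sup>2)" unfolding pyy_def minus_divide_left[symmetric] by simp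
    have "2 * lam / Im z * py z = - (8 * lam * ((Im z)\<^sup>2 - (Im w)\<^sup>2) / (\<rho> * k)\<^sup>2)"
      using that(2) by (simp add: py_def)
    moreover have "8 * lam * ((Im z)\<^sup>2 - (Im w)\<^sup>2) / (\<rho> * k)\<^sup>2 \<le> 8 * lam * (\<rho> * k) / (\<rho> * k)\<^sup>2"
      using b(2) assms(2) by (intro divide_right_mono mult_left_mono) auto
    moreover have "8 * lam * (\<rho> * k) / (\<rho> * k)\<^sup>2 = 8 * lam / (\<rho> * k)"
      using assms(1) k by (simp add: power2_eq_square)
    moreover have "8 * lam / (\<rho> * k) \<le> 8 * lam / \<rho>\<^sup>2"
      using assms k by (intro divide_left_mono) (auto simp: power2_eq_square)
    ultimately have "2 * lam / Im z * py z \<ge> - (8 * lam / \<rho>\<^sup>2)" by linarith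
    moreover have "pxx z = - (2 / \<rho>\<^sup>2)" by (simp add: pxx_def)
    moreover have "- (14 + 8 * lam) / \<rho>\<^sup>2 = - (2 / \<rho>\<^sup>2) + - (12 / \<rho>\<^sup>2) + - (8 * lam / \<rho>\<^sup>2)"
      using assms(1) by (simp add: field_simps)
    ultimately show ?thesis using a by linarith
  qed
  show ?thesis using that[OF 1 2 3] by blast
qed

text \<open>
  The algebra of Bernstein's method at one point. With \<open>\<phi>\<close> the cut-off function, \<open>w = a\<^sup>2 + b\<^sup>2\<close> a sum of squares and
  \<open>LW\<close>, \<open>Lp\<close> the operator applied to \<open>w\<close> and to \<open>\<phi>\<close>, the left-hand side is the operator applied to \<open>\<phi>\<^sup>2 w\<close>. The cross
  terms are absorbed by the squared gradients contained in \<open>LW\<close>.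
\<close>
lemma cutoff_absorption:
  fixes \<phi> w px py :: real
  assumes "0 \<le> \<phi>" "\<phi> \<le> 1" and w: "w = a\<^sup>2 + b\<^sup>2"
    and Wx: "\<bar>Wx\<bar> \<le> 2 * (a * au + b * bu)" and Wy: "\<bar>Wy\<bar> \<le> 2 * (a * av + b * bv)"
    and LW: "LW \<ge> 2 * (au\<^sup>2 + av\<^sup>2 + bu\<^sup>2 + bv\<^sup>2)"
    and G: "px\<^sup>2 + py\<^sup>2 \<le> G" and Lp: "Lp \<ge> - B" and "B \<ge> 0"
  shows "\<phi>\<^sup>2 * LW + w * (2 * \<phi> * Lp + 2 * (px\<^sup>2 + py\<^sup>2)) + 4 * \<phi> * (px * Wx + py * Wy) \<ge> - (2 * B + 6 * G) * w"
proof -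
  have young: "8 * \<phi> * \<bar>p\<bar> * (u * v) \<le> 2 * \<phi>\<^sup>2 * v\<^sup>2 + 8 * p\<^sup>2 * u\<^sup>2" for p u v :: real
  proof -
    have "0 \<le> 2 * (\<phi> * v - 2 * \<bar>p\<bar> * u)\<^sup>2" by simp
    also have "\<dots> = 2 * \<phi>\<^sup>2 * v\<^sup>2 + 8 * \<bar>p\<bar>\<^sup>2 * u\<^sup>2 - 8 * \<phi> * \<bar>p\<bar> * (u * v)"
      by (simp add: power2_diff power_mult_distrib algebra_simps)
    finally show ?thesis by simp
  qed
  have cross: "- (4 * \<phi> * (p * V)) \<le> 8 * \<phi> * \<bar>p\<bar> * (a * u) + 8 * \<phi> * \<bar>p\<bar> * (b * v)"
    if "\<bar>V\<bar> \<le> 2 * (a * u + b * v)" for p V u v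
  proof -
    have "- (4 * \<phi> * (p * V)) \<le> \<bar>4 * \<phi> * (p * V)\<bar>" by simp
    also have "\<dots> = 4 * \<phi> * \<bar>p\<bar> * \<bar>V\<bar>" using assms(1) by (simp add: abs_mult)
    also have "\<dots> \<le> 4 * \<phi> * \<bar>p\<bar> * (2 * (a * u + b * v))" using that assms(1) by (intro mult_left_mono) auto
    finally show ?thesis by (simp add: algebra_simps)
  qed
  have "- (4 * \<phi> * (px * Wx)) - 4 * \<phi> * (py * Wy)
     \<le> 2 * \<phi>\<^sup>2 * (au\<^sup>2 + av\<^sup>2 + bu\<^sup>2 + bv\<^sup>2) + 8 * (px\<^sup>2 + py\<^sup>2) * (a\<^sup>2 + b\<^sup>2)"
    using cross[OF Wx, of px] cross[OF Wy, of py] young[of px a au] young[of px b bu] young[of py a av] young[of py b bv]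
    by (simp add: algebra_simps)
  moreover have "2 * \<phi>\<^sup>2 * (au\<^sup>2 + av\<^sup>2 + bu\<^sup>2 + bv\<^sup>2) \<le> \<phi>\<^sup>2 * LW"
    using mult_left_mono[OF LW, of "\<phi>\<^sup>2"] by (simp add: algebra_simps)
  ultimately have 1: "\<phi>\<^sup>2 * LW + 4 * \<phi> * (px * Wx + py * Wy) \<ge> - (8 * (px\<^sup>2 + py\<^sup>2) * w)"
    unfolding w by (simp add: algebra_simps)
  have "\<phi> * (- B) \<le> \<phi> * Lp" using Lp assms(1) by (intro mult_left_mono) auto
  moreover have "\<phi> * B \<le> B" using assms(2) \<open>B \<ge> 0\<close> mult_right_mono[of \<phi> 1 B] by simp
  ultimately have "- B \<le> \<phi> * Lp" by linarith
  then have "- (2 * B + 6 * G) \<le> 2 * \<phi> * Lp - 6 * (px\<^sup>2 + py\<^sup>2)" using G by (simp add: algebra_simps)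
  moreover have "w \<ge> 0" by (simp add: w)
  ultimately have "- (2 * B + 6 * G) * w \<le> (2 * \<phi> * Lp - 6 * (px\<^sup>2 + py\<^sup>2)) * w"
    by (intro mult_right_mono)
  with 1 show ?thesis by (simp add: algebra_simps)
qed

section \<open>Interior bound for the horizontal derivative\<close>

lemma difference_quotient_uniform:
  fixes f fx :: "complex \<Rightarrow> complex"
  assumes P: "compact P" "continuous_on P fx" and has_partial: "\<And>z. z \<in> P \<Longrightarrow> has_partial 1 f z (fx z)"
    and K: "\<And>z t. z \<in> K \<Longrightarrow> 0 \<le> t \<Longrightarrow> t \<le> \<rho> \<Longrightarrow> z + of_real t \<in> P" and "\<rho> > 0" "\<tau> > 0"
  obtains h where "0 < h" "h \<le> \<rho>"
    "\<And>z. z \<in> K \<Longrightarrow> norm ((f (z + of_real h) - f z) / of_real h - fx z) \<le> \<tau>"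
proof -
  have "uniformly_continuous_on P fx" using P compact_uniformly_continuous by blast
  then obtain d where d: "d > 0" "\<And>x y. x \<in> P \<Longrightarrow> y \<in> P \<Longrightarrow> dist y x < d \<Longrightarrow> dist (fx y) (fx x) < \<tau>"
    using \<open>\<tau> > 0\<close> unfolding uniformly_continuous_on_def by metis
  define h where "h = min \<rho> (d / 2)"
  have h: "0 < h" "h \<le> \<rho>" "h < d" using d(1) \<open>\<rho> > 0\<close> by (auto simp: h_def)
  have "norm ((f (z + of_real h) - f z) / of_real h - fx z) \<le> \<tau>" if z: "z \<in> K" for z
  proof -
    have inP: "z + of_real t \<in> P" if "t \<in> {0..h}" for t using K[OF z, of t] that h by auto
    have "norm (f (z + of_real h * 1) - f (z + of_real 0 * 1) - (h - 0) *\<^sub>R fx (z + of_real 0 * 1)) \<le> norm (h - 0) * \<tau>"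
    proof (rule vector_differentiable_bound_linearization[of "{0..h}" "\<lambda>t. f (z + of_real t * 1)" "\<lambda>t. fx (z + of_real t * 1)"])
      show "((\<lambda>t. f (z + of_real t * 1)) has_vector_derivative fx (z + of_real t * 1)) (at t within {0..h})"
        if "t \<in> {0..h}" for t
        using has_partial[OF inP[OF that]] has_partial_line[of 1 f z t "fx (z + of_real t)"]
        by (auto intro: has_vector_derivative_at_within)
      show "norm (fx (z + of_real t * 1) - fx (z + of_real 0 * 1)) \<le> \<tau>" if "t \<in> {0..h}" for t
        using d(2)[OF inP[of 0] inP[OF that]] that h by (simp add: dist_norm)
    qed (use h in \<open>auto simp: closed_segment_eq_real_ivl\<close>)
    then have "norm (f (z + of_real h) - f z - of_real h * fx z) \<le> h * \<tau>"
      using h by (simp add: scaleR_conv_of_real)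
    moreover have "(f (z + of_real h) - f z) / of_real h - fx z = (f (z + of_real h) - f z - of_real h * fx z) / of_real h"
      using h by (simp add: field_simps)
    ultimately show ?thesis using h by (simp add: norm_divide divide_le_eq mult.commute)
  qed
  then show ?thesis using that h by blast
qed

text \<open>
  Bernstein's method. The constant \<open>148 + 16 \<lambda>\<close> is \<open>2 (14 + 8 \<lambda>) + 6 * 20\<close>, the loss in
  \<open>cutoff_absorption\<close> for the cut-off function; with \<open>k = (148 + 16 \<lambda>) / \<rho>\<^sup>2\<close> the squared gradient of \<open>f\<close>
  in \<open>L W\<close> pays for the loss \<open>k \<bar>g\<bar>\<^sup>2\<close> as soon as the difference quotient \<open>g\<close> is uniformly close to \<open>f\<^sub>x\<close>.
\<close>
lemma dunkl_gradient_x: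
  assumes f: "dunkl_solution lam \<bbbD> f fx fy fxx fyy" and "lam \<ge> 0" "\<rho> > 0"
    and P: "{z. fold_dist z w \<le> 2 * \<rho>} \<subseteq> \<bbbD>"
    and M: "\<And>z. fold_dist z w \<le> 2 * \<rho> \<Longrightarrow> norm (f z) \<le> M"
    and z: "fold_dist z w \<le> \<rho> / 4"
  shows "norm (fx z) \<le> sqrt (8 * (148 + 16 * lam)) * M / \<rho>"
proof -
  define A where "A = 148 + 16 * lam"
  have A: "A > 0" using \<open>lam \<ge> 0\<close> by (simp add: A_def)
  have M0: "M \<ge> 0" using M[of w] \<open>\<rho> > 0\<close> norm_ge_zero[of "f w"] by (simp del: norm_ge_zero)
  define K where "K = {z. cutoff w \<rho> z \<ge> 0}"
  define U where "U = {z. cutoff w \<rho> z > 0}"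
  have cont: "continuous_on UNIV (cutoff w \<rho>)"
    using cutoff_partials[OF \<open>\<rho> > 0\<close> \<open>lam \<ge> 0\<close>, of w] by (metis partials_def)
  have U: "open U" "U \<subseteq> K" unfolding U_def K_def
    by (auto intro!: open_Collect_less continuous_intros cont)
  have KP: "fold_dist (z + of_real t) w \<le> 2 * \<rho>" if "z \<in> K" "0 \<le> t" "t \<le> \<rho>" for z t
    using cutoff_nonneg_bounds(1,3)[of \<rho> w z] that \<open>\<rho> > 0\<close> by (auto simp: K_def fold_dist_le_iff)
  have KP0: "fold_dist z w \<le> 2 * \<rho>" if "z \<in> K" for z using KP[OF that, of 0] \<open>\<rho> > 0\<close> by simp
  have "closed K" unfolding K_def by (intro closed_Collect_le continuous_intros cont)
  moreover have "bounded K"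
    using compact_imp_bounded[OF compact_fold_ball[of w "2 * \<rho>"]] by (rule bounded_subset) (use KP0 in auto)
  ultimately have K: "compact K" using compact_eq_bounded_closed by blast
  have cnjK: "cnj z \<in> K" if "z \<in> K" for z using that by (simp add: K_def cutoff_def)
  have zK: "z \<in> K" and z_half: "cutoff w \<rho> z \<ge> 1 / 2"
    using cutoff_ge_half[OF \<open>\<rho> > 0\<close> z] by (auto simp: K_def)
  have pf: "partials \<bbbD> f fx fy fxx fyy" using f by (simp add: dunkl_solution_def)
  define B where "B = sqrt (8 * A) / \<rho>"
  have B: "B \<ge> 0" using A \<open>\<rho> > 0\<close> by (simp add: B_def)
  have main: "norm (fx z) \<le> B * M + (B + 1) * \<tau>" if "\<tau> > 0" for \<tau>
  proof -
    have contfx: "continuous_on {z. fold_dist z w \<le> 2 * \<rho>} fx"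
      using pf P by (auto simp: partials_def intro: continuous_on_subset)
    have pdf: "has_partial 1 f z (fx z)" if "z \<in> {z. fold_dist z w \<le> 2 * \<rho>}" for z
      using pf P that by (auto simp: partials_def)
    obtain h where h: "0 < h" "h \<le> \<rho>"
      and dq: "\<And>z. z \<in> K \<Longrightarrow> norm ((f (z + of_real h) - f z) / of_real h - fx z) \<le> \<tau>"
      using difference_quotient_uniform[OF compact_fold_ball contfx pdf, of K \<rho> \<tau>] KP \<open>\<rho> > 0\<close> \<open>\<tau> > 0\<close> by blast
    define T where "T = {z. z \<in> \<bbbD> \<and> z + of_real h \<in> \<bbbD>}"
    have T: "z \<in> \<bbbD>" "z + of_real h \<in> \<bbbD>" "cnj z \<in> T" if "z \<in> T" for z
    proof -
      have "cnj z + of_real h = cnj (z + of_real h)" by simp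
      then have "norm (cnj z + of_real h) = norm (z + of_real h)" by (metis complex_mod_cnj)
      then show "z \<in> \<bbbD>" "z + of_real h \<in> \<bbbD>" "cnj z \<in> T" using that by (auto simp: T_def)
    qed
    have KT: "K \<subseteq> T" using KP[of _ 0] KP[of _ h] h \<open>\<rho> > 0\<close> P by (auto simp: T_def subset_iff)
    define g where "g z = (f (z + of_real h) - f z) / of_real h" for z
    obtain gx gy gxx gyy where g: "dunkl_solution lam T g gx gy gxx gyy"
      using dunkl_solution_difference[OF f, of T h] T unfolding g_def by blast
    have fT: "dunkl_solution lam T f fx fy fxx fyy"
      using f T(1) partials_subset[OF pf, of T] unfolding dunkl_solution_def by blast
    obtain Vx Vy Vxx Vyy where V: "partials T (\<lambda>z. (norm (g z))\<^sup>2 + (norm (g (cnj z)))\<^sup>2) Vx Vy Vxx Vyy"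
      and Vx: "\<And>z. z \<in> T \<Longrightarrow> \<bar>Vx z\<bar> \<le> 2 * (norm (g z) * norm (gx z) + norm (g (cnj z)) * norm (gx (cnj z)))"
      and Vy: "\<And>z. z \<in> T \<Longrightarrow> \<bar>Vy z\<bar> \<le> 2 * (norm (g z) * norm (gy z) + norm (g (cnj z)) * norm (gy (cnj z)))"
      and LV: "\<And>z. z \<in> T \<Longrightarrow> Im z \<noteq> 0 \<Longrightarrow> Vxx z + Vyy z + 2 * lam / Im z * Vy z
         \<ge> 2 * ((norm (gx z))\<^sup>2 + (norm (gy z))\<^sup>2 + (norm (gx (cnj z)))\<^sup>2 + (norm (gy (cnj z)))\<^sup>2)"
      using dunkl_solution_Bochner[OF g T(3) \<open>lam \<ge> 0\<close>] by blast
    obtain Wx Wy Wxx Wyy where W: "partials T (\<lambda>z. (norm (f z))\<^sup>2 + (norm (f (cnj z)))\<^sup>2) Wx Wy Wxx Wyy"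
      and "\<And>z. z \<in> T \<Longrightarrow> \<bar>Wx z\<bar> \<le> 2 * (norm (f z) * norm (fx z) + norm (f (cnj z)) * norm (fx (cnj z)))"
      and "\<And>z. z \<in> T \<Longrightarrow> \<bar>Wy z\<bar> \<le> 2 * (norm (f z) * norm (fy z) + norm (f (cnj z)) * norm (fy (cnj z)))"
      and LW: "\<And>z. z \<in> T \<Longrightarrow> Im z \<noteq> 0 \<Longrightarrow> Wxx z + Wyy z + 2 * lam / Im z * Wy z
         \<ge> 2 * ((norm (fx z))\<^sup>2 + (norm (fy z))\<^sup>2 + (norm (fx (cnj z)))\<^sup>2 + (norm (fy (cnj z)))\<^sup>2)"
      using dunkl_solution_Bochner[OF fT T(3) \<open>lam \<ge> 0\<close>] by blast
    obtain px py pxx pyy where p0: "partials UNIV (cutoff w \<rho>) px py pxx pyy"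
      and pg: "\<And>z. cutoff w \<rho> z \<ge> 0 \<Longrightarrow> (px z)\<^sup>2 + (py z)\<^sup>2 \<le> 20 / \<rho>\<^sup>2"
      and pL: "\<And>z. cutoff w \<rho> z \<ge> 0 \<Longrightarrow> Im z \<noteq> 0 \<Longrightarrow> pxx z + pyy z + 2 * lam / Im z * py z \<ge> - (14 + 8 * lam) / \<rho>\<^sup>2"
      using cutoff_partials[OF \<open>\<rho> > 0\<close> \<open>lam \<ge> 0\<close>] by blast
    have p: "partials T (cutoff w \<rho>) px py pxx pyy" using partials_subset[OF p0] by simp
    have idp: "partials T (\<lambda>z. z) (\<lambda>_. 1) (\<lambda>_. \<i>) (\<lambda>_. 0) (\<lambda>_. 0)"
      unfolding partials_def has_partial_def by (auto intro!: continuous_intros derivative_eq_intros)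
    \<comment> \<open>The term \<open>\<epsilon> \<bar>z\<bar>\<^sup>2\<close> makes the inequality strict: it has to beat the error \<open>4 k \<tau>\<^sup>2\<close> caused by the
      difference between \<open>g\<close> and \<open>f\<^sub>x\<close>, and \<open>L\<close> applied to it is at least \<open>4 \<epsilon>\<close>.\<close>
    define \<epsilon> where "\<epsilon> = 2 * A * \<tau>\<^sup>2 / \<rho>\<^sup>2"
    define k where "k = A / \<rho>\<^sup>2"
    have k: "k > 0" using A \<open>\<rho> > 0\<close> by (simp add: k_def)
    have \<epsilon>: "\<epsilon> = 2 * k * \<tau>\<^sup>2" by (simp add: \<epsilon>_def k_def)
    note sq = partials_bilinear[OF bounded_bilinear_mult p p]
    note F = partials_add[OF partials_bilinear[OF bounded_bilinear_mult sq V]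
        partials_add[OF partials_linear[OF bounded_linear_mult_right[of k] W]
          partials_linear[OF bounded_linear_mult_right[of \<epsilon>] partials_bilinear[OF bounded_bilinear_inner idp idp]]]]
    have "cutoff w \<rho> z * cutoff w \<rho> z * ((norm (g z))\<^sup>2 + (norm (g (cnj z)))\<^sup>2) +
        (k * ((norm (f z))\<^sup>2 + (norm (f (cnj z)))\<^sup>2) + \<epsilon> * (z \<bullet> z)) \<le> k * (2 * M\<^sup>2) + \<epsilon>"
    proof (rule weinstein_maximum_principle[OF F \<open>lam \<ge> 0\<close> K KT U _ _ _ zK, of "2 * k * \<tau>\<^sup>2 * 2 - 2 * k * \<tau>\<^sup>2 * 1"], goal_cases)
      case 1
      show ?case using k \<open>\<tau> > 0\<close> by simp
    next
      case (2 v)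
      have vK: "v \<in> K" and vT: "v \<in> T" and cv: "cutoff w \<rho> v \<ge> 0" using 2 U KT by (auto simp: K_def)
      define l where "l = 2 * lam / Im v"
      have l: "l * Im v = 2 * lam" using 2 by (simp add: l_def)
      let ?c = "cutoff w \<rho> v"
      let ?V = "(norm (g v))\<^sup>2 + (norm (g (cnj v)))\<^sup>2"
      have a: "?c\<^sup>2 * (Vxx v + Vyy v + l * Vy v) + ?V * (2 * ?c * (pxx v + pyy v + l * py v) + 2 * ((px v)\<^sup>2 + (py v)\<^sup>2))
          + 4 * ?c * (px v * Vx v + py v * Vy v) \<ge> - (2 * ((14 + 8 * lam) / \<rho>\<^sup>2) + 6 * (20 / \<rho>\<^sup>2)) * ?V"
        unfolding l_def
        by (rule cutoff_absorption[OF cv cutoff_le_1 refl Vx[OF vT] Vy[OF vT] LV[OF vT 2(2)] pg[OF cv]])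
           (use pL[OF cv 2(2), unfolded minus_divide_left[symmetric]] \<open>lam \<ge> 0\<close> in simp_all)
      have "2 * ((14 + 8 * lam) / \<rho>\<^sup>2) + 6 * (20 / \<rho>\<^sup>2) = k"
        by (simp add: k_def A_def add_divide_distrib)
      note a = a[unfolded this]
      have comp: "(norm (g u))\<^sup>2 \<le> 2 * (norm (fx u))\<^sup>2 + 2 * \<tau>\<^sup>2" if "u \<in> K" for u
      proof -
        have "norm (g u) \<le> norm (fx u) + \<tau>"
          using dq[OF that] norm_triangle_sub[of "g u" "fx u"] by (simp add: g_def)
        then have "(norm (g u))\<^sup>2 \<le> (norm (fx u) + \<tau>)\<^sup>2" by (intro power_mono) auto
        also have "\<dots> \<le> 2 * (norm (fx u))\<^sup>2 + 2 * \<tau>\<^sup>2"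
          using zero_le_power2[of "norm (fx u) - \<tau>"] by (simp add: power2_sum power2_diff)
        finally show ?thesis .
      qed
      have "?V \<le> 2 * ((norm (fx v))\<^sup>2 + (norm (fx (cnj v)))\<^sup>2) + 4 * \<tau>\<^sup>2"
        using comp[OF vK] comp[OF cnjK[OF vK]] by simp
      also have "\<dots> \<le> 2 * ((norm (fx v))\<^sup>2 + (norm (fy v))\<^sup>2 + (norm (fx (cnj v)))\<^sup>2 + (norm (fy (cnj v)))\<^sup>2) + 4 * \<tau>\<^sup>2"
        by simp
      also have "\<dots> \<le> Wxx v + Wyy v + l * Wy v + 4 * \<tau>\<^sup>2"
        using LW[OF vT 2(2)] by (simp add: l_def)
      finally have b: "k * ?V \<le> k * (Wxx v + Wyy v + l * Wy v) + 4 * k * \<tau>\<^sup>2"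
        using mult_left_mono[of ?V "Wxx v + Wyy v + l * Wy v + 4 * \<tau>\<^sup>2" k] k by (simp add: algebra_simps)
      have c: "\<epsilon> * (4 + l * (2 * Im v)) \<ge> 4 * \<epsilon>"
      proof -
        have "l * (2 * Im v) = 4 * lam" using l by simp
        moreover have "\<epsilon> \<ge> 0" using k by (simp add: \<epsilon>)
        ultimately show ?thesis using \<open>lam \<ge> 0\<close> by (simp add: distrib_left)
      qed
      have i1: "v \<bullet> \<i> = Im v" "\<i> \<bullet> v = Im v" by (simp_all add: inner_complex_def)
      have "4 * \<epsilon> - 4 * k * \<tau>\<^sup>2 = 2 * k * \<tau>\<^sup>2 * 2"
        by (simp add: \<epsilon>)
      then have "2 * k * \<tau>\<^sup>2 * 2 - 2 * k * \<tau>\<^sup>2 * 1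
        \<le> (?c\<^sup>2 * (Vxx v + Vyy v + l * Vy v) + ?V * (2 * ?c * (pxx v + pyy v + l * py v) + 2 * ((px v)\<^sup>2 + (py v)\<^sup>2))
          + 4 * ?c * (px v * Vx v + py v * Vy v)) + k * (Wxx v + Wyy v + l * Wy v) + \<epsilon> * (4 + l * (2 * Im v))"
        using a b c mult_nonneg_nonneg[OF less_imp_le[OF k] zero_le_power2[of \<tau>]] by linarith
      then show ?case
        unfolding l_def[symmetric] by (simp add: i1 power2_eq_square algebra_simps)
    next
      case (3 v)
      then have vK: "v \<in> K" and cv: "cutoff w \<rho> v = 0" by (auto simp: K_def U_def)
      have n: "norm (f u) ^ 2 \<le> M\<^sup>2" if "u \<in> K" for u
        using M[OF KP0[OF that]] by (intro power_mono) auto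
      have "norm v < 1" using KT T(1) vK by auto
      then have "v \<bullet> v \<le> 1" by (simp add: dot_square_norm power_le_one)
      then have "\<epsilon> * (v \<bullet> v) \<le> \<epsilon> * 1" using k by (intro mult_left_mono) (auto simp: \<epsilon>)
      moreover have "k * ((norm (f v))\<^sup>2 + (norm (f (cnj v)))\<^sup>2) \<le> k * (2 * M\<^sup>2)"
        using n[OF vK] n[OF cnjK[OF vK]] k by (intro mult_left_mono) auto
      ultimately show ?case using cv by simp
    qed
    moreover have "0 \<le> k * ((norm (f z))\<^sup>2 + (norm (f (cnj z)))\<^sup>2)" "0 \<le> \<epsilon> * (z \<bullet> z)"
      using k by (auto simp: \<epsilon>)
    ultimately have up: "cutoff w \<rho> z * cutoff w \<rho> z * ((norm (g z))\<^sup>2 + (norm (g (cnj z)))\<^sup>2) \<le> k * (2 * M\<^sup>2) + \<epsilon>"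
      by linarith
    have "1 / 4 \<le> cutoff w \<rho> z * cutoff w \<rho> z"
      using mult_mono[OF z_half z_half] z_half by simp
    then have "1 / 4 * (norm (g z))\<^sup>2 \<le> cutoff w \<rho> z * cutoff w \<rho> z * ((norm (g z))\<^sup>2 + (norm (g (cnj z)))\<^sup>2)"
      by (intro mult_mono) auto
    with up have "(norm (g z))\<^sup>2 \<le> 8 * k * (M\<^sup>2 + \<tau>\<^sup>2)" by (simp add: \<epsilon> algebra_simps)
    also have "\<dots> = B\<^sup>2 * (M\<^sup>2 + \<tau>\<^sup>2)"
      using A by (simp add: B_def k_def power_divide)
    also have "\<dots> \<le> B\<^sup>2 * (M + \<tau>)\<^sup>2"
      using M0 \<open>\<tau> > 0\<close> by (intro mult_left_mono) (auto simp: power2_sum)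
    finally have "(norm (g z))\<^sup>2 \<le> (B * (M + \<tau>))\<^sup>2" by (simp only: power_mult_distrib)
    then have "norm (g z) \<le> B * (M + \<tau>)"
      by (rule power2_le_imp_le) (use B M0 \<open>\<tau> > 0\<close> in simp)
    moreover have "norm (fx z) \<le> norm (g z) + \<tau>"
      using dq[OF zK] norm_triangle_sub[of "fx z" "g z"] by (simp add: g_def norm_minus_commute)
    ultimately show ?thesis by (simp add: algebra_simps)
  qed
  have "norm (fx z) \<le> B * M"
  proof (rule field_le_epsilon)
    fix e :: real assume "e > 0"
    then show "norm (fx z) \<le> B * M + e"
      using main[of "e / (B + 1)"] B by simp
  qed
  then show ?thesis by (simp add: B_def A_def)
qed

section \<open>Oscillation over small boxes\<close>

lemma vector_mvt_bound:
  fixes f :: "real \<Rightarrow> 'a::real_inner"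
  assumes "a \<le> b" "continuous_on {a..b} f"
    and f': "\<And>x. a < x \<Longrightarrow> x < b \<Longrightarrow> (f has_vector_derivative f' x) (at x)"
    and B: "\<And>x. a < x \<Longrightarrow> x < b \<Longrightarrow> norm (f' x) \<le> B"
  shows "norm (f b - f a) \<le> B * (b - a)"
proof (cases "a = b")
  case False
  then have "a < b" using assms(1) by simp
  then obtain x where x: "a < x" "x < b" "norm (f b - f a) \<le> norm ((b - a) *\<^sub>R f' x)"
    using mvt_general[OF _ assms(2), of "\<lambda>x h. h *\<^sub>R f' x"] f' by (auto simp: has_vector_derivative_def)
  then have "norm (f b - f a) \<le> (b - a) * norm (f' x)" using \<open>a < b\<close> by simp
  also have "\<dots> \<le> (b - a) * B" using B[OF x(1,2)] \<open>a < b\<close> by (intro mult_left_mono) auto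
  finally show ?thesis by (simp add: mult.commute)
qed simp

lemma has_partial_segment_bound:
  fixes f F :: "complex \<Rightarrow> complex"
  assumes "continuous_on ((\<lambda>t. u + of_real t * e) ` {min 0 T..max 0 T}) f"
    and "\<And>t. min 0 T < t \<Longrightarrow> t < max 0 T \<Longrightarrow> has_partial e f (u + of_real t * e) (F (u + of_real t * e)) \<and> norm (F (u + of_real t * e)) \<le> B"
  shows "norm (f (u + of_real T * e) - f u) \<le> B * \<bar>T\<bar>"
proof -
  have "norm (f (u + of_real (max 0 T) * e) - f (u + of_real (min 0 T) * e)) \<le> B * (max 0 T - min 0 T)"
  proof (rule vector_mvt_bound)
    show "continuous_on {min 0 T..max 0 T} (\<lambda>t. f (u + of_real t * e))"
      by (rule continuous_on_compose2[OF assms(1)]) (auto intro!: continuous_intros)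
  qed (use assms(2) in \<open>auto simp: has_partial_line\<close>)
  then show ?thesis by (cases "T \<ge> 0") (auto simp: max_def min_def norm_minus_commute)
qed

text \<open>
  If \<open>\<bar>Im z\<bar>\<close> is at least \<open>\<rho> / 8\<close>, the bound on \<open>f\<close> suffices. Otherwise the vertical segment from the axis to
  \<open>z\<close> stays where \<open>f\<^sub>x\<close> is bounded, and the odd part \<open>o\<close> of \<open>f\<close> on it satisfies
  \<open>(s\<^bsup>2\<lambda>\<^esup> o)' = \<i> s\<^bsup>2\<lambda>\<^esup> (f\<^sub>x(\<zeta>) + f\<^sub>x(cnj \<zeta>))\<close>, by the first-order equation at \<open>\<zeta>\<close> and \<open>cnj \<zeta>\<close>.
\<close>
lemma dunkl_odd_part_bound:
  assumes f: "dunkl_solution lam \<bbbD> f fx fy fxx fyy" and "lam \<ge> 0" "\<rho> > 0"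
    and P: "{z. fold_dist z w \<le> 2 * \<rho>} \<subseteq> \<bbbD>"
    and M: "\<And>z. fold_dist z w \<le> 2 * \<rho> \<Longrightarrow> norm (f z) \<le> M"
    and z: "fold_dist z w \<le> \<rho> / 8"
  shows "norm (f z - f (cnj z)) \<le> 2 * (sqrt (8 * (148 + 16 * lam)) * M / \<rho>) * \<bar>Im z\<bar>"
proof -
  define B where "B = sqrt (8 * (148 + 16 * lam)) * M / \<rho>"
  have M0: "M \<ge> 0" using M[of w] \<open>\<rho> > 0\<close> norm_ge_zero[of "f w"] by (simp del: norm_ge_zero)
  have pf: "partials \<bbbD> f fx fy fxx fyy" using f by (simp add: dunkl_solution_def)
  have main: "norm (f z - f (cnj z)) \<le> 2 * B * Im z" if z: "fold_dist z w \<le> \<rho> / 8" and y: "Im z > 0" for z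
  proof (cases "Im z \<ge> \<rho> / 8")
    case True
    have "norm (f z - f (cnj z)) \<le> norm (f z) + norm (f (cnj z))" by (rule norm_triangle_ineq4)
    also have "\<dots> \<le> 2 * M" using M[of z] M[of "cnj z"] z \<open>\<rho> > 0\<close> by simp
    also have "\<dots> = 2 * (8 * M / \<rho>) * (\<rho> / 8)" using \<open>\<rho> > 0\<close> by simp
    also have "\<dots> \<le> 2 * B * Im z"
    proof (intro mult_mono)
      have "8 \<le> sqrt (8 * (148 + 16 * lam))" using \<open>lam \<ge> 0\<close> by (intro real_le_rsqrt) simp
      then show "8 * M / \<rho> \<le> B" using M0 \<open>\<rho> > 0\<close> unfolding B_def by (intro divide_right_mono mult_right_mono) auto
      then show "0 \<le> 2 * B" using M0 \<open>\<rho> > 0\<close> by (meson divide_nonneg_pos mult_nonneg_nonneg order_trans zero_le_numeral)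
    qed (use True M0 \<open>\<rho> > 0\<close> in auto)
    finally show ?thesis .
  next
    case False
    define \<zeta> where "\<zeta> s = complex_of_real (Re z) + of_real s * \<i>" for s
    have near: "fold_dist (\<zeta> s) w \<le> \<rho> / 4" if "0 \<le> s" "s \<le> Im z" for s
    proof -
      have r: "\<bar>Re z - Re w\<bar> \<le> \<rho> / 8" and i: "\<bar>\<bar>Im z\<bar> - \<bar>Im w\<bar>\<bar> \<le> \<rho> / 8"
        using z unfolding fold_dist_le_iff by auto
      have "\<bar>Im w\<bar> \<le> \<rho> / 4" using abs_le_D2[OF i] y False by simp
      note r
      moreover have "\<bar>\<bar>s\<bar> - \<bar>Im w\<bar>\<bar> \<le> \<rho> / 4"
        using \<open>\<bar>Im w\<bar> \<le> \<rho> / 4\<close> that False by (intro abs_leI) auto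
      ultimately show ?thesis using \<open>\<rho> > 0\<close> unfolding fold_dist_le_iff \<zeta>_def by auto
    qed
    have near': "fold_dist (cnj (\<zeta> s)) w \<le> \<rho> / 4" if "0 \<le> s" "s \<le> Im z" for s
      using near[OF that] by simp
    have inD: "\<zeta> s \<in> \<bbbD>" "cnj (\<zeta> s) \<in> \<bbbD>" if "0 \<le> s" "s \<le> Im z" for s
      using near[OF that] near'[OF that] P \<open>\<rho> > 0\<close> by (auto simp: subset_iff)
    have fxB: "norm (fx (\<zeta> s)) \<le> B" "norm (fx (cnj (\<zeta> s))) \<le> B" if "0 \<le> s" "s \<le> Im z" for s
      using dunkl_gradient_x[OF f \<open>lam \<ge> 0\<close> \<open>\<rho> > 0\<close> P M near[OF that]]
        dunkl_gradient_x[OF f \<open>lam \<ge> 0\<close> \<open>\<rho> > 0\<close> P M near'[OF that]] by (auto simp: B_def)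
    have \<zeta>y: "\<zeta> (Im z) = z" "Im (\<zeta> s) = s" "\<zeta> 0 = cnj (\<zeta> 0)" for s by (simp_all add: \<zeta>_def complex_eq_iff)
    define o' where "o' s = f (\<zeta> s) - f (cnj (\<zeta> s))" for s
    define dm where "dm s = fy (\<zeta> s) + fy (cnj (\<zeta> s))" for s
    have do': "(o' has_vector_derivative dm s) (at s)" if "0 \<le> s" "s \<le> Im z" for s
    proof -
      have "has_partial \<i> f (\<zeta> s) (fy (\<zeta> s))" "has_partial \<i> f (cnj (\<zeta> s)) (fy (cnj (\<zeta> s)))"
        using pf inD[OF that] by (auto simp: partials_def)
      then have "has_partial \<i> (\<lambda>z. f z - f (cnj z)) (\<zeta> s) (fy (\<zeta> s) - (- fy (cnj (\<zeta> s))))"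
        by (intro has_partial_diff has_partial_cnj_im)
      then show ?thesis unfolding \<zeta>_def has_partial_line o'_def dm_def by simp
    qed
    have dm: "of_real s * dm s + of_real (2 * lam) * o' s = of_real s * (\<i> * (fx (\<zeta> s) + fx (cnj (\<zeta> s))))"
      if "0 < s" "s \<le> Im z" for s
    proof -
      have s: "0 \<le> s" "s \<le> Im z" using that by auto
      have "fx (\<zeta> s) + \<i> * fy (\<zeta> s) = - \<i> * of_real lam * o' s / of_real s"
        "fx (cnj (\<zeta> s)) + \<i> * fy (cnj (\<zeta> s)) = - \<i> * of_real lam * o' s / of_real s"
      proof -
        have CR: "fx v + \<i> * fy v = - \<i> * of_real lam * (f v - f (cnj v)) / of_real (Im v)"
          if "v \<in> \<bbbD>" "Im v \<noteq> 0" for v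
          using f that unfolding dunkl_solution_def by blast
        have flip: "- \<i> * c * (b - a) / (- d) = - \<i> * c * (a - b) / d" for a b c d :: complex
          by (simp add: algebra_simps diff_divide_distrib)
        show "fx (\<zeta> s) + \<i> * fy (\<zeta> s) = - \<i> * of_real lam * o' s / of_real s"
          using CR[OF inD(1)[OF s]] that by (simp add: \<zeta>y o'_def)
        show "fx (cnj (\<zeta> s)) + \<i> * fy (cnj (\<zeta> s)) = - \<i> * of_real lam * o' s / of_real s"
          using CR[OF inD(2)[OF s]] that flip[of "of_real lam" "f (cnj (\<zeta> s))" "f (\<zeta> s)" "of_real s"]
          by (simp only: \<zeta>y o'_def complex_cnj_cnj complex_cnj cnj.sel of_real_minus)
      qed
      then have "of_real s * (fx (\<zeta> s) + \<i> * fy (\<zeta> s)) = - \<i> * of_real lam * o' s"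
        "of_real s * (fx (cnj (\<zeta> s)) + \<i> * fy (cnj (\<zeta> s))) = - \<i> * of_real lam * o' s"
        using that by auto
      then have "\<i> * (of_real s * (fx (\<zeta> s) + \<i> * fy (\<zeta> s)) + of_real s * (fx (cnj (\<zeta> s)) + \<i> * fy (cnj (\<zeta> s))))
         = \<i> * (2 * (- \<i> * of_real lam * o' s))" by simp
      moreover have ii: "\<i> * (\<i> * x) = - x" for x by (simp flip: mult.assoc)
      ultimately show ?thesis by (simp add: dm_def algebra_simps ii)
    qed
    have "norm (o' (Im z)) \<le> 2 * B * Im z + e" if "e > 0" for e
    proof -
      have "isCont o' 0" using do'[of 0] y has_vector_derivative_continuous by auto
      moreover have "o' 0 = 0" using \<zeta>y(3) by (simp add: o'_def)
      ultimately obtain d where d: "d > 0" "\<And>s. dist s 0 < d \<Longrightarrow> norm (o' s) < e"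
        using \<open>e > 0\<close> unfolding continuous_at_eps_delta by (metis dist_0_norm dist_commute)
      \<comment> \<open>Integration starts at a point \<open>a > 0\<close> where the odd part is smaller than \<open>e\<close>, because for \<open>\<lambda> = 0\<close>
        the factor \<open>s powr (2 * lam)\<close> jumps at 0, where \<open>0 powr 0 = 0\<close>.\<close>
      define a where "a = min (d / 2) (Im z)"
      have a: "0 < a" "a \<le> Im z" "a < d" using d(1) y by (auto simp: a_def)
      define q where "q s = (s powr (2 * lam)) *\<^sub>R o' s" for s
      have dq: "(q has_vector_derivative (s powr (2 * lam)) *\<^sub>R (\<i> * (fx (\<zeta> s) + fx (cnj (\<zeta> s))))) (at s)"
        if "0 < s" "s \<le> Im z" for s
      proof -
        have "(q has_vector_derivative (s powr (2 * lam)) *\<^sub>R dm s + (2 * lam * s powr (2 * lam - 1)) *\<^sub>R o' s) (at s)"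
          unfolding q_def
          by (rule has_vector_derivative_scaleR) (use that do'[of s] in \<open>auto intro!: derivative_eq_intros\<close>)
        moreover have "of_real s * ((s powr (2 * lam)) *\<^sub>R dm s + (2 * lam * s powr (2 * lam - 1)) *\<^sub>R o' s)
            = of_real (s powr (2 * lam)) * (of_real s * dm s + of_real (2 * lam) * o' s)"
        proof -
          have "s * s powr (2 * lam - 1) = s powr (2 * lam)" using that by (simp add: powr_diff)
          then have "complex_of_real s * of_real (s powr (2 * lam - 1)) = of_real (s powr (2 * lam))"
            by (metis of_real_mult)
          then show ?thesis by (simp add: scaleR_conv_of_real algebra_simps)
        qed
        ultimately show ?thesis unfolding dm[OF that]
          using that by (simp add: scaleR_conv_of_real)
      qed
      have "norm (q (Im z) - q a) \<le> (Im z powr (2 * lam) * (2 * B)) * (Im z - a)"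
      proof (rule vector_mvt_bound[OF a(2)])
        show "continuous_on {a..Im z} q"
        proof (rule continuous_at_imp_continuous_on, rule ballI)
          fix s assume "s \<in> {a..Im z}"
          then show "isCont q s" using has_vector_derivative_continuous[OF dq[of s]] a by auto
        qed
        show "(q has_vector_derivative (s powr (2 * lam)) *\<^sub>R (\<i> * (fx (\<zeta> s) + fx (cnj (\<zeta> s))))) (at s)"
          if "a < s" "s < Im z" for s using dq that a by auto
        show "norm ((s powr (2 * lam)) *\<^sub>R (\<i> * (fx (\<zeta> s) + fx (cnj (\<zeta> s))))) \<le> Im z powr (2 * lam) * (2 * B)"
          if "a < s" "s < Im z" for s
        proof -
          have "norm (fx (\<zeta> s) + fx (cnj (\<zeta> s))) \<le> 2 * B"
            using norm_triangle_ineq[of "fx (\<zeta> s)" "fx (cnj (\<zeta> s))"] fxB[of s] that a by simp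
          moreover have "s powr (2 * lam) \<le> Im z powr (2 * lam)"
            using that a \<open>lam \<ge> 0\<close> by (intro powr_mono2) auto
          ultimately show ?thesis by (simp add: norm_mult mult_mono)
        qed
      qed
      also have "\<dots> \<le> (Im z powr (2 * lam) * (2 * B)) * Im z"
      proof -
        have "0 \<le> B" using order_trans[OF norm_ge_zero fxB(1)[of 0]] y by simp
        then show ?thesis using a by (intro mult_left_mono) auto
      qed
      finally have "norm (q (Im z)) \<le> Im z powr (2 * lam) * (2 * B * Im z) + norm (q a)"
        using norm_triangle_sub[of "q (Im z)" "q a"] by (simp add: algebra_simps)
      also have "norm (q a) \<le> Im z powr (2 * lam) * e"
      proof -
        have "norm (o' a) \<le> e" using d(2)[of a] a by (simp add: less_imp_le)
        moreover have "a powr (2 * lam) \<le> Im z powr (2 * lam)" using a \<open>lam \<ge> 0\<close> by (intro powr_mono2) auto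
        ultimately show ?thesis by (simp add: q_def mult_mono)
      qed
      finally have "Im z powr (2 * lam) * norm (o' (Im z)) \<le> Im z powr (2 * lam) * (2 * B * Im z + e)"
        by (simp add: q_def algebra_simps)
      then show ?thesis using y by simp
    qed
    then have "norm (o' (Im z)) \<le> 2 * B * Im z" by (rule field_le_epsilon)
    then show ?thesis by (simp add: o'_def \<zeta>y)
  qed
  consider "Im z > 0" | "Im z = 0" | "Im (cnj z) > 0" by fastforce
  then show ?thesis
  proof cases
    case 1
    then show ?thesis using main[OF z] by (simp add: B_def)
  next
    case 2
    then have "cnj z = z" by (simp add: complex_eq_iff)
    then show ?thesis using 2 by simp
  next
    case 3
    then show ?thesis using main[of "cnj z"] z by (simp add: B_def norm_minus_commute)
  qed
qed

text \<open>
  One moves from \<open>w\<close> horizontally and then vertically away from the axis. The hypothesis on the signs keeps the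
  interior of the vertical segment off the axis, where \<open>f\<^sub>y\<close> is known from the first-order equation.
\<close>
lemma dunkl_oscillation:
  assumes f: "dunkl_solution lam \<bbbD> f fx fy fxx fyy" and "lam \<ge> 0" "\<rho> > 0"
    and P: "{z. fold_dist z w \<le> 2 * \<rho>} \<subseteq> \<bbbD>"
    and M: "\<And>z. fold_dist z w \<le> 2 * \<rho> \<Longrightarrow> norm (f z) \<le> M"
    and "\<eta> \<le> \<rho> / 8" "\<bar>Re z - Re w\<bar> \<le> \<eta>" "\<bar>Im z - Im w\<bar> \<le> \<eta>" and sign: "0 \<le> Im w * (Im z - Im w)"
  shows "norm (f z - f w) \<le> (2 + 2 * lam) * (sqrt (8 * (148 + 16 * lam)) * M / \<rho>) * \<eta>"
proof -
  define B where "B = sqrt (8 * (148 + 16 * lam)) * M / \<rho>"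
  have pf: "partials \<bbbD> f fx fy fxx fyy" using f by (simp add: dunkl_solution_def)
  have near: "fold_dist v w \<le> \<rho> / 8" if "\<bar>Re v - Re w\<bar> \<le> \<eta>" "\<bar>Im v - Im w\<bar> \<le> \<eta>" for v
    using that \<open>\<eta> \<le> \<rho> / 8\<close> unfolding fold_dist_le_iff by linarith
  have inD: "v \<in> \<bbbD>" if "fold_dist v w \<le> \<rho> / 8" for v using that P \<open>\<rho> > 0\<close> by (auto simp: subset_iff)
  have contf: "continuous_on \<bbbD> f" using pf by (simp add: partials_def)
  have fxB: "norm (fx v) \<le> B" if "fold_dist v w \<le> \<rho> / 8" for v
    using dunkl_gradient_x[OF f \<open>lam \<ge> 0\<close> \<open>\<rho> > 0\<close> P M, of v] that \<open>\<rho> > 0\<close> by (auto simp: B_def)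
  have fyB: "norm (fy v) \<le> (1 + 2 * lam) * B" if "fold_dist v w \<le> \<rho> / 8" "Im v \<noteq> 0" for v
  proof -
    have "norm (f v - f (cnj v)) \<le> 2 * B * \<bar>Im v\<bar>"
      using dunkl_odd_part_bound[OF f \<open>lam \<ge> 0\<close> \<open>\<rho> > 0\<close> P M that(1)] by (simp add: B_def)
    then have d: "norm ((f v - f (cnj v)) / of_real (Im v)) \<le> 2 * B"
      using that(2) by (simp add: norm_divide divide_le_eq)
    have "fx v + \<i> * fy v = - (\<i> * of_real lam * ((f v - f (cnj v)) / of_real (Im v)))"
      using f inD[OF that(1)] that(2) unfolding dunkl_solution_def by simp
    then have "\<i> * fy v = - (\<i> * of_real lam * ((f v - f (cnj v)) / of_real (Im v))) - fx v"
      by (simp add: algebra_simps)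
    then have "norm (\<i> * fy v) \<le> norm (\<i> * of_real lam * ((f v - f (cnj v)) / of_real (Im v))) + norm (fx v)"
      using norm_triangle_ineq4[of "- (\<i> * of_real lam * ((f v - f (cnj v)) / of_real (Im v)))" "fx v"] by (simp only: norm_minus_cancel)
    also have "norm (\<i> * of_real lam * ((f v - f (cnj v)) / of_real (Im v))) = lam * norm ((f v - f (cnj v)) / of_real (Im v))"
      using \<open>lam \<ge> 0\<close> by (simp add: norm_mult norm_divide)
    also have "\<dots> \<le> lam * (2 * B)" using d \<open>lam \<ge> 0\<close> by (rule mult_left_mono)
    finally show ?thesis using fxB[OF that(1)] by (simp add: norm_mult algebra_simps)
  qed
  have B0: "B \<ge> 0" using fxB[of w] \<open>\<rho> > 0\<close> norm_ge_zero[of "fx w"] by (simp del: norm_ge_zero)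
  define T where "T = Re z - Re w"
  define u where "u = w + of_real T * 1"
  define V where "V = Im z - Im w"
  have zu: "z = u + of_real V * \<i>" by (simp add: u_def T_def V_def complex_eq_iff)
  have "norm (f (w + of_real T * 1) - f w) \<le> B * \<bar>T\<bar>"
  proof (rule has_partial_segment_bound)
    have n: "fold_dist (w + of_real t * 1) w \<le> \<rho> / 8" if "min 0 T \<le> t" "t \<le> max 0 T" for t
      using that assms(7,8) by (intro near) (auto simp: T_def min_def max_def split: if_splits)
    then show "continuous_on ((\<lambda>t. w + of_real t * 1) ` {min 0 T..max 0 T}) f"
      by (intro continuous_on_subset[OF contf]) (use inD in auto)
    show "has_partial 1 f (w + of_real t * 1) (fx (w + of_real t * 1)) \<and> norm (fx (w + of_real t * 1)) \<le> B"
      if "min 0 T < t" "t < max 0 T" for t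
      using n[of t] fxB inD pf that unfolding partials_def by auto
  qed
  moreover have "norm (f (u + of_real V * \<i>) - f u) \<le> (1 + 2 * lam) * B * \<bar>V\<bar>"
  proof (rule has_partial_segment_bound)
    have n: "fold_dist (u + of_real t * \<i>) w \<le> \<rho> / 8" if "min 0 V \<le> t" "t \<le> max 0 V" for t
      using that assms(7,8) by (intro near) (auto simp: T_def V_def u_def min_def max_def split: if_splits)
    then show "continuous_on ((\<lambda>t. u + of_real t * \<i>) ` {min 0 V..max 0 V}) f"
      by (intro continuous_on_subset[OF contf]) (use inD in auto)
    show "has_partial \<i> f (u + of_real t * \<i>) (fy (u + of_real t * \<i>)) \<and> norm (fy (u + of_real t * \<i>)) \<le> (1 + 2 * lam) * B"
      if t: "min 0 V < t" "t < max 0 V" for t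
    proof -
      have "Im (u + of_real t * \<i>) \<noteq> 0"
        using t sign by (auto simp: u_def V_def min_def max_def zero_le_mult_iff split: if_splits)
      then show ?thesis using n[of t] fyB inD pf t unfolding partials_def by auto
    qed
  qed
  ultimately have "norm (f z - f w) \<le> B * \<bar>T\<bar> + (1 + 2 * lam) * B * \<bar>V\<bar>"
    using norm_triangle_ineq[of "f z - f u" "f u - f w"] by (simp add: zu u_def)
  also have "\<dots> \<le> B * \<eta> + (1 + 2 * lam) * B * \<eta>"
    using assms(7,8) B0 \<open>lam \<ge> 0\<close> by (intro add_mono mult_left_mono) (auto simp: T_def V_def)
  finally have "norm (f z - f w) \<le> (2 + 2 * lam) * B * \<eta>" by (simp add: algebra_simps)
  then show ?thesis by (simp only: B_def)
qed

section \<open>The sub-mean-value inequality\<close>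

definition sigma_density :: "real \<Rightarrow> complex \<Rightarrow> real" where
  "sigma_density lam w = c_const lam * \<bar>Im w\<bar> powr (2 * lam)"

lemma c_const_pos: "lam \<ge> 0 \<Longrightarrow> c_const lam > 0"
  unfolding c_const_def by (intro divide_pos_pos mult_pos_pos Gamma_real_pos) auto

lemma sigma_density_nonneg: "lam \<ge> 0 \<Longrightarrow> 0 \<le> sigma_density lam w"
  using c_const_pos[of lam] by (simp add: sigma_density_def)

lemma borel_measurable_sigma_density [measurable]: "sigma_density lam \<in> borel_measurable borel"
  unfolding sigma_density_def[abs_def] by measurable

lemma powr_absorb_scale:
  fixes x y r s L :: real
  assumes "0 < r" "0 \<le> x" "0 \<le> y" "0 \<le> s" "L \<ge> 0" "s * x \<le> r * y"
  shows "s powr L * x powr L \<le> r powr L * y powr L"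
  using powr_mono2[of L "s * x" "r * y"] assms by (simp add: powr_mult)

text \<open>
  A box of size \<open>\<eta>\<close> next to \<open>w\<close> on the side facing away from the real axis. The weight is bounded below on it by
  a multiple of \<open>(\<bar>Im w\<bar> + \<eta>)\<^bsup>2\<lambda>\<^esup>\<close>, and \<open>dunkl_oscillation\<close> applies to its points.
\<close>
lemma away_box:
  fixes w :: complex
  assumes "\<eta> > 0"
  obtains Q where "Q \<in> sets lborel" "emeasure lborel Q = ennreal (\<eta>\<^sup>2 / 4)"
    "\<And>z. z \<in> Q \<Longrightarrow> \<bar>Re z - Re w\<bar> \<le> \<eta> \<and> \<bar>Im z - Im w\<bar> \<le> \<eta> \<and> 0 \<le> Im w * (Im z - Im w)
       \<and> (\<bar>Im w\<bar> + \<eta>) / 4 \<le> \<bar>Im z\<bar>"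
proof -
  define a where "a = (if Im w \<ge> 0 then Im w + \<eta> / 4 else Im w - \<eta> / 2)"
  have "emeasure lborel (cbox (Complex (Re w - \<eta> / 2) a) (Complex (Re w + \<eta> / 2) (a + \<eta> / 4)))
      = ennreal (\<Prod>b\<in>Basis. (Complex (Re w + \<eta> / 2) (a + \<eta> / 4) - Complex (Re w - \<eta> / 2) a) \<bullet> b)"
    by (rule emeasure_lborel_cbox) (use assms in \<open>auto simp: Basis_complex_def\<close>)
  also have "(\<Prod>b\<in>Basis. (Complex (Re w + \<eta> / 2) (a + \<eta> / 4) - Complex (Re w - \<eta> / 2) a) \<bullet> b) = \<eta>\<^sup>2 / 4"
    by (simp add: Basis_complex_def power2_eq_square complex_i_not_one[symmetric])
  finally have m: "emeasure lborel (cbox (Complex (Re w - \<eta> / 2) a) (Complex (Re w + \<eta> / 2) (a + \<eta> / 4))) = ennreal (\<eta>\<^sup>2 / 4)" .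
  show ?thesis
  proof (rule that[OF _ m])
    fix z assume "z \<in> cbox (Complex (Re w - \<eta> / 2) a) (Complex (Re w + \<eta> / 2) (a + \<eta> / 4))"
    then have z: "Re w - \<eta> / 2 \<le> Re z" "Re z \<le> Re w + \<eta> / 2" "a \<le> Im z" "Im z \<le> a + \<eta> / 4"
      by (auto simp: cbox_def Basis_complex_def inner_complex_def)
    show "\<bar>Re z - Re w\<bar> \<le> \<eta> \<and> \<bar>Im z - Im w\<bar> \<le> \<eta> \<and> 0 \<le> Im w * (Im z - Im w) \<and> (\<bar>Im w\<bar> + \<eta>) / 4 \<le> \<bar>Im z\<bar>"
    proof (cases "Im w \<ge> 0")
      case True
      then show ?thesis using z assms by (auto simp: a_def intro!: mult_nonneg_nonneg)
    next
      case False
      then show ?thesis using z assms by (auto simp: a_def intro!: mult_nonpos_nonpos)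
    qed
  qed simp
qed

text \<open>
  The argument of Hardy and Littlewood. Let \<open>z\<^sub>1\<close> maximise \<open>\<bar>f z\<bar> (R - fold_dist z z\<^sub>0)\<^sup>a\<close> with
  \<open>a = (2\<lambda> + 2) / p\<close>, and let \<open>r = R - fold_dist z\<^sub>1 z\<^sub>0\<close>. Within folded distance \<open>r / 2\<close> of \<open>z\<^sub>1\<close>, \<open>\<bar>f\<bar>\<close> is at most
  \<open>2\<^sup>a \<bar>f z\<^sub>1\<bar>\<close>, so by the oscillation bound it is at least \<open>\<bar>f z\<^sub>1\<bar> / 2\<close> on a box of size \<open>\<eta>\<close> comparable to \<open>r\<close>.
  The exponent \<open>a\<close> is chosen so that \<open>\<bar>f z\<^sub>0\<bar>\<^sup>p R\<^bsup>2\<lambda> + 2\<^esup> \<le> \<bar>f z\<^sub>1\<bar>\<^sup>p r\<^bsup>2\<lambda> + 2\<^esup>\<close>; comparing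
  \<open>r (\<bar>Im z\<^sub>0\<bar> + R)\<close> with \<open>R (\<bar>Im z\<^sub>1\<bar> + \<eta>)\<close> then replaces the power of \<open>R\<close> by the sharp weight.
\<close>
lemma sub_mean_value:
  assumes "lam \<ge> 0" "p > 0"
  obtains C where "C > 0"
    "\<And>f z0 R. lambda_analytic lam f \<Longrightarrow> R > 0 \<Longrightarrow> {z. fold_dist z z0 \<le> R} \<subseteq> \<bbbD> \<Longrightarrow>
       ennreal (norm (f z0) powr p * (R\<^sup>2 * (\<bar>Im z0\<bar> + R) powr (2 * lam)))
       \<le> ennreal C * (\<integral>\<^sup>+w. indicator {w. fold_dist w z0 \<le> R} w * ennreal (norm (f w) powr p * sigma_density lam w) \<partial>lborel)"
proof -
  define L where "L = 2 * lam"
  have L: "L \<ge> 0" using assms by (simp add: L_def)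
  define a where "a = (L + 2) / p"
  have a: "a > 0" "a * p = L + 2" using assms L by (auto simp: a_def)
  define B where "B = (2 + 2 * lam) * (sqrt (8 * (148 + 16 * lam)) * 2 powr a)"
  have B: "B > 0" using assms by (simp add: B_def)
  \<comment> \<open>Over a box of size \<open>\<epsilon>\<close> times \<open>r / 4\<close> the oscillation is at most \<open>B \<epsilon>\<close> times the modulus of \<open>f\<close> at the centre.\<close>
  define \<epsilon> where "\<epsilon> = min (1/8) (1 / (2 * B))"
  have \<epsilon>: "0 < \<epsilon>" "\<epsilon> \<le> 1/8" "B * \<epsilon> \<le> 1/2"
  proof -
    show "0 < \<epsilon>" "\<epsilon> \<le> 1/8" using B by (auto simp: \<epsilon>_def)
    have "B * \<epsilon> \<le> B * (1 / (2 * B))" using B by (intro mult_left_mono) (auto simp: \<epsilon>_def)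
    then show "B * \<epsilon> \<le> 1/2" using B by simp
  qed
  define c where "c = c_const lam"
  have c: "c > 0" using c_const_pos[OF assms(1)] by (simp add: c_def)
  \<comment> \<open>The factors are the losses from halving \<open>f\<close>, from the weight on the box, from the area \<open>\<eta>\<^sup>2 / 4\<close> of the
    box, from \<open>r = 4 \<eta> / \<epsilon>\<close>, and from comparing \<open>r (\<bar>Im z\<^sub>0\<bar> + R)\<close> with \<open>R (\<bar>Im z\<^sub>1\<bar> + \<eta>)\<close>.\<close>
  define C where "C = (2 powr p * 4 powr L * 4 * (4 / \<epsilon>)\<^sup>2 * (8 / \<epsilon>) powr L) / c"
  have C: "C > 0" using c \<epsilon> by (simp add: C_def)
  show ?thesis
  proof (rule that[OF C])
    fix f z0 and R :: real
    assume f: "lambda_analytic lam f" and R: "R > 0" and S: "{z. fold_dist z z0 \<le> R} \<subseteq> \<bbbD>"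
    let ?S = "{z. fold_dist z z0 \<le> R}"
    show "ennreal (norm (f z0) powr p * (R\<^sup>2 * (\<bar>Im z0\<bar> + R) powr (2 * lam)))
       \<le> ennreal C * (\<integral>\<^sup>+w. indicator ?S w * ennreal (norm (f w) powr p * sigma_density lam w) \<partial>lborel)"
    proof (cases "f z0 = 0")
      case True
      then show ?thesis by simp
    next
      case False
      obtain fx fy fxx fyy where sol: "dunkl_solution lam \<bbbD> f fx fy fxx fyy"
        using lambda_analytic_solution[OF f] .
      have contf: "continuous_on \<bbbD> f" using sol by (simp add: dunkl_solution_def partials_def)
      define H where "H z = norm (f z) * (R - fold_dist z z0) powr a" for z
      have "continuous_on ?S H"
        unfolding H_def
        by (intro continuous_intros continuous_on_powr' continuous_on_subset[OF contf] S) (use a in auto)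
      moreover have "z0 \<in> ?S" using R by simp
      ultimately obtain z1 where z1: "z1 \<in> ?S" "\<And>z. z \<in> ?S \<Longrightarrow> H z \<le> H z1"
        using continuous_attains_sup[OF compact_fold_ball] by blast
      have H01: "H z0 \<le> H z1" using z1(2)[of z0] R by simp
      have H0: "H z0 > 0" using False R by (simp add: H_def)
      define r where "r = R - fold_dist z1 z0"
      have "r \<ge> 0" using z1 by (simp add: r_def)
      moreover have "r \<noteq> 0" using H01 H0 by (auto simp: H_def r_def)
      ultimately have r: "r > 0" by simp
      have rR: "r \<le> R" by (simp add: r_def)
      have f1: "norm (f z1) > 0" using H01 H0 by (auto simp: H_def)
      define X0 where "X0 = norm (f z0)"
      define X1 where "X1 = norm (f z1)"
      have X: "X0 > 0" "X1 > 0" using False f1 by (auto simp: X0_def X1_def)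
      have XR: "X0 * R powr a \<le> X1 * r powr a"
        using H01 by (simp add: H_def X0_def X1_def r_def)
      define \<rho> where "\<rho> = r / 4"
      have \<rho>: "\<rho> > 0" using r by (simp add: \<rho>_def)
      have sub: "fold_dist z z0 \<le> R - r / 2" if "fold_dist z z1 \<le> 2 * \<rho>" for z
      proof -
        have "2 * \<rho> = r / 2" "fold_dist z1 z0 = R - r" by (simp_all add: \<rho>_def r_def)
        then show ?thesis using fold_dist_triangle[of z z0 z1] that by simp
      qed
      have P: "{z. fold_dist z z1 \<le> 2 * \<rho>} \<subseteq> \<bbbD>"
        using sub S r by (smt (verit) mem_Collect_eq subset_iff half_gt_zero)
      have M: "norm (f z) \<le> 2 powr a * X1" if "fold_dist z z1 \<le> 2 * \<rho>" for z
      proof -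
        have "norm (f z) * (r / 2) powr a \<le> H z"
          unfolding H_def using sub[OF that] r a by (intro mult_left_mono powr_mono2) auto
        also have "\<dots> \<le> X1 * r powr a"
          using z1(2)[of z] sub[OF that] r by (simp add: H_def X1_def r_def)
        also have "\<dots> = (2 powr a * X1) * (r / 2) powr a" using r by (simp add: powr_divide)
        finally show ?thesis using r by simp
      qed
      define \<eta> where "\<eta> = \<epsilon> * \<rho>"
      have \<eta>: "\<eta> > 0" "\<eta> \<le> \<rho> / 8"
        using \<epsilon> \<rho> mult_right_mono[of \<epsilon> "1/8" \<rho>] by (auto simp: \<eta>_def)
      obtain Q where Q: "Q \<in> sets lborel" "emeasure lborel Q = ennreal (\<eta>\<^sup>2 / 4)"
        and Qz: "\<And>z. z \<in> Q \<Longrightarrow> \<bar>Re z - Re z1\<bar> \<le> \<eta> \<and> \<bar>Im z - Im z1\<bar> \<le> \<eta> \<and> 0 \<le> Im z1 * (Im z - Im z1)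
           \<and> (\<bar>Im z1\<bar> + \<eta>) / 4 \<le> \<bar>Im z\<bar>"
        using away_box[OF \<eta>(1), of z1] by blast
      define y1 where "y1 = \<bar>Im z1\<bar>"
      define k where "k = (X1 / 2) powr p * (c * ((y1 + \<eta>) / 4) powr L)"
      have QS: "z \<in> ?S" and low: "k \<le> norm (f z) powr p * sigma_density lam z" if "z \<in> Q" for z
      proof -
        note q = Qz[OF that]
        have "fold_dist z z1 \<le> \<eta>" using q unfolding fold_dist_le_iff by linarith
        then have near: "fold_dist z z1 \<le> 2 * \<rho>" using \<eta> \<rho> by linarith
        show "z \<in> ?S" using sub[OF near] r by simp
        have "norm (f z - f z1) \<le> (2 + 2 * lam) * (sqrt (8 * (148 + 16 * lam)) * (2 powr a * X1) / \<rho>) * \<eta>"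
          by (rule dunkl_oscillation[OF sol assms(1) \<rho> P M \<eta>(2)]) (use q in auto)
        also have "\<dots> = B * \<epsilon> * X1" using \<rho> by (simp add: B_def \<eta>_def)
        also have "\<dots> \<le> 1/2 * X1" using \<epsilon>(3) X by (intro mult_right_mono) auto
        finally have "norm (f z) \<ge> X1 / 2"
          using norm_triangle_ineq2[of "f z1" "f z"] by (simp add: X1_def norm_minus_commute)
        then have "(X1 / 2) powr p \<le> norm (f z) powr p" using X assms by (intro powr_mono2) auto
        moreover have "((y1 + \<eta>) / 4) powr L \<le> \<bar>Im z\<bar> powr L"
          using q L \<eta> by (intro powr_mono2) (auto simp: y1_def)
        ultimately show "k \<le> norm (f z) powr p * sigma_density lam z"
          unfolding k_def sigma_density_def c_def[symmetric] L_def[symmetric]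
          using c by (intro mult_mono) auto
      qed
      have k0: "k \<ge> 0" using c by (simp add: k_def)
      have "ennreal (k * (\<eta>\<^sup>2 / 4)) = ennreal k * emeasure lborel Q"
        unfolding Q(2) using k0 by (rule ennreal_mult) simp
      also have "\<dots> = (\<integral>\<^sup>+w. ennreal k * indicator Q w \<partial>lborel)"
        by (rule nn_integral_cmult_indicator[symmetric, OF Q(1)])
      also have "\<dots> \<le> (\<integral>\<^sup>+w. indicator ?S w * ennreal (norm (f w) powr p * sigma_density lam w) \<partial>lborel)"
        by (intro nn_integral_mono) (use QS low in \<open>auto simp: indicator_def intro!: ennreal_leI\<close>)
      finally have int: "ennreal (k * (\<eta>\<^sup>2 / 4))
        \<le> (\<integral>\<^sup>+w. indicator ?S w * ennreal (norm (f w) powr p * sigma_density lam w) \<partial>lborel)" .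
      define y0 where "y0 = \<bar>Im z0\<bar>"
      have y01: "y0 \<le> y1 + (R - r)"
        using fold_dist_ge(2)[of z1 z0] abs_le_D2[of "\<bar>Im z1\<bar> - \<bar>Im z0\<bar>"] by (auto simp: y0_def y1_def r_def)
      have ratio: "r * (y0 + R) \<le> R * (8 / \<epsilon> * (y1 + \<eta>))"
      proof -
        have y1: "y1 \<ge> 0" by (simp add: y1_def)
        have "r * (y0 + R) \<le> r * (y1 + 2 * R)" using y01 r by (intro mult_left_mono) auto
        also have "\<dots> = r * y1 + 2 * R * r" by (simp add: algebra_simps)
        also have "\<dots> \<le> R * y1 + 2 * R * r" using rR y1 by (intro add_right_mono mult_right_mono) auto
        also have "\<dots> = R * (y1 + 2 * r)" by (simp add: algebra_simps)
        also have "\<dots> \<le> R * (8 / \<epsilon> * (y1 + \<eta>))"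
        proof (rule mult_left_mono)
          have "8 / \<epsilon> * \<eta> = 2 * r" using \<epsilon> by (simp add: \<eta>_def \<rho>_def)
          moreover have "1 * y1 \<le> 8 / \<epsilon> * y1" using \<epsilon> y1 by (intro mult_right_mono) (auto simp: field_simps)
          ultimately show "y1 + 2 * r \<le> 8 / \<epsilon> * (y1 + \<eta>)" by (simp add: distrib_left)
        qed (use R in simp)
        finally show ?thesis .
      qed
      have "X0 powr p * (R powr L * R\<^sup>2) = (X0 * R powr a) powr p"
        using X R a by (simp add: powr_mult powr_powr powr_add)
      also have "\<dots> \<le> (X1 * r powr a) powr p" using XR X assms by (intro powr_mono2) auto
      also have "\<dots> = X1 powr p * (r powr L * r\<^sup>2)"
        using X r a by (simp add: powr_mult powr_powr powr_add)
      finally have e1: "X0 powr p * (R powr L * R\<^sup>2) \<le> X1 powr p * (r powr L * r\<^sup>2)" .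
      have e2: "r powr L * (y0 + R) powr L \<le> R powr L * (8 / \<epsilon> * (y1 + \<eta>)) powr L"
        by (rule powr_absorb_scale[OF R _ _ _ L ratio]) (use R r \<epsilon> \<eta> in \<open>auto simp: y0_def y1_def\<close>)
      have "R powr L * (X0 powr p * (R\<^sup>2 * (y0 + R) powr L)) = X0 powr p * (R powr L * R\<^sup>2) * (y0 + R) powr L"
        by simp
      also have "\<dots> \<le> X1 powr p * (r powr L * r\<^sup>2) * (y0 + R) powr L"
        using e1 by (intro mult_right_mono) auto
      also have "\<dots> = X1 powr p * r\<^sup>2 * (r powr L * (y0 + R) powr L)" by simp
      also have "\<dots> \<le> X1 powr p * r\<^sup>2 * (R powr L * (8 / \<epsilon> * (y1 + \<eta>)) powr L)"
        using e2 by (intro mult_left_mono) auto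
      also have "\<dots> = R powr L * (X1 powr p * r\<^sup>2 * (8 / \<epsilon> * (y1 + \<eta>)) powr L)" by simp
      finally have "X0 powr p * (R\<^sup>2 * (y0 + R) powr L) \<le> X1 powr p * r\<^sup>2 * (8 / \<epsilon> * (y1 + \<eta>)) powr L"
        using R by simp
      also have "\<dots> = C * (k * (\<eta>\<^sup>2 / 4))"
      proof -
        have "(8 / \<epsilon> * (y1 + \<eta>)) powr L = (8 / \<epsilon>) powr L * (y1 + \<eta>) powr L"
          by (rule powr_mult)
        moreover have "((y1 + \<eta>) / 4) powr L = (y1 + \<eta>) powr L / 4 powr L"
          using \<eta> by (simp add: powr_divide y1_def)
        moreover have "(X1 / 2) powr p = X1 powr p / 2 powr p" using X by (simp add: powr_divide)
        moreover have "r\<^sup>2 = (4 / \<epsilon>)\<^sup>2 * \<eta>\<^sup>2" using \<epsilon> by (simp add: \<eta>_def \<rho>_def power2_eq_square)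
        ultimately show ?thesis using c by (simp add: C_def k_def)
      qed
      finally have "ennreal (X0 powr p * (R\<^sup>2 * (y0 + R) powr L)) \<le> ennreal (C * (k * (\<eta>\<^sup>2 / 4)))"
        by (rule ennreal_leI)
      also have "\<dots> = ennreal C * ennreal (k * (\<eta>\<^sup>2 / 4))" using C k0 by (intro ennreal_mult) auto
      also have "\<dots> \<le> ennreal C * (\<integral>\<^sup>+w. indicator ?S w * ennreal (norm (f w) powr p * sigma_density lam w) \<partial>lborel)"
        using int by (rule mult_left_mono) simp
      finally show ?thesis by (simp add: X0_def y0_def L_def)
    qed
  qed
qed

section \<open>Integration over circles\<close>

lemma sin_ge_half:
  assumes "0 \<le> x" "x \<le> pi / 2"
  shows "x / 2 \<le> sin x"
proof -
  have "\<bar>sin x - (\<Sum>m<3. sin_coeff m * x ^ m)\<bar> \<le> inverse (fact 3) * \<bar>x\<bar> ^ 3"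
    by (rule Maclaurin_sin_bound)
  moreover have "(\<Sum>m<3. sin_coeff m * x ^ m) = x"
    by (simp add: sin_coeff_def numeral_eq_Suc)
  moreover have "inverse (fact 3) * \<bar>x\<bar> ^ 3 = x ^ 3 / 6"
    using assms by (simp add: fact_numeral)
  ultimately have "\<bar>sin x - x\<bar> \<le> x ^ 3 / 6" by simp
  from abs_le_D2[OF this] have "sin x \<ge> x - x ^ 3 / 6" by simp
  moreover have "x ^ 3 / 6 \<le> x / 2"
  proof -
    have "x \<le> 1.6" using assms pi_less_4 pi_approx by simp
    then have "x * x \<le> 1.6 * 1.6" using assms by (intro mult_mono) auto
    then have "x * (x * x) \<le> x * 3" using assms by (intro mult_left_mono) auto
    then show ?thesis by (simp add: power3_eq_cube algebra_simps)
  qed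
  ultimately show ?thesis by simp
qed

lemma angle_le_chord:
  assumes "a \<in> {0..pi}" "b \<in> {0..pi}" "\<bar>cos a - cos b\<bar> \<le> d" "\<bar>sin a - sin b\<bar> \<le> d"
  shows "\<bar>a - b\<bar> \<le> 4 * d"
proof -
  have le: "\<bar>\<bar>a - b\<bar> / 2\<bar> \<le> pi / 2" using assms by (auto simp: abs_le_iff)
  have d: "d \<ge> 0" using assms by linarith
  have "(cos a - cos b)\<^sup>2 + (sin a - sin b)\<^sup>2 = 2 - 2 * cos (a - b)"
  proof -
    have "(cos a - cos b)\<^sup>2 + (sin a - sin b)\<^sup>2
      = ((sin a)\<^sup>2 + (cos a)\<^sup>2) + ((sin b)\<^sup>2 + (cos b)\<^sup>2) - 2 * (cos a * cos b + sin a * sin b)"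
      by algebra
    then show ?thesis by (simp add: cos_diff)
  qed
  also have "\<dots> = 4 * (sin (\<bar>a - b\<bar> / 2))\<^sup>2"
  proof -
    have "cos (a - b) = cos (2 * (\<bar>a - b\<bar> / 2))" by (simp add: cos_abs_real)
    also have "\<dots> = 1 - 2 * (sin (\<bar>a - b\<bar> / 2))\<^sup>2" by (rule cos_double_sin)
    finally show ?thesis by simp
  qed
  finally have eq: "(cos a - cos b)\<^sup>2 + (sin a - sin b)\<^sup>2 = 4 * (sin (\<bar>a - b\<bar> / 2))\<^sup>2" .
  have "(cos a - cos b)\<^sup>2 \<le> d\<^sup>2" "(sin a - sin b)\<^sup>2 \<le> d\<^sup>2"
    using assms(3,4) d by (simp_all add: abs_le_square_iff[symmetric])
  moreover have "(\<bar>a - b\<bar> / 2 / 2)\<^sup>2 \<le> (sin (\<bar>a - b\<bar> / 2))\<^sup>2"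
    using sin_ge_half[of "\<bar>a - b\<bar> / 2"] le by (intro power_mono) auto
  then have "(a - b)\<^sup>2 \<le> 16 * (sin (\<bar>a - b\<bar> / 2))\<^sup>2" by (simp add: power_divide)
  ultimately have "(a - b)\<^sup>2 \<le> 16 * d\<^sup>2" using eq zero_le_power2[of d] by linarith
  then have "\<bar>a - b\<bar>\<^sup>2 \<le> (4 * d)\<^sup>2" by (simp add: power_mult_distrib)
  then show ?thesis using d by (intro power2_le_imp_le[of "\<bar>a - b\<bar>"]) auto
qed

definition fold_arc :: "real \<Rightarrow> real \<Rightarrow> complex \<Rightarrow> real set" where
  "fold_arc r R w = {\<theta> \<in> {-pi..pi}. fold_dist w (of_real r * cis \<theta>) \<le> R}"

text \<open>
  For radii at least \<open>1 / 2\<close>, two angles of \<open>[0, \<pi>]\<close> in this set have chords of length \<open>O(R)\<close>, so this half of the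
  set lies in an interval of length \<open>32 R\<close>; the other half is handled by reflection. For small radii \<open>R\<close> is
  bounded below and the trivial bound \<open>2 \<pi>\<close> is enough.
\<close>
lemma fold_arc_measure:
  assumes "0 \<le> r" "r < 1" and R: "R = (1 - r) / 4"
  shows "emeasure lborel (fold_arc r R w) \<le> ennreal (64 * R)"
proof (cases "r < 1 / 2")
  case True
  have "emeasure lborel (fold_arc r R w) \<le> emeasure lborel {-pi..pi}"
    by (intro emeasure_mono) (auto simp: fold_arc_def)
  also have "\<dots> = ennreal (2 * pi)" by simp
  also have "\<dots> \<le> ennreal (64 * R)" using True pi_less_4 by (intro ennreal_leI) (simp add: R)
  finally show ?thesis .
next
  case False
  have R0: "R > 0" using assms by simp
  have close: "\<bar>a - b\<bar> \<le> 16 * R"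
    if "a \<in> {0..pi}" "b \<in> {0..pi}" "fold_dist w (of_real r * cis a) \<le> R" "fold_dist w (of_real r * cis b) \<le> R" for a b
  proof -
    have "fold_dist (of_real r * cis a) (of_real r * cis b) \<le> 2 * R"
      using fold_dist_triangle[of "of_real r * cis a" "of_real r * cis b" w] that(3,4) by (simp add: fold_dist_commute)
    then have c: "\<bar>r * cos a - r * cos b\<bar> \<le> 2 * R" and s: "\<bar>\<bar>r * sin a\<bar> - \<bar>r * sin b\<bar>\<bar> \<le> 2 * R"
      unfolding fold_dist_le_iff by simp_all
    have "\<bar>r * sin a\<bar> = r * sin a" "\<bar>r * sin b\<bar> = r * sin b"
      using that(1,2) assms(1) by (simp_all add: sin_ge_zero)
    note s = s[unfolded this]
    have "r * \<bar>u - v\<bar> = \<bar>r * u - r * v\<bar>" for u v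
      using assms(1) by (simp add: right_diff_distrib[symmetric] abs_mult)
    then have "r * \<bar>cos a - cos b\<bar> \<le> 2 * R" "r * \<bar>sin a - sin b\<bar> \<le> 2 * R"
      using c s by simp_all
    moreover have "1 / 2 * \<bar>cos a - cos b\<bar> \<le> r * \<bar>cos a - cos b\<bar>" "1 / 2 * \<bar>sin a - sin b\<bar> \<le> r * \<bar>sin a - sin b\<bar>"
      using False by (intro mult_right_mono; simp)+
    ultimately have "1 / 2 * \<bar>cos a - cos b\<bar> \<le> 2 * R" "1 / 2 * \<bar>sin a - sin b\<bar> \<le> 2 * R"
      using order_trans by blast+
    then have "\<bar>cos a - cos b\<bar> \<le> 4 * R" "\<bar>sin a - sin b\<bar> \<le> 4 * R" by simp_all
    then show ?thesis using angle_le_chord[OF that(1,2)] by fastforce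
  qed
  have fc: "fold_dist w (of_real r * cis (- t)) = fold_dist w (of_real r * cis t)" for t
    by (simp add: fold_dist_def)
  have half: "\<exists>I. I \<in> sets lborel \<and> emeasure lborel I \<le> ennreal (32 * R) \<and> {\<theta> \<in> {0..pi}. fold_dist w (of_real r * cis \<theta>) \<le> R} \<subseteq> I
     \<and> {\<theta> \<in> {-pi..0}. fold_dist w (of_real r * cis \<theta>) \<le> R} \<subseteq> uminus ` I \<and> uminus ` I \<in> sets lborel
     \<and> emeasure lborel (uminus ` I) \<le> ennreal (32 * R)"
  proof (cases "\<exists>b. b \<in> {0..pi} \<and> fold_dist w (of_real r * cis b) \<le> R")
    case True
    then obtain b where b: "b \<in> {0..pi}" "fold_dist w (of_real r * cis b) \<le> R" by blast
    have neg: "uminus ` {b - 16 * R..b + 16 * R} = {- (b + 16 * R)..- (b - 16 * R)}" by simp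
    show ?thesis
    proof (intro exI[of _ "{b - 16 * R..b + 16 * R}"] conjI)
      show "{\<theta> \<in> {0..pi}. fold_dist w (of_real r * cis \<theta>) \<le> R} \<subseteq> {b - 16 * R..b + 16 * R}"
        using close[OF _ b(1) _ b(2)] by (fastforce simp: abs_le_iff)
      show "{\<theta> \<in> {-pi..0}. fold_dist w (of_real r * cis \<theta>) \<le> R} \<subseteq> uminus ` {b - 16 * R..b + 16 * R}"
      proof
        fix t assume "t \<in> {\<theta> \<in> {-pi..0}. fold_dist w (of_real r * cis \<theta>) \<le> R}"
        then have "\<bar>(- t) - b\<bar> \<le> 16 * R" using close[of "- t" b] b fc by auto
        then show "t \<in> uminus ` {b - 16 * R..b + 16 * R}" unfolding neg by (auto simp: abs_le_iff)
      qed
    qed (use R0 in \<open>simp_all only: neg\<close>, simp_all)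
  next
    case no: False
    have "{\<theta> \<in> {-pi..0}. fold_dist w (of_real r * cis \<theta>) \<le> R} = {}"
    proof (rule ccontr)
      assume "\<not> ?thesis"
      then obtain t where "t \<in> {-pi..0}" "fold_dist w (of_real r * cis t) \<le> R" by blast
      then have "- t \<in> {0..pi} \<and> fold_dist w (of_real r * cis (- t)) \<le> R" using fc by simp
      then show False using no by blast
    qed
    then show ?thesis using no by (intro exI[of _ "{}"]) auto
  qed
  then obtain I where I: "I \<in> sets lborel" "emeasure lborel I \<le> ennreal (32 * R)" "{\<theta> \<in> {0..pi}. fold_dist w (of_real r * cis \<theta>) \<le> R} \<subseteq> I"
     "{\<theta> \<in> {-pi..0}. fold_dist w (of_real r * cis \<theta>) \<le> R} \<subseteq> uminus ` I" "uminus ` I \<in> sets lborel"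
     "emeasure lborel (uminus ` I) \<le> ennreal (32 * R)" by blast
  have "fold_arc r R w \<subseteq> {\<theta> \<in> {0..pi}. fold_dist w (of_real r * cis \<theta>) \<le> R} \<union> {\<theta> \<in> {-pi..0}. fold_dist w (of_real r * cis \<theta>) \<le> R}"
    by (auto simp: fold_arc_def)
  also have "\<dots> \<subseteq> I \<union> uminus ` I" using I(3,4) by blast
  finally have "emeasure lborel (fold_arc r R w) \<le> emeasure lborel (I \<union> uminus ` I)"
    using I by (intro emeasure_mono) auto
  also have "\<dots> \<le> emeasure lborel I + emeasure lborel (uminus ` I)" by (rule emeasure_subadditive[OF I(1,5)])
  also have "\<dots> \<le> ennreal (32 * R) + ennreal (32 * R)" by (rule add_mono[OF I(2,6)])
  also have "\<dots> = ennreal (64 * R)" using R0 by (simp add: ennreal_plus[symmetric] del: ennreal_plus)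
  finally show ?thesis .
qed

text \<open>
  The number \<open>(3 r - 1) / 2 = r - 2 R\<close>, where \<open>R = (1 - r) / 4\<close>, is the inner radius of an annulus that contains
  all folded balls of radius \<open>R\<close> with centre on the circle of radius \<open>r\<close>.
\<close>
definition tail_energy :: "real \<Rightarrow> real \<Rightarrow> (complex \<Rightarrow> complex) \<Rightarrow> real \<Rightarrow> ennreal" where
  "tail_energy lam p f r =
     (\<integral>\<^sup>+w. indicator {w \<in> \<bbbD>. (3 * r - 1) / 2 \<le> norm w} w * ennreal (norm (f w) powr p * sigma_density lam w) \<partial>lborel)"

lemma annulus_borel [measurable]: "{w \<in> \<bbbD>. c \<le> norm w} \<in> sets borel"
proof -
  have "{w \<in> \<bbbD>. c \<le> norm w} = \<bbbD> \<inter> {w. c \<le> norm w}" by auto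
  moreover have "closed {w :: complex. c \<le> norm w}" by (intro closed_Collect_le continuous_intros)
  ultimately show ?thesis by (simp add: borel_closed)
qed

lemma fold_ball_in_annulus:
  assumes "0 \<le> r" "r < 1" "fold_dist w (of_real r * cis \<theta>) \<le> (1 - r) / 4"
  shows "w \<in> \<bbbD>" "(3 * r - 1) / 2 \<le> norm w"
proof -
  have n: "norm (of_real r * cis \<theta>) = r" using assms(1) by (simp add: norm_mult)
  have "norm w \<le> r + 2 * fold_dist w (of_real r * cis \<theta>)" using norm_le_fold_dist[of w "of_real r * cis \<theta>"] n by simp
  moreover have "r \<le> norm w + 2 * fold_dist w (of_real r * cis \<theta>)"
    using norm_le_fold_dist[of "of_real r * cis \<theta>" w] n by (simp add: fold_dist_commute)
  ultimately show "w \<in> \<bbbD>" "(3 * r - 1) / 2 \<le> norm w" using assms by auto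
qed

text \<open>
  The second bound comes from integrating the sub-mean-value inequality over the circle of radius \<open>r\<close> and exchanging
  the integrals. The weight drops out since \<open>\<bar>sin \<theta>\<bar> \<le> 4 (r \<bar>sin \<theta>\<bar> + R)\<close>, both sides being affine in
  \<open>\<bar>sin \<theta>\<bar>\<close>.
\<close>
lemma circle_bounds:
  assumes "lam \<ge> 0" "p > 0"
  obtains C where "C > 0"
    "\<And>f r \<theta>. lambda_analytic lam f \<Longrightarrow> 0 \<le> r \<Longrightarrow> r < 1 \<Longrightarrow>
       ennreal (norm (f (of_real r * cis \<theta>)) powr p * (1 - r) powr (2 * lam + 2)) \<le> ennreal C * tail_energy lam p f r"
    "\<And>f r. lambda_analytic lam f \<Longrightarrow> 0 \<le> r \<Longrightarrow> r < 1 \<Longrightarrow>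
       ennreal (1 - r) * (\<integral>\<^sup>+\<theta>. indicator {-pi..pi} \<theta> * ennreal (norm (f (of_real r * cis \<theta>)) powr p * \<bar>sin \<theta>\<bar> powr (2 * lam)) \<partial>lborel)
       \<le> ennreal C * tail_energy lam p f r"
proof -
  define L where "L = 2 * lam"
  have L: "L \<ge> 0" using assms by (simp add: L_def)
  obtain K where K: "K > 0" and smv: "\<And>f z0 R. lambda_analytic lam f \<Longrightarrow> R > 0 \<Longrightarrow> {z. fold_dist z z0 \<le> R} \<subseteq> \<bbbD> \<Longrightarrow>
       ennreal (norm (f z0) powr p * (R\<^sup>2 * (\<bar>Im z0\<bar> + R) powr L))
       \<le> ennreal K * (\<integral>\<^sup>+w. indicator {w. fold_dist w z0 \<le> R} w * ennreal (norm (f w) powr p * sigma_density lam w) \<partial>lborel)"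
    using sub_mean_value[OF assms] unfolding L_def by blast
  define C where "C = max (4 powr (L + 2) * K) (4 * 64 * 4 powr L * K)"
  have C: "C > 0" "4 powr (L + 2) * K \<le> C" "4 * 64 * 4 powr L * K \<le> C"
    using K by (auto simp: C_def less_max_iff_disj)
  show ?thesis
  proof (rule that[OF C(1)])
    fix f and r :: real assume f: "lambda_analytic lam f" and r: "0 \<le> r" "r < 1"
    define R where "R = (1 - r) / 4"
    have R: "R > 0" "1 - r = 4 * R" using r by (auto simp: R_def)
    define z where "z \<theta> = of_real r * cis \<theta>" for \<theta>
    have sub: "{w. fold_dist w (z \<theta>) \<le> R} \<subseteq> {w \<in> \<bbbD>. (3 * r - 1) / 2 \<le> norm w}" for \<theta>
      using fold_ball_in_annulus[OF r] by (auto simp: z_def R_def)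
    have subD: "{w. fold_dist w (z \<theta>) \<le> R} \<subseteq> \<bbbD>" for \<theta> using sub[of \<theta>] by blast
    define G where "G w = ennreal (norm (f w) powr p * sigma_density lam w)" for w
    have local: "ennreal (norm (f (z \<theta>)) powr p * (R\<^sup>2 * (\<bar>Im (z \<theta>)\<bar> + R) powr L))
        \<le> ennreal K * (\<integral>\<^sup>+w. indicator {w. fold_dist w (z \<theta>) \<le> R} w * G w \<partial>lborel)" for \<theta>
      unfolding G_def by (rule smv[OF f R(1) subD])
    show "ennreal (norm (f (of_real r * cis \<theta>)) powr p * (1 - r) powr (2 * lam + 2)) \<le> ennreal C * tail_energy lam p f r" for \<theta>
    proof -
      have "(1 - r) powr (2 * lam + 2) = 4 powr (L + 2) * (R powr 2 * R powr L)"
        unfolding R(2) L_def[symmetric] using R(1) by (simp add: powr_mult powr_add)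
      also have "\<dots> \<le> 4 powr (L + 2) * (R\<^sup>2 * (\<bar>Im (z \<theta>)\<bar> + R) powr L)"
        using R(1) L by (intro mult_left_mono mult_mono powr_mono2) auto
      finally have "ennreal (norm (f (z \<theta>)) powr p * (1 - r) powr (2 * lam + 2))
         \<le> ennreal (4 powr (L + 2) * (norm (f (z \<theta>)) powr p * (R\<^sup>2 * (\<bar>Im (z \<theta>)\<bar> + R) powr L)))"
        by (intro ennreal_leI) (metis mult.left_commute mult_left_mono powr_ge_zero)
      also have "\<dots> = ennreal (4 powr (L + 2)) * ennreal (norm (f (z \<theta>)) powr p * (R\<^sup>2 * (\<bar>Im (z \<theta>)\<bar> + R) powr L))"
        by (rule ennreal_mult) auto
      also have "\<dots> \<le> ennreal (4 powr (L + 2)) * (ennreal K * (\<integral>\<^sup>+w. indicator {w. fold_dist w (z \<theta>) \<le> R} w * G w \<partial>lborel))"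
        using local by (rule mult_left_mono) simp
      also have "\<dots> \<le> ennreal (4 powr (L + 2)) * (ennreal K * tail_energy lam p f r)"
        unfolding tail_energy_def G_def using sub
        by (intro mult_left_mono nn_integral_mono mult_right_mono) (auto simp: indicator_def subset_iff)
      also have "\<dots> = ennreal (4 powr (L + 2) * K) * tail_energy lam p f r"
        using K by (simp add: ennreal_mult mult.assoc)
      also have "\<dots> \<le> ennreal C * tail_energy lam p f r"
        using C by (intro mult_right_mono ennreal_leI) auto
      finally show ?thesis by (simp add: z_def)
    qed
    \<comment> \<open>\<open>f\<close> is arbitrary outside the disk, so measurability requires cutting it off there.\<close>
    define H where "H w = ennreal ((indicator \<bbbD> w *\<^sub>R norm (f w)) powr p * sigma_density lam w)" for w
    have "continuous_on \<bbbD> f"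
      using lambda_analytic_solution[OF f] unfolding dunkl_solution_def partials_def by blast
    then have "(\<lambda>w. indicator \<bbbD> w *\<^sub>R norm (f w)) \<in> borel_measurable borel"
      by (intro borel_measurable_continuous_on_indicator continuous_intros) auto
    then have Hm [measurable]: "H \<in> borel_measurable borel" unfolding H_def by measurable
    have GH: "indicator {w. fold_dist w (z \<theta>) \<le> R} w * G w = indicator {w. fold_dist w (z \<theta>) \<le> R} w * H w" for \<theta> w
      using subD[of \<theta>] by (auto simp: indicator_def G_def H_def subset_iff)
    define J where "J \<theta> w = (if \<theta> \<in> {-pi..pi} \<and> max \<bar>Re w - r * cos \<theta>\<bar> \<bar>\<bar>Im w\<bar> - \<bar>r * sin \<theta>\<bar>\<bar> \<le> R then H w else 0)" for \<theta> w
    have J1: "J \<theta> w = indicator {-pi..pi} \<theta> * (indicator {w. fold_dist w (z \<theta>) \<le> R} w * G w)" for \<theta> w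
      unfolding GH by (auto simp: J_def indicator_def fold_dist_def z_def)
    have J2: "J \<theta> w = H w * indicator (fold_arc r R w) \<theta>" for \<theta> w
      by (auto simp: J_def indicator_def fold_arc_def fold_dist_def)
    have Jm: "case_prod J \<in> borel_measurable (lborel \<Otimes>\<^sub>M lborel)"
      unfolding J_def by measurable
    have pt: "ennreal (R\<^sup>2) * (indicator {-pi..pi} \<theta> * ennreal (norm (f (z \<theta>)) powr p * \<bar>sin \<theta>\<bar> powr L))
        \<le> ennreal (4 powr L * K) * (\<integral>\<^sup>+w. J \<theta> w \<partial>lborel)" for \<theta>
    proof (cases "\<theta> \<in> {-pi..pi}")
      case True
      have "\<bar>sin \<theta>\<bar> \<le> 4 * (\<bar>Im (z \<theta>)\<bar> + R)"
      proof -
        have "0 \<le> (1 - \<bar>sin \<theta>\<bar>) * (1 - r) + \<bar>sin \<theta>\<bar> * (3 * r)" using r by (intro add_nonneg_nonneg mult_nonneg_nonneg) auto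
        then have "\<bar>sin \<theta>\<bar> \<le> 4 * (r * \<bar>sin \<theta>\<bar>) + (1 - r)" by (simp add: algebra_simps)
        then show ?thesis using r R(2) by (simp add: z_def abs_mult)
      qed
      then have "\<bar>sin \<theta>\<bar> powr L \<le> (4 * (\<bar>Im (z \<theta>)\<bar> + R)) powr L" using L by (intro powr_mono2) auto
      also have "\<dots> = 4 powr L * (\<bar>Im (z \<theta>)\<bar> + R) powr L" by (rule powr_mult)
      finally have "R\<^sup>2 * (norm (f (z \<theta>)) powr p * \<bar>sin \<theta>\<bar> powr L)
          \<le> R\<^sup>2 * (norm (f (z \<theta>)) powr p * (4 powr L * (\<bar>Im (z \<theta>)\<bar> + R) powr L))"
        by (intro mult_left_mono) auto
      also have "\<dots> = 4 powr L * (norm (f (z \<theta>)) powr p * (R\<^sup>2 * (\<bar>Im (z \<theta>)\<bar> + R) powr L))" by simp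
      finally have "ennreal (R\<^sup>2 * (norm (f (z \<theta>)) powr p * \<bar>sin \<theta>\<bar> powr L))
          \<le> ennreal (4 powr L * (norm (f (z \<theta>)) powr p * (R\<^sup>2 * (\<bar>Im (z \<theta>)\<bar> + R) powr L)))"
        by (rule ennreal_leI)
      also have "\<dots> = ennreal (4 powr L) * ennreal (norm (f (z \<theta>)) powr p * (R\<^sup>2 * (\<bar>Im (z \<theta>)\<bar> + R) powr L))"
        by (rule ennreal_mult) auto
      also have "\<dots> \<le> ennreal (4 powr L) * (ennreal K * (\<integral>\<^sup>+w. indicator {w. fold_dist w (z \<theta>) \<le> R} w * G w \<partial>lborel))"
        using local by (rule mult_left_mono) simp
      also have "\<dots> = ennreal (4 powr L * K) * (\<integral>\<^sup>+w. J \<theta> w \<partial>lborel)"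
        using K True unfolding J1 by (simp add: ennreal_mult mult.assoc)
      finally show ?thesis using True by (simp add: ennreal_mult)
    qed simp
    let ?N = "\<integral>\<^sup>+\<theta>. indicator {-pi..pi} \<theta> * ennreal (norm (f (z \<theta>)) powr p * \<bar>sin \<theta>\<bar> powr L) \<partial>lborel"
    have zc: "continuous_on UNIV z" unfolding z_def by (intro continuous_intros)
    have fz: "continuous_on UNIV (\<lambda>\<theta>. f (z \<theta>))"
      by (rule continuous_on_compose2[OF \<open>continuous_on \<bbbD> f\<close> zc]) (use r in \<open>auto simp: z_def norm_mult\<close>)
    have [measurable]: "(\<lambda>\<theta>. f (z \<theta>)) \<in> borel_measurable borel"
      by (rule borel_measurable_continuous_onI[OF fz])
    have "ennreal (R\<^sup>2) * ?N = (\<integral>\<^sup>+\<theta>. ennreal (R\<^sup>2) * (indicator {-pi..pi} \<theta> * ennreal (norm (f (z \<theta>)) powr p * \<bar>sin \<theta>\<bar> powr L)) \<partial>lborel)"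
      by (rule nn_integral_cmult[symmetric]) measurable
    also have "\<dots> \<le> (\<integral>\<^sup>+\<theta>. ennreal (4 powr L * K) * (\<integral>\<^sup>+w. J \<theta> w \<partial>lborel) \<partial>lborel)"
      by (rule nn_integral_mono) (rule pt)
    also have "\<dots> = ennreal (4 powr L * K) * (\<integral>\<^sup>+\<theta>. (\<integral>\<^sup>+w. J \<theta> w \<partial>lborel) \<partial>lborel)"
      using Jm by (intro nn_integral_cmult) (simp add: lborel.borel_measurable_nn_integral)
    also have "(\<integral>\<^sup>+\<theta>. (\<integral>\<^sup>+w. J \<theta> w \<partial>lborel) \<partial>lborel) = (\<integral>\<^sup>+w. (\<integral>\<^sup>+\<theta>. J \<theta> w \<partial>lborel) \<partial>lborel)"
      using lborel_pair.Fubini'[OF Jm] by simp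
    also have "\<dots> \<le> (\<integral>\<^sup>+w. ennreal (64 * R) * (indicator {w \<in> \<bbbD>. (3 * r - 1) / 2 \<le> norm w} w * G w) \<partial>lborel)"
    proof (rule nn_integral_mono)
      fix w
      have arcm: "fold_arc r R w \<in> sets lborel"
      proof -
        have "fold_arc r R w = {-pi..pi} \<inter> {\<theta>. fold_dist w (of_real r * cis \<theta>) \<le> R}" by (auto simp: fold_arc_def)
        moreover have "closed {\<theta>. fold_dist w (of_real r * cis \<theta>) \<le> R}"
          by (intro closed_Collect_le continuous_intros)
        ultimately show ?thesis by (simp add: borel_closed closed_Int)
      qed
      have "(\<integral>\<^sup>+\<theta>. J \<theta> w \<partial>lborel) = H w * emeasure lborel (fold_arc r R w)"
        unfolding J2 by (rule nn_integral_cmult_indicator[OF arcm])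
      also have "\<dots> \<le> ennreal (64 * R) * (indicator {w \<in> \<bbbD>. (3 * r - 1) / 2 \<le> norm w} w * G w)"
      proof (cases "fold_arc r R w = {}")
        case True
        then show ?thesis by simp
      next
        case False
        then obtain \<theta> where "fold_dist w (z \<theta>) \<le> R" by (auto simp: fold_arc_def z_def)
        then have w: "w \<in> {w \<in> \<bbbD>. (3 * r - 1) / 2 \<le> norm w}" using sub[of \<theta>] by blast
        have "H w * emeasure lborel (fold_arc r R w) \<le> H w * ennreal (64 * R)"
          by (intro mult_left_mono fold_arc_measure[OF r R_def]) simp
        moreover have "H w = G w" using w by (simp add: H_def G_def)
        ultimately show ?thesis using w by (simp add: mult.commute)
      qed
      finally show "(\<integral>\<^sup>+\<theta>. J \<theta> w \<partial>lborel) \<le> ennreal (64 * R) * (indicator {w \<in> \<bbbD>. (3 * r - 1) / 2 \<le> norm w} w * G w)" .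
    qed
    also have "\<dots> = ennreal (64 * R) * tail_energy lam p f r"
    proof -
      have "indicator {w \<in> \<bbbD>. (3 * r - 1) / 2 \<le> norm w} w * G w = indicator {w \<in> \<bbbD>. (3 * r - 1) / 2 \<le> norm w} w * H w" for w
        by (auto simp: indicator_def G_def H_def)
      moreover have "(\<lambda>w. indicator {w \<in> \<bbbD>. (3 * r - 1) / 2 \<le> norm w} w * H w) \<in> borel_measurable lborel"
        using annulus_borel Hm by (intro borel_measurable_times_ennreal borel_measurable_indicator) simp_all
      ultimately show ?thesis unfolding tail_energy_def G_def[symmetric]
        by (simp add: nn_integral_cmult)
    qed
    finally have "ennreal (R\<^sup>2) * ?N \<le> ennreal (4 powr L * K) * (ennreal (64 * R) * tail_energy lam p f r)"
      by (simp add: mult_left_mono)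
    then have "ennreal (4 / R) * (ennreal (R\<^sup>2) * ?N) \<le> ennreal (4 / R) * (ennreal (4 powr L * K) * (ennreal (64 * R) * tail_energy lam p f r))"
      by (rule mult_left_mono) simp
    moreover have "ennreal (4 / R) * (ennreal (R\<^sup>2) * ?N) = ennreal (1 - r) * ?N"
      using R by (simp add: mult.assoc[symmetric] ennreal_mult[symmetric] power2_eq_square)
    moreover have "ennreal (4 / R) * (ennreal (4 powr L * K) * (ennreal (64 * R) * tail_energy lam p f r))
       = ennreal (4 * 64 * 4 powr L * K) * tail_energy lam p f r"
      using R K by (simp add: mult.assoc[symmetric] ennreal_mult[symmetric])
    ultimately have "ennreal (1 - r) * ?N \<le> ennreal (4 * 64 * 4 powr L * K) * tail_energy lam p f r" by simp
    also have "\<dots> \<le> ennreal C * tail_energy lam p f r"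
      using C by (intro mult_right_mono ennreal_leI) auto
    finally show "ennreal (1 - r) * (\<integral>\<^sup>+\<theta>. indicator {-pi..pi} \<theta> * ennreal (norm (f (of_real r * cis \<theta>)) powr p * \<bar>sin \<theta>\<bar> powr (2 * lam)) \<partial>lborel)
       \<le> ennreal C * tail_energy lam p f r" by (simp add: z_def L_def)
  qed
qed

section \<open>Tail energy and the growth of integral means\<close>

text \<open>
  The tail energies of a function of the Bergman space are integrals of one function \<open>g\<close> of finite integral over
  shrinking annuli, which is the form in which dominated convergence applies.
\<close>
lemma tail_energy_finite:
  assumes "lam \<ge> 0" "f \<in> bergman_space p lam"
  defines "I \<equiv> LINT z:\<bbbD>|sigma_measure lam. norm (f z) powr p"
  obtains g where "g \<in> borel_measurable lborel" "(\<integral>\<^sup>+w. g w \<partial>lborel) = ennreal I" "I \<ge> 0"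
    "\<And>r. tail_energy lam p f r = (\<integral>\<^sup>+w. indicator {w \<in> \<bbbD>. (3 * r - 1) / 2 \<le> norm w} w * g w \<partial>lborel)"
proof -
  have sm: "sigma_measure lam = density lborel (\<lambda>z. ennreal (sigma_density lam z))"
    by (simp add: sigma_measure_def sigma_density_def)
  define h where "h z = indicator \<bbbD> z *\<^sub>R (norm (f z) powr p)" for z
  have int: "integrable (sigma_measure lam) h"
    using assms(2) by (simp add: bergman_space_def set_integrable_def h_def[abs_def])
  have I: "I = (LINT z|sigma_measure lam. h z)"
    by (simp add: I_def set_lebesgue_integral_def h_def)
  have [measurable]: "h \<in> borel_measurable borel"
    using borel_measurable_integrable[OF int] by (simp add: sm)
  have h0: "h z \<ge> 0" for z by (simp add: h_def)
  define g where "g z = ennreal (sigma_density lam z) * ennreal (h z)" for z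
  have g: "g \<in> borel_measurable lborel" unfolding g_def by measurable
  have "(\<integral>\<^sup>+w. g w \<partial>lborel) = (\<integral>\<^sup>+z. ennreal (h z) \<partial>sigma_measure lam)"
    unfolding sm g_def by (rule nn_integral_density[symmetric]) measurable
  also have "\<dots> = ennreal I" unfolding I by (rule nn_integral_eq_integral[OF int]) (simp add: h0)
  finally have gI: "(\<integral>\<^sup>+w. g w \<partial>lborel) = ennreal I" .
  have "I \<ge> 0" unfolding I by (rule integral_nonneg_AE) (simp add: h0)
  moreover have "tail_energy lam p f r = (\<integral>\<^sup>+w. indicator {w \<in> \<bbbD>. (3 * r - 1) / 2 \<le> norm w} w * g w \<partial>lborel)" for r
    unfolding tail_energy_def
    by (intro nn_integral_cong)
       (auto simp: g_def h_def indicator_def ennreal_mult[symmetric] sigma_density_nonneg[OF assms(1)] mult.commute)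
  ultimately show ?thesis using that g gI by blast
qed

lemma tail_energy_le:
  assumes "lam \<ge> 0" "f \<in> bergman_space p lam"
  shows "tail_energy lam p f r \<le> ennreal (LINT z:\<bbbD>|sigma_measure lam. norm (f z) powr p)"
proof -
  obtain g where "g \<in> borel_measurable lborel"
    and g: "(\<integral>\<^sup>+w. g w \<partial>lborel) = ennreal (LINT z:\<bbbD>|sigma_measure lam. norm (f z) powr p)"
    and "0 \<le> (LINT z:\<bbbD>|sigma_measure lam. norm (f z) powr p)"
    and gt: "\<And>r. tail_energy lam p f r = (\<integral>\<^sup>+w. indicator {w \<in> \<bbbD>. (3 * r - 1) / 2 \<le> norm w} w * g w \<partial>lborel)"
    by (rule tail_energy_finite[OF assms]) blast
  show ?thesis unfolding g[symmetric] gt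
    by (intro nn_integral_mono) (simp add: indicator_def)
qed

lemma tail_energy_antimono: "r \<le> s \<Longrightarrow> tail_energy lam p f s \<le> tail_energy lam p f r"
  unfolding tail_energy_def by (intro nn_integral_mono) (auto simp: indicator_def)

lemma tail_energy_small:
  assumes "lam \<ge> 0" "f \<in> bergman_space p lam" "e > 0"
  shows "\<forall>\<^sub>F r in at_left 1. tail_energy lam p f r < ennreal e"
proof -
  define I where "I = (LINT z:\<bbbD>|sigma_measure lam. norm (f z) powr p)"
  obtain g where g: "g \<in> borel_measurable lborel" "(\<integral>\<^sup>+w. g w \<partial>lborel) = ennreal I" "0 \<le> I"
    "\<And>r. tail_energy lam p f r = (\<integral>\<^sup>+w. indicator {w \<in> \<bbbD>. (3 * r - 1) / 2 \<le> norm w} w * g w \<partial>lborel)"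
    unfolding I_def by (rule tail_energy_finite[OF assms(1,2)]) blast
  define t where "t n = 1 - inverse (real (Suc n))" for n
  have t1: "t \<longlonglongrightarrow> 1"
    unfolding t_def using tendsto_diff[OF tendsto_const[of 1] LIMSEQ_inverse_real_of_nat] by simp
  have "(\<lambda>n. \<integral>\<^sup>+w. indicator {w \<in> \<bbbD>. (3 * t n - 1) / 2 \<le> norm w} w * g w \<partial>lborel)
      \<longlonglongrightarrow> (\<integral>\<^sup>+w. 0 \<partial>(lborel :: complex measure))"
  proof (rule nn_integral_dominated_convergence[where w = g])
    show "(\<lambda>w. indicator {w \<in> \<bbbD>. (3 * t n - 1) / 2 \<le> norm w} w * g w) \<in> borel_measurable lborel" for n
      using g(1) annulus_borel by (intro borel_measurable_times_ennreal borel_measurable_indicator) simp_all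
    show "AE w in lborel. (\<lambda>n. indicator {w \<in> \<bbbD>. (3 * t n - 1) / 2 \<le> norm w} w * g w) \<longlonglongrightarrow> 0"
    proof (rule AE_I2)
      fix w :: complex
      have "\<forall>\<^sub>F n in sequentially. indicator {w \<in> \<bbbD>. (3 * t n - 1) / 2 \<le> norm w} w * g w = 0"
      proof (cases "w \<in> \<bbbD>")
        case True
        have "(\<lambda>n. (3 * t n - 1) / 2) \<longlonglongrightarrow> (3 * 1 - 1) / 2" by (intro tendsto_intros t1) simp
        then have "\<forall>\<^sub>F n in sequentially. (3 * t n - 1) / 2 > norm w"
          using True by (intro order_tendstoD) auto
        then show ?thesis by eventually_elim simp
      qed simp
      then show "(\<lambda>n. indicator {w \<in> \<bbbD>. (3 * t n - 1) / 2 \<le> norm w} w * g w) \<longlonglongrightarrow> 0"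
        by (rule tendsto_eventually)
    qed
  qed (use g in \<open>auto simp: indicator_def\<close>)
  then have "(\<lambda>n. tail_energy lam p f (t n)) \<longlonglongrightarrow> 0" by (simp add: g(4))
  then have "\<forall>\<^sub>F n in sequentially. tail_energy lam p f (t n) < ennreal e"
    using assms(3) by (intro order_tendstoD) auto
  then obtain n where n: "tail_energy lam p f (t n) < ennreal e" using eventually_happens by force
  have "\<forall>\<^sub>F r in at_left 1. r \<in> {t n<..<1}"
    by (rule eventually_at_left_real) (simp add: t_def)
  then show ?thesis
  proof eventually_elim
    case (elim r)
    then show ?case using tail_energy_antimono[of "t n" r lam p f] n by (auto intro: order.strict_trans1)
  qed
qed

text \<open>
  For finite \<open>\<ell>\<close> the pointwise bound enters with the power \<open>q = (\<ell> - p) / p\<close> and the mean of order \<open>p\<close> with the power 1;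
  after taking the root of order \<open>\<ell>\<close>, the tail energy has the exponent \<open>q / \<ell> + 1 / \<ell> = 1 / p\<close> and \<open>1 - r\<close> the exponent
  \<open>- (2\<lambda> + 2) q / \<ell> - 1 / \<ell> = - \<delta> (2\<lambda> + 1) - 1 / p\<close>.
\<close>
lemma integral_mean_le_tail:
  assumes "lam \<ge> 0" "p > 0" "ereal p \<le> l" "\<delta> = 1 / p - real_of_ereal (1 / l)"
  obtains c where "c > 0"
    "\<And>f r. f \<in> bergman_space p lam \<Longrightarrow> r \<in> {0..<1} \<Longrightarrow> 0 \<le> integral_mean lam l f r"
    "\<And>f r. f \<in> bergman_space p lam \<Longrightarrow> r \<in> {0..<1} \<Longrightarrow>
       integral_mean lam l f r \<le> c * (1 - r) powr (- \<delta> * (2 * lam + 1) - 1 / p) * enn2real (tail_energy lam p f r) powr (1 / p)"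
proof -
  define L where "L = 2 * lam"
  have L: "L \<ge> 0" using assms by (simp add: L_def)
  obtain C where C: "C > 0"
    and sup0: "\<And>f r \<theta>. lambda_analytic lam f \<Longrightarrow> 0 \<le> r \<Longrightarrow> r < 1 \<Longrightarrow>
       ennreal (norm (f (of_real r * cis \<theta>)) powr p * (1 - r) powr (2 * lam + 2)) \<le> ennreal C * tail_energy lam p f r"
    and int0: "\<And>f r. lambda_analytic lam f \<Longrightarrow> 0 \<le> r \<Longrightarrow> r < 1 \<Longrightarrow>
       ennreal (1 - r) * (\<integral>\<^sup>+\<theta>. indicator {-pi..pi} \<theta> * ennreal (norm (f (of_real r * cis \<theta>)) powr p * \<bar>sin \<theta>\<bar> powr (2 * lam)) \<partial>lborel)
       \<le> ennreal C * tail_energy lam p f r"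
    using circle_bounds[OF assms(1,2)] by blast
  define e where "e f r = enn2real (tail_energy lam p f r)" for f r
  have e0: "e f r \<ge> 0" for f r by (simp add: e_def)
  have ee: "tail_energy lam p f r = ennreal (e f r)" if "f \<in> bergman_space p lam" for f r
    using tail_energy_le[OF assms(1) that, of r] by (auto simp: e_def ennreal_enn2real_if top_unique)
  have an: "lambda_analytic lam f" if "f \<in> bergman_space p lam" for f using that by (simp add: bergman_space_def)
  define X where "X f r = C * e f r * (1 - r) powr (- (L + 2))" for f r
  have X0: "X f r \<ge> 0" for f r using C e0 by (simp add: X_def)
  have sup: "norm (f (of_real r * cis \<theta>)) powr p \<le> X f r" if "f \<in> bergman_space p lam" "r \<in> {0..<1}" for f r \<theta>
  proof -
    have "ennreal (norm (f (of_real r * cis \<theta>)) powr p * (1 - r) powr (L + 2)) \<le> ennreal (C * e f r)"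
      using sup0[OF an[OF that(1)], of r \<theta>] that C e0 by (simp add: ee L_def ennreal_mult)
    then have "norm (f (of_real r * cis \<theta>)) powr p * (1 - r) powr (L + 2) \<le> C * e f r"
      using C e0 by (subst (asm) ennreal_le_iff) auto
    moreover have "(1 - r) powr (L + 2) > 0" using that by simp
    ultimately show ?thesis unfolding X_def powr_minus by (simp only: divide_inverse[symmetric] pos_le_divide_eq)
  qed
  have contf: "continuous_on UNIV (\<lambda>\<theta>. f (of_real r * cis \<theta>))" if "f \<in> bergman_space p lam" "r \<in> {0..<1}" for f r
  proof -
    have "continuous_on \<bbbD> f"
      using lambda_analytic_solution[OF an[OF that(1)]] unfolding dunkl_solution_def partials_def by blast
    then show ?thesis
      by (rule continuous_on_compose2) (use that in \<open>auto intro!: continuous_intros simp: norm_mult\<close>)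
  qed
  show ?thesis
  proof (cases l)
    case MInf
    then show ?thesis using assms(3) by simp
  next
    case PInf
    have ex: "- \<delta> * (2 * lam + 1) - 1 / p = - (L + 2) * (1 / p)"
      using assms(2,4) PInf by (simp add: L_def field_simps)
    have pt: "norm (f (of_real r * cis \<theta>)) \<le> C powr (1 / p) * (1 - r) powr (- \<delta> * (2 * lam + 1) - 1 / p) * e f r powr (1 / p)"
      if "f \<in> bergman_space p lam" "r \<in> {0..<1}" for f r \<theta>
    proof -
      have "norm (f (of_real r * cis \<theta>)) = (norm (f (of_real r * cis \<theta>)) powr p) powr (1 / p)"
        using assms(2) by (simp add: powr_powr)
      also have "\<dots> \<le> X f r powr (1 / p)" using sup[OF that] assms(2) by (intro powr_mono2) auto
      also have "\<dots> = C powr (1 / p) * (1 - r) powr (- \<delta> * (2 * lam + 1) - 1 / p) * e f r powr (1 / p)"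
        unfolding X_def ex by (simp add: powr_mult powr_powr)
      finally show ?thesis .
    qed
    show ?thesis
    proof (rule that)
      show "C powr (1 / p) > 0" using C by simp
      fix f and r :: real assume fr: "f \<in> bergman_space p lam" "r \<in> {0..<1}"
      have im: "integral_mean lam l f r = (SUP \<theta>\<in>{-pi..pi}. norm (f (of_real r * cis \<theta>)))"
        using PInf by (simp add: integral_mean_def)
      have bdd: "bdd_above ((\<lambda>\<theta>. norm (f (of_real r * cis \<theta>))) ` {-pi..pi})"
        using pt[OF fr] by (rule bdd_aboveI2)
      show "0 \<le> integral_mean lam l f r" unfolding im
        by (rule cSUP_upper2[OF bdd, of 0]) auto
      show "integral_mean lam l f r \<le> C powr (1 / p) * (1 - r) powr (- \<delta> * (2 * lam + 1) - 1 / p) * enn2real (tail_energy lam p f r) powr (1 / p)"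
        unfolding im e_def[symmetric] by (rule cSUP_least) (use pt[OF fr] in auto)
    qed
  next
    case (real x)
    have x: "x \<ge> p" "x > 0" using assms(2,3) real by auto
    define c' where "c' = c_const lam / (2 * lam + 2)"
    have c': "c' > 0" using c_const_pos[OF assms(1)] assms(1) by (simp add: c'_def)
    define q where "q = (x - p) / p"
    have q: "q \<ge> 0" "p * q = x - p" using x assms(2) by (auto simp: q_def)
    have \<delta>: "\<delta> = 1 / p - 1 / x" using assms(4) real x by (simp add: one_ereal_def)
    have im: "integral_mean lam l f r = (LINT \<theta>:{-pi..pi}|m_measure lam. norm (f (of_real r * cis \<theta>)) powr x) powr (1 / x)" for f r
      using real by (simp add: integral_mean_def)
    have bound: "(LINT \<theta>:{-pi..pi}|m_measure lam. norm (f (of_real r * cis \<theta>)) powr x) \<le> c' * X f r powr q * (C * e f r / (1 - r))"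
      if fr: "f \<in> bergman_space p lam" "r \<in> {0..<1}" for f r
    proof -
      define F where "F \<theta> = norm (f (of_real r * cis \<theta>))" for \<theta>
      have [measurable]: "F \<in> borel_measurable borel"
        unfolding F_def by (intro borel_measurable_continuous_onI continuous_intros contf[OF fr])
      let ?N = "\<integral>\<^sup>+\<theta>. indicator {-pi..pi} \<theta> * ennreal (F \<theta> powr p * \<bar>sin \<theta>\<bar> powr L) \<partial>lborel"
      have D: "1 - r > 0" using fr by simp
      have "ennreal (1 - r) * ?N \<le> ennreal (C * e f r)"
        using int0[OF an[OF fr(1)], of r] fr C e0 by (simp add: ee L_def F_def ennreal_mult)
      then have "ennreal (1 / (1 - r)) * (ennreal (1 - r) * ?N) \<le> ennreal (1 / (1 - r)) * ennreal (C * e f r)"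
        by (rule mult_left_mono) simp
      then have N: "?N \<le> ennreal (C * e f r / (1 - r))"
        using D C e0 by (simp add: mult.assoc[symmetric] ennreal_mult[symmetric])
      have pw: "F \<theta> powr x \<le> X f r powr q * F \<theta> powr p" for \<theta>
      proof -
        have "F \<theta> powr x = (F \<theta> powr p) powr q * F \<theta> powr p"
          using q by (simp add: powr_powr powr_add[symmetric])
        also have "\<dots> \<le> X f r powr q * F \<theta> powr p"
          using sup[OF fr, of \<theta>] q by (intro mult_right_mono powr_mono2) (auto simp: F_def)
        finally show ?thesis .
      qed
      have "(\<integral>\<^sup>+\<theta>. ennreal (indicator {-pi..pi} \<theta> *\<^sub>R (F \<theta> powr x)) \<partial>m_measure lam)
          = (\<integral>\<^sup>+\<theta>. ennreal (c' * \<bar>sin \<theta>\<bar> powr L) * ennreal (indicator {-pi..pi} \<theta> *\<^sub>R (F \<theta> powr x)) \<partial>lborel)"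
        unfolding m_measure_def c'_def L_def by (rule nn_integral_density) measurable
      also have "\<dots> \<le> (\<integral>\<^sup>+\<theta>. ennreal (c' * X f r powr q) * (indicator {-pi..pi} \<theta> * ennreal (F \<theta> powr p * \<bar>sin \<theta>\<bar> powr L)) \<partial>lborel)"
      proof (rule nn_integral_mono)
        fix \<theta>
        have "c' * \<bar>sin \<theta>\<bar> powr L * F \<theta> powr x \<le> c' * \<bar>sin \<theta>\<bar> powr L * (X f r powr q * F \<theta> powr p)"
          using pw c' by (intro mult_left_mono) auto
        then have "ennreal (c' * \<bar>sin \<theta>\<bar> powr L * F \<theta> powr x) \<le> ennreal (c' * X f r powr q * (F \<theta> powr p * \<bar>sin \<theta>\<bar> powr L))"
          by (intro ennreal_leI) (simp add: mult_ac)
        then show "ennreal (c' * \<bar>sin \<theta>\<bar> powr L) * ennreal (indicator {-pi..pi} \<theta> *\<^sub>R (F \<theta> powr x))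
          \<le> ennreal (c' * X f r powr q) * (indicator {-pi..pi} \<theta> * ennreal (F \<theta> powr p * \<bar>sin \<theta>\<bar> powr L))"
          using c' by (auto simp: indicator_def ennreal_mult[symmetric])
      qed
      also have "\<dots> = ennreal (c' * X f r powr q) * ?N" by (rule nn_integral_cmult) measurable
      also have "\<dots> \<le> ennreal (c' * X f r powr q) * ennreal (C * e f r / (1 - r))" using N by (rule mult_left_mono) simp
      also have "\<dots> = ennreal (c' * X f r powr q * (C * e f r / (1 - r)))"
        using c' C e0 D by (intro ennreal_mult[symmetric]) auto
      finally have le: "(\<integral>\<^sup>+\<theta>. ennreal (indicator {-pi..pi} \<theta> *\<^sub>R (F \<theta> powr x)) \<partial>m_measure lam)
          \<le> ennreal (c' * X f r powr q * (C * e f r / (1 - r)))" .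
      have "(LINT \<theta>|m_measure lam. indicator {-pi..pi} \<theta> *\<^sub>R (F \<theta> powr x)) \<le> c' * X f r powr q * (C * e f r / (1 - r))"
        by (rule integral_real_bounded[OF _ le]) (use c' C e0 D in auto)
      then show ?thesis by (simp add: set_lebesgue_integral_def F_def)
    qed
    have ex: "- \<delta> * (2 * lam + 1) - 1 / p = - (L + 2) * (q * (1 / x)) + - 1 * (1 / x)"
      using assms(2) x by (simp add: \<delta> L_def q_def field_simps)
    have ex2: "1 / p = q * (1 / x) + 1 / x" using assms(2) x by (simp add: q_def field_simps)
    show ?thesis
    proof (rule that)
      show "c' powr (1 / x) * C powr (1 / p) > 0" using C c' by simp
      fix f and r :: real assume fr: "f \<in> bergman_space p lam" "r \<in> {0..<1}"
      have D: "1 - r > 0" using fr by simp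
      show "0 \<le> integral_mean lam l f r" unfolding im by simp
      have nn: "0 \<le> (LINT \<theta>:{-pi..pi}|m_measure lam. norm (f (of_real r * cis \<theta>)) powr x)"
        unfolding set_lebesgue_integral_def by (rule integral_nonneg_AE) simp
      have "integral_mean lam l f r \<le> (c' * X f r powr q * (C * e f r / (1 - r))) powr (1 / x)"
        unfolding im using bound[OF fr] nn x by (intro powr_mono2) auto
      also have "\<dots> = (c' * X f r powr q * (C * e f r * (1 - r) powr (- 1))) powr (1 / x)"
        using D by (simp add: powr_minus divide_inverse)
      also have "\<dots> = c' powr (1 / x) * ((C * e f r) powr (q * (1 / x)) * (C * e f r) powr (1 / x))
          * ((1 - r) powr (- (L + 2) * (q * (1 / x))) * (1 - r) powr (- 1 * (1 / x)))"
        unfolding X_def by (simp only: powr_mult powr_powr mult_ac)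
      also have "\<dots> = c' powr (1 / x) * (C * e f r) powr (1 / p) * (1 - r) powr (- \<delta> * (2 * lam + 1) - 1 / p)"
        unfolding ex by (simp only: ex2 powr_add)
      also have "\<dots> = c' powr (1 / x) * C powr (1 / p) * (1 - r) powr (- \<delta> * (2 * lam + 1) - 1 / p) * e f r powr (1 / p)"
        by (simp add: powr_mult)
      finally show "integral_mean lam l f r \<le> c' powr (1 / x) * C powr (1 / p) * (1 - r) powr (- \<delta> * (2 * lam + 1) - 1 / p) * enn2real (tail_energy lam p f r) powr (1 / p)"
        by (simp add: e_def)
    qed
  qed
qed

theorem theorem4p5:
  fixes lam p \<delta> :: real and l :: ereal
  assumes "lam \<ge> 0"
    and "2 * lam / (2 * lam + 1) \<le> p" and "p > 0"
    and "ereal p \<le> l"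
    and "\<delta> = 1 / p - real_of_ereal (1 / l)"
  shows "(\<forall>f \<in> bergman_space p lam.
            (\<lambda>r. integral_mean lam l f r)
              \<in> o[at_left 1](\<lambda>r. (1 - r) powr (- \<delta> * (2 * lam + 1) - 1 / p))) \<and>
         (\<exists>c > 0. \<forall>f \<in> bergman_space p lam. \<forall>r \<in> {0..<1}.
            integral_mean lam l f r
              \<le> c * (1 - r) powr (- \<delta> * (2 * lam + 1) - 1 / p) * bergman_norm p lam f)"
proof -
  obtain c where c: "c > 0"
    and nonneg: "\<And>f r. f \<in> bergman_space p lam \<Longrightarrow> r \<in> {0..<1} \<Longrightarrow> 0 \<le> integral_mean lam l f r"
    and le: "\<And>f r. f \<in> bergman_space p lam \<Longrightarrow> r \<in> {0..<1} \<Longrightarrow>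
       integral_mean lam l f r \<le> c * (1 - r) powr (- \<delta> * (2 * lam + 1) - 1 / p) * enn2real (tail_energy lam p f r) powr (1 / p)"
    using integral_mean_le_tail[OF assms(1,3,4,5)] by blast
  have "(\<lambda>r. integral_mean lam l f r) \<in> o[at_left 1](\<lambda>r. (1 - r) powr (- \<delta> * (2 * lam + 1) - 1 / p))"
    if f: "f \<in> bergman_space p lam" for f
  proof (rule landau_o.smallI)
    fix \<epsilon> :: real assume \<epsilon>: "\<epsilon> > 0"
    have pos: "(\<epsilon> / c) powr p > 0" using \<epsilon> c by simp
    have "\<forall>\<^sub>F r :: real in at_left 1. r \<in> {0<..<1}" by (rule eventually_at_left_real) simp
    then show "\<forall>\<^sub>F r in at_left 1. norm (integral_mean lam l f r) \<le> \<epsilon> * norm ((1 - r) powr (- \<delta> * (2 * lam + 1) - 1 / p))"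
      using tail_energy_small[OF assms(1) f pos]
    proof eventually_elim
      case (elim r)
      have "enn2real (tail_energy lam p f r) \<le> (\<epsilon> / c) powr p"
        using elim(2) by (intro enn2real_leI) auto
      then have "enn2real (tail_energy lam p f r) powr (1 / p) \<le> ((\<epsilon> / c) powr p) powr (1 / p)"
        using assms(3) by (intro powr_mono2) auto
      also have "\<dots> = \<epsilon> / c" using assms(3) \<epsilon> c by (simp add: powr_powr)
      finally have "c * (1 - r) powr (- \<delta> * (2 * lam + 1) - 1 / p) * enn2real (tail_energy lam p f r) powr (1 / p)
         \<le> c * (1 - r) powr (- \<delta> * (2 * lam + 1) - 1 / p) * (\<epsilon> / c)"
        using c by (intro mult_left_mono) auto
      also have "\<dots> = \<epsilon> * (1 - r) powr (- \<delta> * (2 * lam + 1) - 1 / p)" using c by simp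
      finally have "integral_mean lam l f r \<le> \<epsilon> * (1 - r) powr (- \<delta> * (2 * lam + 1) - 1 / p)"
        by (rule order_trans[OF le[OF f], rotated]) (use elim(1) in simp)
      then show ?case using nonneg[OF f, of r] elim(1) by simp
    qed
  qed
  moreover have "integral_mean lam l f r \<le> c * (1 - r) powr (- \<delta> * (2 * lam + 1) - 1 / p) * bergman_norm p lam f"
    if fr: "f \<in> bergman_space p lam" "r \<in> {0..<1}" for f r
  proof -
    define I where "I = (LINT z:\<bbbD>|sigma_measure lam. norm (f z) powr p)"
    have "I \<ge> 0" unfolding I_def by (rule tail_energy_finite[OF assms(1) fr(1)])
    then have "enn2real (tail_energy lam p f r) \<le> I"
      using tail_energy_le[OF assms(1) fr(1), of r] by (intro enn2real_leI) (auto simp: I_def)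
    then have "enn2real (tail_energy lam p f r) powr (1 / p) \<le> bergman_norm p lam f"
      unfolding bergman_norm_def I_def using assms(3) by (intro powr_mono2) auto
    then have "c * (1 - r) powr (- \<delta> * (2 * lam + 1) - 1 / p) * enn2real (tail_energy lam p f r) powr (1 / p)
        \<le> c * (1 - r) powr (- \<delta> * (2 * lam + 1) - 1 / p) * bergman_norm p lam f"
      using c by (intro mult_left_mono) auto
    then show ?thesis using le[OF fr] by linarith
  qed
  ultimately show ?thesis using c by blast
qed

end
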